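(* Let $H$ be a Hopf algebra, let $A$ be a right $H$-comodule algebra with coinvariant subalgebra $B$, and let $f\colon H\to A$ be a total integral which is an algebra map, with convolution inverse $f^{-1}=f\circ S$. Then $A_B=A/[A,B]$ is a left-right anti Yetter-Drinfeld module over $H$ by the coaction induced from the original coaction of $H$ on $A$ and the action $$ha=f(h^{(2)})\,a\,f^{-1}(h^{(1)}).$$ Furthermore, if $$a_{\langle 0\rangle}\,f^{-1}\big((a_{\langle 1\rangle})^{(1)}\big)\,f\big((a_{\langle 1\rangle})^{(2)}\big)=a ,$$ then this module is stable.
   Context: All Hopf algebras, algebras and coalgebras are over a field $k$, and every Hopf algebra $H$ has an invertible antipode $S$. Sweedler notation: $\Delta(h)=h^{(1)}\otimes h^{(2)}$ for coproducts and $a\mapsto a_{\langle 0\rangle}\otimes a_{\langle 1\rangle}$ for right coactions. The coinvariant subalgebra of a right $H$-comodule algebra $A$ is $B=\{a\in A: a_{\langle 0\rangle}\otimes a_{\langle 1\rangle}=a\otimes 1_H\}$, and $[A,B]$ is the linear span of all $ab-ba$, $a\in A$, $b\in B$. A total integral $f\colon H\to A$ is a linear map with $f(1)=1$ and $f(h^{(1)})\otimes h^{(2)}=f(h)_{\langle 0\rangle}\otimes f(h)_{\langle 1\rangle}$. A left $H$-module and right $H$-comodule $M$ (coaction $\rho$) is a left-right anti Yetter-Drinfeld module if $\rho(hm)=h^{(2)}m_{\langle 0\rangle}\otimes h^{(3)}m_{\langle 1\rangle}S(h^{(1)})$ for all $h,m$; it is stable if $m_{\langle 1\rangle}m_{\langle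 0\rangle}=m$ for all $m$. *)

theory Defs
  imports "HOL-Algebra.AbelCoset" "Jordan_Normal_Form.Missing_VectorSpace"
begin

section \<open>Quotients and tensor products of vector spaces\<close>

text \<open>
  Vector spaces and algebras over a field \<open>K\<close> are both HOL-Algebra records of type
  \<open>module\<close>, which extends \<open>ring\<close> by a scalar multiplication.  For a mere vector space the
  fields \<open>mult\<close> and \<open>one\<close> are irrelevant.
\<close>

definition ground_vs :: "('k, 'r) ring_scheme \<Rightarrow> ('k, 'k) module" where
  "ground_vs K = \<lparr>carrier = carrier K, mult = mult K, one = one K, zero = zero K,
     add = add K, smult = mult K\<rparr>"

definition quotient_vs :: "('k, 'v, 'm) module_scheme \<Rightarrow> 'v set \<Rightarrow> ('k, 'v set) module" where
  "quotient_vs V N = \<lparr>carrier = a_rcosets\<^bsub>V\<^esub> N, mult = undefined, one = undefined, zero = N,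
     add = set_add V, smult = (\<lambda>c X. set_add V N (smult V c ` X))\<rparr>"

text \<open>
  The map induced by \<open>g\<close> on cosets: the value of \<open>descend g\<close> at a coset \<open>X\<close> is the common value of
  \<open>g\<close> on \<open>X\<close>, which is meaningful only if \<open>g\<close> is constant on \<open>X\<close>.
\<close>

definition descend :: "('v \<Rightarrow> 'w) \<Rightarrow> 'v set \<Rightarrow> 'w" where
  "descend g X = the_elem (g ` X)"

text \<open>The vector space with basis \<open>X\<close>: finitely supported functions vanishing outside \<open>X\<close>.\<close>

definition free_vs :: "('k, 'r) ring_scheme \<Rightarrow> 'x set \<Rightarrow> ('k, 'x \<Rightarrow> 'k) module" where
  "free_vs K X =
     \<lparr>carrier = {g. range g \<subseteq> carrier K \<and> {x. g x \<noteq> \<zero>\<^bsub>K\<^esub>} \<subseteq> X \<and> finite {x. g x \<noteq> \<zero>\<^bsub>K\<^esub>}},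
      mult = undefined, one = undefined, zero = (\<lambda>_. \<zero>\<^bsub>K\<^esub>),
      add = (\<lambda>g h x. g x \<oplus>\<^bsub>K\<^esub> h x), smult = (\<lambda>c g x. c \<otimes>\<^bsub>K\<^esub> g x)\<rparr>"

definition free_basis :: "('k, 'r) ring_scheme \<Rightarrow> 'x \<Rightarrow> 'x \<Rightarrow> 'k" where
  "free_basis K x = (\<lambda>y. if y = x then \<one>\<^bsub>K\<^esub> else \<zero>\<^bsub>K\<^esub>)"

definition tensor_relations ::
  "('k, 'r) ring_scheme \<Rightarrow> ('k, 'v, 'm) module_scheme \<Rightarrow> ('k, 'w, 'n) module_scheme
   \<Rightarrow> ('v \<times> 'w \<Rightarrow> 'k) set" where
  "tensor_relations K V W =
     (let F = free_vs K (carrier V \<times> carrier W); e = (\<lambda>v w. free_basis K (v, w)) in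
      {e (v \<oplus>\<^bsub>V\<^esub> v') w \<ominus>\<^bsub>F\<^esub> (e v w \<oplus>\<^bsub>F\<^esub> e v' w) | v v' w.
         v \<in> carrier V \<and> v' \<in> carrier V \<and> w \<in> carrier W} \<union>
      {e v (w \<oplus>\<^bsub>W\<^esub> w') \<ominus>\<^bsub>F\<^esub> (e v w \<oplus>\<^bsub>F\<^esub> e v w') | v w w'.
         v \<in> carrier V \<and> w \<in> carrier W \<and> w' \<in> carrier W} \<union>
      {e (c \<odot>\<^bsub>V\<^esub> v) w \<ominus>\<^bsub>F\<^esub> (c \<odot>\<^bsub>F\<^esub> e v w) | c v w.
         c \<in> carrier K \<and> v \<in> carrier V \<and> w \<in> carrier W} \<union>
      {e v (c \<odot>\<^bsub>W\<^esub> w) \<ominus>\<^bsub>F\<^esub> (c \<odot>\<^bsub>F\<^esub> e v w) | c v w.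
         c \<in> carrier K \<and> v \<in> carrier V \<and> w \<in> carrier W})"

definition tensor_kernel ::
  "('k, 'r) ring_scheme \<Rightarrow> ('k, 'v, 'm) module_scheme \<Rightarrow> ('k, 'w, 'n) module_scheme
   \<Rightarrow> ('v \<times> 'w \<Rightarrow> 'k) set" where
  "tensor_kernel K V W =
     LinearCombinations.module.span K (free_vs K (carrier V \<times> carrier W)) (tensor_relations K V W)"

definition tensor_vs ::
  "('k, 'r) ring_scheme \<Rightarrow> ('k, 'v, 'm) module_scheme \<Rightarrow> ('k, 'w, 'n) module_scheme
   \<Rightarrow> ('k, ('v \<times> 'w \<Rightarrow> 'k) set) module" where
  "tensor_vs K V W = quotient_vs (free_vs K (carrier V \<times> carrier W)) (tensor_kernel K V W)"

text \<open>The elementary tensor \<open>v \<otimes> w\<close> of \<open>V \<otimes> W\<close>.\<close>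

definition tens ::
  "('k, 'r) ring_scheme \<Rightarrow> ('k, 'v, 'm) module_scheme \<Rightarrow> ('k, 'w, 'n) module_scheme
   \<Rightarrow> 'v \<Rightarrow> 'w \<Rightarrow> ('v \<times> 'w \<Rightarrow> 'k) set" where
  "tens K V W v w =
     tensor_kernel K V W +>\<^bsub>free_vs K (carrier V \<times> carrier W)\<^esub> free_basis K (v, w)"

text \<open>
  The linear map \<open>V \<otimes> W \<rightarrow> U\<close>, \<open>v \<otimes> w \<mapsto> \<phi> v w\<close>, induced by a bilinear map \<open>\<phi>\<close>.  This is how
  Sweedler notation is rendered: for bilinear \<open>\<phi>\<close>, the expression
  \<open>\<phi>(h\<^sup>(\<^sup>1\<^sup>), h\<^sup>(\<^sup>2\<^sup>))\<close> is \<open>tensor_lift K U \<phi> (\<Delta> h)\<close>.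
\<close>

definition tensor_lift ::
  "('k, 'r) ring_scheme \<Rightarrow> ('k, 'u, 'm) module_scheme \<Rightarrow> ('v \<Rightarrow> 'w \<Rightarrow> 'u)
   \<Rightarrow> ('v \<times> 'w \<Rightarrow> 'k) set \<Rightarrow> 'u" where
  "tensor_lift K U \<phi> =
     descend (\<lambda>g. \<Oplus>\<^bsub>U\<^esub>p\<in>{p. g p \<noteq> \<zero>\<^bsub>K\<^esub>}. g p \<odot>\<^bsub>U\<^esub> \<phi> (fst p) (snd p))"

text \<open>
  \<open>V \<otimes> W\<close> with the multiplication \<open>(x \<otimes> y) (x' \<otimes> y') = x x' \<otimes> y y'\<close>, which makes it an
  algebra if \<open>V\<close> and \<open>W\<close> are algebras.
\<close>

definition tensor ::
  "('k, 'r) ring_scheme \<Rightarrow> ('k, 'v, 'm) module_scheme \<Rightarrow> ('k, 'w, 'n) module_scheme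
   \<Rightarrow> ('k, ('v \<times> 'w \<Rightarrow> 'k) set) module" where
  "tensor K V W =
     (tensor_vs K V W)
       \<lparr>mult := (\<lambda>s t. tensor_lift K (tensor_vs K V W) (\<lambda>x y.
                   tensor_lift K (tensor_vs K V W) (\<lambda>x' y'.
                     tens K V W (x \<otimes>\<^bsub>V\<^esub> x') (y \<otimes>\<^bsub>W\<^esub> y')) t) s),
        one := tens K V W \<one>\<^bsub>V\<^esub> \<one>\<^bsub>W\<^esub>\<rparr>"

text \<open>\<open>f \<otimes> g\<close> with values in \<open>V \<otimes> W\<close>, and the associator \<open>(U \<otimes> V) \<otimes> W \<rightarrow> U \<otimes> (V \<otimes> W)\<close>.\<close>

definition tensor_map ::
  "('k, 'r) ring_scheme \<Rightarrow> ('k, 'v, 'm) module_scheme \<Rightarrow> ('k, 'w, 'n) module_scheme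
   \<Rightarrow> ('a \<Rightarrow> 'v) \<Rightarrow> ('b \<Rightarrow> 'w) \<Rightarrow> ('a \<times> 'b \<Rightarrow> 'k) set \<Rightarrow> ('v \<times> 'w \<Rightarrow> 'k) set" where
  "tensor_map K V W f g = tensor_lift K (tensor K V W) (\<lambda>x y. tens K V W (f x) (g y))"

definition tensor_assoc ::
  "('k, 'r) ring_scheme \<Rightarrow> ('k, 'u, 'l) module_scheme \<Rightarrow> ('k, 'v, 'm) module_scheme
   \<Rightarrow> ('k, 'w, 'n) module_scheme \<Rightarrow> (('u \<times> 'v \<Rightarrow> 'k) set \<times> 'w \<Rightarrow> 'k) set
   \<Rightarrow> ('u \<times> ('v \<times> 'w \<Rightarrow> 'k) set \<Rightarrow> 'k) set" where
  "tensor_assoc K U V W =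
     tensor_lift K (tensor K U (tensor K V W)) (\<lambda>t w.
       tensor_lift K (tensor K U (tensor K V W)) (\<lambda>u v.
         tens K U (tensor K V W) u (tens K V W v w)) t)"

text \<open>
  \<open>\<phi>(h\<^sup>(\<^sup>1\<^sup>), h\<^sup>(\<^sup>2\<^sup>), h\<^sup>(\<^sup>3\<^sup>))\<close> for a trilinear map \<open>\<phi>\<close> with values in \<open>U\<close>, computed via
  \<open>(\<Delta> \<otimes> id) \<Delta> h\<close>.
\<close>

definition sweedler3 ::
  "('k, 'r) ring_scheme \<Rightarrow> ('h \<Rightarrow> ('h \<times> 'h \<Rightarrow> 'k) set) \<Rightarrow> ('k, 'u, 'm) module_scheme
   \<Rightarrow> ('h \<Rightarrow> 'h \<Rightarrow> 'h \<Rightarrow> 'u) \<Rightarrow> 'h \<Rightarrow> 'u" where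
  "sweedler3 K \<Delta> U \<phi> h =
     tensor_lift K U (\<lambda>x z. tensor_lift K U (\<lambda>x' y. \<phi> x' y z) (\<Delta> x)) (\<Delta> h)"


section \<open>Hopf algebras and comodule algebras\<close>

text \<open>The locale \<open>algebra\<close> of HOL-Algebra is restricted to commutative algebras.\<close>

locale assoc_algebra = vectorspace K A + A?: ring A for K and A +
  assumes smult_mult_left:
    "\<lbrakk>c \<in> carrier K; x \<in> carrier A; y \<in> carrier A\<rbrakk>
      \<Longrightarrow> (c \<odot>\<^bsub>A\<^esub> x) \<otimes>\<^bsub>A\<^esub> y = c \<odot>\<^bsub>A\<^esub> (x \<otimes>\<^bsub>A\<^esub> y)"
    and smult_mult_right:
    "\<lbrakk>c \<in> carrier K; x \<in> carrier A; y \<in> carrier A\<rbrakk>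
      \<Longrightarrow> x \<otimes>\<^bsub>A\<^esub> (c \<odot>\<^bsub>A\<^esub> y) = c \<odot>\<^bsub>A\<^esub> (x \<otimes>\<^bsub>A\<^esub> y)"

locale coalgebra = vectorspace K C for K and C +
  fixes \<Delta> and \<epsilon>
  assumes comult_linear: "\<Delta> \<in> module_hom K C (tensor K C C)"
    and counit_linear: "\<epsilon> \<in> module_hom K C (ground_vs K)"
    and coassoc: "c \<in> carrier C \<Longrightarrow>
      tensor_assoc K C C C (tensor_map K (tensor K C C) C \<Delta> id (\<Delta> c))
        = tensor_map K C (tensor K C C) id \<Delta> (\<Delta> c)"
    and counit_left: "c \<in> carrier C \<Longrightarrow> tensor_lift K C (\<lambda>x y. \<epsilon> x \<odot>\<^bsub>C\<^esub> y) (\<Delta> c) = c"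
    and counit_right: "c \<in> carrier C \<Longrightarrow> tensor_lift K C (\<lambda>x y. \<epsilon> y \<odot>\<^bsub>C\<^esub> x) (\<Delta> c) = c"

locale hopf_algebra = assoc_algebra K H + coalgebra K H \<Delta> \<epsilon> for K and H and \<Delta> and \<epsilon> +
  fixes S
  assumes comult_hom: "\<Delta> \<in> ring_hom H (tensor K H H)"
    and counit_hom: "\<epsilon> \<in> ring_hom H K"
    and antipode_linear: "S \<in> module_hom K H H"
    and antipode_left: "h \<in> carrier H \<Longrightarrow>
      tensor_lift K H (\<lambda>x y. S x \<otimes>\<^bsub>H\<^esub> y) (\<Delta> h) = \<epsilon> h \<odot>\<^bsub>H\<^esub> \<one>\<^bsub>H\<^esub>"
    and antipode_right: "h \<in> carrier H \<Longrightarrow>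
      tensor_lift K H (\<lambda>x y. x \<otimes>\<^bsub>H\<^esub> S y) (\<Delta> h) = \<epsilon> h \<odot>\<^bsub>H\<^esub> \<one>\<^bsub>H\<^esub>"

locale right_comodule = C: coalgebra K C \<Delta> \<epsilon> + M: vectorspace K M
  for K and C and \<Delta> and \<epsilon> and M +
  fixes \<rho>
  assumes coaction_linear: "\<rho> \<in> module_hom K M (tensor K M C)"
    and coaction_coassoc: "m \<in> carrier M \<Longrightarrow>
      tensor_assoc K M C C (tensor_map K (tensor K M C) C \<rho> id (\<rho> m))
        = tensor_map K M (tensor K C C) id \<Delta> (\<rho> m)"
    and coaction_counit: "m \<in> carrier M \<Longrightarrow>
      tensor_lift K M (\<lambda>x c. \<epsilon> c \<odot>\<^bsub>M\<^esub> x) (\<rho> m) = m"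

locale comodule_algebra = H: hopf_algebra K H \<Delta> \<epsilon> S + A: assoc_algebra K A
    + right_comodule K H \<Delta> \<epsilon> A \<rho>
  for K and H and \<Delta> and \<epsilon> and S and A and \<rho> +
  assumes coaction_hom: "\<rho> \<in> ring_hom A (tensor K A H)"

definition coinvariants ::
  "('k, 'r) ring_scheme \<Rightarrow> ('k, 'h, 'm) module_scheme \<Rightarrow> ('k, 'a, 'n) module_scheme
   \<Rightarrow> ('a \<Rightarrow> ('a \<times> 'h \<Rightarrow> 'k) set) \<Rightarrow> 'a set" where
  "coinvariants K H A \<rho> = {a \<in> carrier A. \<rho> a = tens K A H a \<one>\<^bsub>H\<^esub>}"

definition commutator_span ::
  "('k, 'r) ring_scheme \<Rightarrow> ('k, 'a, 'n) module_scheme \<Rightarrow> 'a set \<Rightarrow> 'a set" where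
  "commutator_span K A B =
     LinearCombinations.module.span K A
       {a \<otimes>\<^bsub>A\<^esub> b \<ominus>\<^bsub>A\<^esub> b \<otimes>\<^bsub>A\<^esub> a | a b. a \<in> carrier A \<and> b \<in> B}"

definition total_integral ::
  "('k, 'r) ring_scheme \<Rightarrow> ('k, 'h, 'm) module_scheme \<Rightarrow> ('h \<Rightarrow> ('h \<times> 'h \<Rightarrow> 'k) set)
   \<Rightarrow> ('k, 'a, 'n) module_scheme \<Rightarrow> ('a \<Rightarrow> ('a \<times> 'h \<Rightarrow> 'k) set) \<Rightarrow> ('h \<Rightarrow> 'a) \<Rightarrow> bool" where
  "total_integral K H \<Delta> A \<rho> f \<longleftrightarrow>
     f \<in> module_hom K H A \<and> f \<one>\<^bsub>H\<^esub> = \<one>\<^bsub>A\<^esub> \<and>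
     (\<forall>h\<in>carrier H. tensor_map K A H f id (\<Delta> h) = \<rho> (f h))"

definition convolution ::
  "('k, 'r) ring_scheme \<Rightarrow> ('h \<Rightarrow> ('h \<times> 'h \<Rightarrow> 'k) set) \<Rightarrow> ('k, 'a, 'n) module_scheme
   \<Rightarrow> ('h \<Rightarrow> 'a) \<Rightarrow> ('h \<Rightarrow> 'a) \<Rightarrow> 'h \<Rightarrow> 'a" where
  "convolution K \<Delta> A f g h = tensor_lift K A (\<lambda>x y. f x \<otimes>\<^bsub>A\<^esub> g y) (\<Delta> h)"

definition convolution_inverse ::
  "('k, 'r) ring_scheme \<Rightarrow> ('k, 'h, 'm) module_scheme \<Rightarrow> ('h \<Rightarrow> ('h \<times> 'h \<Rightarrow> 'k) set)
   \<Rightarrow> ('h \<Rightarrow> 'k) \<Rightarrow> ('k, 'a, 'n) module_scheme \<Rightarrow> ('h \<Rightarrow> 'a) \<Rightarrow> ('h \<Rightarrow> 'a) \<Rightarrow> bool" where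
  "convolution_inverse K H \<Delta> \<epsilon> A f g \<longleftrightarrow>
     g \<in> module_hom K H A \<and>
     (\<forall>h\<in>carrier H. convolution K \<Delta> A f g h = \<epsilon> h \<odot>\<^bsub>A\<^esub> \<one>\<^bsub>A\<^esub> \<and>
                    convolution K \<Delta> A g f h = \<epsilon> h \<odot>\<^bsub>A\<^esub> \<one>\<^bsub>A\<^esub>)"


section \<open>Anti Yetter-Drinfeld modules\<close>

locale left_module = H: assoc_algebra K H + M: vectorspace K M for K and H and M +
  fixes act
  assumes act_linear_right: "h \<in> carrier H \<Longrightarrow> act h \<in> module_hom K M M"
    and act_linear_left: "m \<in> carrier M \<Longrightarrow> (\<lambda>h. act h m) \<in> module_hom K H M"
    and act_mult: "\<lbrakk>g \<in> carrier H; h \<in> carrier H; m \<in> carrier M\<rbrakk>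
      \<Longrightarrow> act (g \<otimes>\<^bsub>H\<^esub> h) m = act g (act h m)"
    and act_one: "m \<in> carrier M \<Longrightarrow> act \<one>\<^bsub>H\<^esub> m = m"

locale anti_yetter_drinfeld = H: hopf_algebra K H \<Delta> \<epsilon> S + left_module K H M act
    + right_comodule K H \<Delta> \<epsilon> M \<rho>
  for K and H and \<Delta> and \<epsilon> and S and M and act and \<rho> +
  assumes ayd: "\<lbrakk>h \<in> carrier H; m \<in> carrier M\<rbrakk> \<Longrightarrow>
    \<rho> (act h m) = sweedler3 K \<Delta> (tensor K M H) (\<lambda>h1 h2 h3.
      tensor_lift K (tensor K M H) (\<lambda>m0 m1.
        tens K M H (act h2 m0) (h3 \<otimes>\<^bsub>H\<^esub> m1 \<otimes>\<^bsub>H\<^esub> S h1)) (\<rho> m)) h"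

definition stable_module ::
  "('k, 'r) ring_scheme \<Rightarrow> ('k, 'm, 'n) module_scheme \<Rightarrow> ('h \<Rightarrow> 'm \<Rightarrow> 'm)
   \<Rightarrow> ('m \<Rightarrow> ('m \<times> 'h \<Rightarrow> 'k) set) \<Rightarrow> bool" where
  "stable_module K M act \<rho> \<longleftrightarrow>
     (\<forall>m\<in>carrier M. tensor_lift K M (\<lambda>m0 m1. act m1 m0) (\<rho> m) = m)"


section \<open>The quotient \<open>A\<^sub>B = A / [A, B]\<close>\<close>

definition AB_kernel ::
  "('k, 'r) ring_scheme \<Rightarrow> ('k, 'h, 'm) module_scheme \<Rightarrow> ('k, 'a, 'n) module_scheme
   \<Rightarrow> ('a \<Rightarrow> ('a \<times> 'h \<Rightarrow> 'k) set) \<Rightarrow> 'a set" where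
  "AB_kernel K H A \<rho> = commutator_span K A (coinvariants K H A \<rho>)"

definition AB ::
  "('k, 'r) ring_scheme \<Rightarrow> ('k, 'h, 'm) module_scheme \<Rightarrow> ('k, 'a, 'n) module_scheme
   \<Rightarrow> ('a \<Rightarrow> ('a \<times> 'h \<Rightarrow> 'k) set) \<Rightarrow> ('k, 'a set) module" where
  "AB K H A \<rho> = quotient_vs A (AB_kernel K H A \<rho>)"

definition AB_class ::
  "('k, 'r) ring_scheme \<Rightarrow> ('k, 'h, 'm) module_scheme \<Rightarrow> ('k, 'a, 'n) module_scheme
   \<Rightarrow> ('a \<Rightarrow> ('a \<times> 'h \<Rightarrow> 'k) set) \<Rightarrow> 'a \<Rightarrow> 'a set" where
  "AB_class K H A \<rho> a = AB_kernel K H A \<rho> +>\<^bsub>A\<^esub> a"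

text \<open>\<open>a \<mapsto> [a\<^sub>\<langle>\<^sub>0\<^sub>\<rangle>] \<otimes> a\<^sub>\<langle>\<^sub>1\<^sub>\<rangle>\<close> and the map it induces on \<open>A\<^sub>B\<close>.\<close>

definition AB_pre_coaction ::
  "('k, 'r) ring_scheme \<Rightarrow> ('k, 'h, 'm) module_scheme \<Rightarrow> ('k, 'a, 'n) module_scheme
   \<Rightarrow> ('a \<Rightarrow> ('a \<times> 'h \<Rightarrow> 'k) set) \<Rightarrow> 'a \<Rightarrow> ('a set \<times> 'h \<Rightarrow> 'k) set" where
  "AB_pre_coaction K H A \<rho> a = tensor_map K (AB K H A \<rho>) H (AB_class K H A \<rho>) id (\<rho> a)"

definition AB_coaction ::
  "('k, 'r) ring_scheme \<Rightarrow> ('k, 'h, 'm) module_scheme \<Rightarrow> ('k, 'a, 'n) module_scheme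
   \<Rightarrow> ('a \<Rightarrow> ('a \<times> 'h \<Rightarrow> 'k) set) \<Rightarrow> 'a set \<Rightarrow> ('a set \<times> 'h \<Rightarrow> 'k) set" where
  "AB_coaction K H A \<rho> = descend (AB_pre_coaction K H A \<rho>)"

text \<open>\<open>h a = f(h\<^sup>(\<^sup>2\<^sup>)) a f'(h\<^sup>(\<^sup>1\<^sup>))\<close> and the map it induces on \<open>A\<^sub>B\<close>; \<open>f'\<close> stands for \<open>f\<^sup>-\<^sup>1\<close>.\<close>

definition twisted_action ::
  "('k, 'r) ring_scheme \<Rightarrow> ('h \<Rightarrow> ('h \<times> 'h \<Rightarrow> 'k) set) \<Rightarrow> ('k, 'a, 'n) module_scheme
   \<Rightarrow> ('h \<Rightarrow> 'a) \<Rightarrow> ('h \<Rightarrow> 'a) \<Rightarrow> 'h \<Rightarrow> 'a \<Rightarrow> 'a" where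
  "twisted_action K \<Delta> A f f' h a = tensor_lift K A (\<lambda>h1 h2. f h2 \<otimes>\<^bsub>A\<^esub> a \<otimes>\<^bsub>A\<^esub> f' h1) (\<Delta> h)"

definition AB_action ::
  "('k, 'r) ring_scheme \<Rightarrow> ('k, 'h, 'm) module_scheme \<Rightarrow> ('h \<Rightarrow> ('h \<times> 'h \<Rightarrow> 'k) set)
   \<Rightarrow> ('k, 'a, 'n) module_scheme \<Rightarrow> ('a \<Rightarrow> ('a \<times> 'h \<Rightarrow> 'k) set)
   \<Rightarrow> ('h \<Rightarrow> 'a) \<Rightarrow> ('h \<Rightarrow> 'a) \<Rightarrow> 'h \<Rightarrow> 'a set \<Rightarrow> 'a set" where
  "AB_action K H \<Delta> A \<rho> f f' h =
     descend (\<lambda>a. AB_class K H A \<rho> (twisted_action K \<Delta> A f f' h a))"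

end

theory Submission
  imports Defs
begin

text \<open>
  Write \<open>B\<close> for the coinvariants and \<open>\<pi>(a) = a\<^sub>0 f(S a\<^sub>1)\<close>.  Everything rests on this map.

  The map \<open>\<pi>\<close> takes values in \<open>B\<close>.  Since \<open>\<rho>\<close> and \<open>f\<close> are multiplicative and
  \<open>\<rho>(f(S h)) = f(S h\<^sub>2) \<otimes> S h\<^sub>1\<close> (\<open>coaction_f_antipode\<close>), the coaction of \<open>\<pi>(a)\<close> is
  \<open>a\<^sub>0 f(S a\<^sub>3) \<otimes> a\<^sub>1 S(a\<^sub>2)\<close>, and the two middle legs cancel (\<open>comodule_antipode_cancel\<close>).

  For \<open>b \<in> B\<close> one has \<open>b f(S h) = f(S h\<^sub>1) \<pi>(f(h\<^sub>2) b)\<close> and \<open>f(h) b = \<pi>(f(h\<^sub>1) b) f(h\<^sub>2)\<close>.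
  Substituting the first into \<open>h(ab) = f(h\<^sub>2) a b f(S h\<^sub>1)\<close> and the second into \<open>h(ba)\<close> gives
  sums over the same triple coproduct of \<open>x \<pi>(y)\<close> and of \<open>\<pi>(y) x\<close>, where
  \<open>x = f(h\<^sub>3) a f(S h\<^sub>1)\<close> and \<open>y = f(h\<^sub>2) b\<close>.  These agree modulo \<open>[A, B]\<close>, so the action
  descends (\<open>hact_trace\<close>).  The coaction descends because \<open>\<rho>(ab) = a\<^sub>0 b \<otimes> a\<^sub>1\<close> and
  \<open>\<rho>(ba) = b a\<^sub>0 \<otimes> a\<^sub>1\<close>.

  The remaining identities are computed in \<open>A\<close> and then pushed to the quotient.  That the action is
  multiplicative is the antimultiplicativity of \<open>S\<close>.  The anti Yetter-Drinfeld identity holds already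
  in \<open>A \<otimes> H\<close>: both sides are \<open>f(h\<^sub>3) a\<^sub>0 f(S h\<^sub>2) \<otimes> h\<^sub>4 a\<^sub>1 S(h\<^sub>1)\<close> (\<open>coaction_hact\<close>).  For
  stability, \<open>a\<^sub>1 a\<^sub>0 = f(a\<^sub>2) a\<^sub>0 f(S a\<^sub>1) = f(a\<^sub>1) \<pi>(a\<^sub>0)\<close> is congruent to \<open>\<pi>(a\<^sub>0) f(a\<^sub>1)\<close>, which
  is \<open>a\<close> by the stability hypothesis.

  A Sweedler sum is the value of \<open>tensor_lift\<close> at a coproduct or a coaction, and three rules drive
  the computations: summands may be replaced inside a sum (\<open>tensor_lift_cong\<close>), linear maps may be
  moved across a sum (\<open>hom_tensor_lift\<close>), and iterated sums of a trilinear expression may be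
  regrouped (\<open>coassoc_lift\<close>).  Each step requires that the summand be multilinear; these side
  conditions are discharged syntactically by the rules collected in \<open>multilinear\<close>.
\<close>

section \<open>Linear maps\<close>

lemma module_hom_mem: "g \<in> module_hom K V W \<Longrightarrow> v \<in> carrier V \<Longrightarrow> g v \<in> carrier W"
  by (auto simp: module_hom_def)

lemma module_homI:
  assumes "\<And>v. v \<in> carrier V \<Longrightarrow> g v \<in> carrier W"
    and "\<And>v w. \<lbrakk>v \<in> carrier V; w \<in> carrier V\<rbrakk> \<Longrightarrow> g (v \<oplus>\<^bsub>V\<^esub> w) = g v \<oplus>\<^bsub>W\<^esub> g w"
    and "\<And>c v. \<lbrakk>c \<in> carrier K; v \<in> carrier V\<rbrakk> \<Longrightarrow> g (c \<odot>\<^bsub>V\<^esub> v) = c \<odot>\<^bsub>W\<^esub> g v"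
  shows "g \<in> module_hom K V W"
  using assms by (auto simp: module_hom_def)

lemma mod_hom_of_module_hom:
  assumes "vectorspace K V" "vectorspace K W" "g \<in> module_hom K V W"
  shows "mod_hom K V W g"
  using assms by (simp add: mod_hom_def mod_hom_axioms_def vectorspace_def)

lemma module_hom_minus:
  assumes "vectorspace K V" "vectorspace K W" "g \<in> module_hom K V W"
    and "v \<in> carrier V" "w \<in> carrier V"
  shows "g (v \<ominus>\<^bsub>V\<^esub> w) = g v \<ominus>\<^bsub>W\<^esub> g w"
  by (rule mod_hom.f_minus[OF mod_hom_of_module_hom[OF assms(1-3)] assms(4,5)])

text \<open>
  The kernel is a submodule, so it contains a span as soon as it contains the generators.  This is
  how maps out of the tensor product and out of \<open>A / [A, B]\<close> are shown to be well defined.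
\<close>

lemma module_hom_vanishes_on_span:
  assumes V: "vectorspace K V" and W: "vectorspace K W" and g: "g \<in> module_hom K V W"
    and X: "X \<subseteq> carrier V" "\<And>x. x \<in> X \<Longrightarrow> g x = \<zero>\<^bsub>W\<^esub>" and v: "v \<in> LinearCombinations.module.span K V X"
  shows "g v = \<zero>\<^bsub>W\<^esub>"
proof -
  interpret g: mod_hom K V W g by (rule mod_hom_of_module_hom[OF V W g])
  have "X \<subseteq> g.ker" using X by (auto simp: g.ker_def)
  then have "LinearCombinations.module.span K V X \<subseteq> g.ker"
    by (rule g.M.span_is_subset[OF _ g.ker_is_submodule])
  with v show ?thesis by (auto simp: g.ker_def)
qed

section \<open>Quotients\<close>

context subspace
begin

interpretation V: vectorspace K V by (rule vs)

interpretation N: submodule K W V by (rule submod)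

lemma uminus_mem: "x \<in> W \<Longrightarrow> \<ominus> x \<in> W"
  using N.smult_closed[of "\<ominus>\<^bsub>K\<^esub> \<one>\<^bsub>K\<^esub>" x] N.subset
  by (metis V.R.add.inv_closed V.R.one_closed V.smult_minus_1 subsetD)

interpretation N: abelian_subgroup W V
proof (rule abelian_subgroupI3)
  show "additive_subgroup W V"
  proof (rule additive_subgroupI)
    show "subgroup W (add_monoid V)"
      by (rule V.add.subgroupI)
        (use N.subset N.zero_closed N.m_closed uminus_mem in \<open>auto simp: a_inv_def simp del: N.zero_closed\<close>)
  qed
qed (rule V.M.abelian_group_axioms)

lemma quotient_carrierE:
  assumes "X \<in> carrier (quotient_vs V W)"
  obtains v where "v \<in> carrier V" "X = W +>\<^bsub>V\<^esub> v"
  using assms by (auto simp: quotient_vs_def A_RCOSETS_def' a_r_coset_def')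

lemma coset_mem: "v \<in> carrier V \<Longrightarrow> W +>\<^bsub>V\<^esub> v \<in> carrier (quotient_vs V W)"
  by (auto simp: quotient_vs_def A_RCOSETS_def' a_r_coset_def')

lemma coset_add:
  "\<lbrakk>v \<in> carrier V; w \<in> carrier V\<rbrakk>
    \<Longrightarrow> W +>\<^bsub>V\<^esub> (v \<oplus> w) = (W +>\<^bsub>V\<^esub> v) \<oplus>\<^bsub>quotient_vs V W\<^esub> (W +>\<^bsub>V\<^esub> w)"
  by (simp add: quotient_vs_def N.a_rcos_sum)

text \<open>
  The scalar action on cosets is \<open>N + c X\<close> and not \<open>c X\<close>; the extra summand matters only for
  \<open>c = 0\<close>, where \<open>c X\<close> is a single point.
\<close>

lemma coset_smult:
  assumes c: "c \<in> carrier K" and v: "v \<in> carrier V"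
  shows "W +>\<^bsub>V\<^esub> (c \<odot>\<^bsub>V\<^esub> v) = c \<odot>\<^bsub>quotient_vs V W\<^esub> (W +>\<^bsub>V\<^esub> v)" (is "?L = ?R")
proof -
  have R: "?R = {n \<oplus> (c \<odot>\<^bsub>V\<^esub> (n' \<oplus> v)) | n n'. n \<in> W \<and> n' \<in> W}"
    by (auto simp: quotient_vs_def set_add_def' a_r_coset_def')
  show ?thesis
  proof
    show "?L \<subseteq> ?R"
    proof
      fix x assume "x \<in> ?L"
      then obtain n where n: "n \<in> W" "x = n \<oplus> c \<odot>\<^bsub>V\<^esub> v" by (auto simp: a_r_coset_def')
      then have "x = n \<oplus> c \<odot>\<^bsub>V\<^esub> (\<zero> \<oplus> v)" using v by simp
      with n show "x \<in> ?R" unfolding R using N.zero_closed by blast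
    qed
    show "?R \<subseteq> ?L"
    proof
      fix x assume "x \<in> ?R"
      then obtain n n' where n: "n \<in> W" "n' \<in> W" "x = n \<oplus> c \<odot>\<^bsub>V\<^esub> (n' \<oplus> v)" unfolding R by blast
      moreover have "n \<in> carrier V" "n' \<in> carrier V" using n N.subset by auto
      ultimately have "x = (n \<oplus> c \<odot>\<^bsub>V\<^esub> n') \<oplus> c \<odot>\<^bsub>V\<^esub> v"
        using c v by (simp add: V.smult_r_distr V.M.a_assoc)
      moreover have "n \<oplus> c \<odot>\<^bsub>V\<^esub> n' \<in> W" using n c by simp
      ultimately show "x \<in> ?L" by (auto simp: a_r_coset_def')
    qed
  qed
qed

lemma coset_zero: "W +>\<^bsub>V\<^esub> \<zero> = \<zero>\<^bsub>quotient_vs V W\<^esub>"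
  by (simp add: quotient_vs_def N.a_rcos_const)

lemma coset_hom: "(\<lambda>v. W +>\<^bsub>V\<^esub> v) \<in> module_hom K V (quotient_vs V W)"
  by (auto intro!: module_homI coset_mem coset_add coset_smult)

lemma vectorspace_quotient: "vectorspace K (quotient_vs V W)"
proof -
  let ?Q = "quotient_vs V W"
  note hom = coset_add[symmetric] coset_smult[symmetric] coset_mem coset_zero[symmetric]
  have neg: "\<exists>Y\<in>carrier ?Q. X \<oplus>\<^bsub>?Q\<^esub> Y = \<zero>\<^bsub>?Q\<^esub>" if "X \<in> carrier ?Q" for X
    using that
  proof (rule quotient_carrierE)
    fix x assume "x \<in> carrier V" "X = W +>\<^bsub>V\<^esub> x"
    then show ?thesis
      by (intro bexI[of _ "W +>\<^bsub>V\<^esub> (\<ominus> x)"]) (auto simp: hom V.M.r_neg)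
  qed
  show ?thesis
    by (rule vs_criteria; (intro allI ballI impI)?; (elim conjE)?; (elim quotient_carrierE)?;
        (rule neg)?)
      (auto simp: hom V.field_axioms V.M.a_ac V.smult_assoc1 V.smult_l_distr V.smult_r_distr)
qed

lemma coset_eqI:
  assumes "v \<in> carrier V" "w \<in> carrier V" "v \<ominus> w \<in> W"
  shows "W +>\<^bsub>V\<^esub> v = W +>\<^bsub>V\<^esub> w"
  using assms N.a_rcos_module_rev[of w v] N.a_repr_independence' by (metis a_minus_def)

lemma descend_coset:
  assumes U: "vectorspace K U" and g: "g \<in> module_hom K V U"
    and ker: "\<And>x. x \<in> W \<Longrightarrow> g x = \<zero>\<^bsub>U\<^esub>" and v: "v \<in> carrier V"
  shows "descend g (W +>\<^bsub>V\<^esub> v) = g v"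
proof -
  interpret U: vectorspace K U by (rule U)
  have "g ` (W +>\<^bsub>V\<^esub> v) = {g v}"
  proof safe
    fix y assume "y \<in> W +>\<^bsub>V\<^esub> v"
    then obtain n where n: "n \<in> W" "y = n \<oplus> v" by (auto simp: a_r_coset_def')
    then show "g y = g v"
      using ker[of n] v N.subset module_hom_mem[OF g v] by (simp add: module_hom_add[OF g] subsetD)
  next
    show "g v \<in> g ` (W +>\<^bsub>V\<^esub> v)" using N.a_rcos_self[OF v] by blast
  qed
  then show ?thesis by (simp add: descend_def)
qed

lemma descend_hom:
  assumes U: "vectorspace K U" and g: "g \<in> module_hom K V U"
    and ker: "\<And>x. x \<in> W \<Longrightarrow> g x = \<zero>\<^bsub>U\<^esub>"
  shows "descend g \<in> module_hom K (quotient_vs V W) U"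
  by (rule module_homI; elim quotient_carrierE)
    (auto simp: coset_add[symmetric] coset_smult[symmetric] descend_coset[OF assms]
      module_hom_mem[OF g] module_hom_add[OF g] module_hom_smult[OF g])

end

section \<open>Free vector spaces\<close>

definition free_extension ::
  "('k, 'r) ring_scheme \<Rightarrow> ('k, 'u, 'm) module_scheme \<Rightarrow> ('x \<Rightarrow> 'u) \<Rightarrow> ('x \<Rightarrow> 'k) \<Rightarrow> 'u" where
  "free_extension K U \<phi> g = (\<Oplus>\<^bsub>U\<^esub>p\<in>{p. g p \<noteq> \<zero>\<^bsub>K\<^esub>}. g p \<odot>\<^bsub>U\<^esub> \<phi> p)"

lemma free_vs_memI:
  "\<lbrakk>\<And>x. g x \<in> carrier K; {x. g x \<noteq> \<zero>\<^bsub>K\<^esub>} \<subseteq> Y; Y \<subseteq> X; finite Y\<rbrakk> \<Longrightarrow> g \<in> carrier (free_vs K X)"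
  by (auto simp: free_vs_def finite_subset)

lemma free_vs_memD:
  assumes "g \<in> carrier (free_vs K X)"
  shows "\<And>x. g x \<in> carrier K" "{x. g x \<noteq> \<zero>\<^bsub>K\<^esub>} \<subseteq> X" "finite {x. g x \<noteq> \<zero>\<^bsub>K\<^esub>}"
  using assms by (auto simp: free_vs_def)

lemma free_vs_simps [simp]:
  "\<zero>\<^bsub>free_vs K X\<^esub> = (\<lambda>_. \<zero>\<^bsub>K\<^esub>)"
  "g \<oplus>\<^bsub>free_vs K X\<^esub> h = (\<lambda>x. g x \<oplus>\<^bsub>K\<^esub> h x)"
  "c \<odot>\<^bsub>free_vs K X\<^esub> g = (\<lambda>x. c \<otimes>\<^bsub>K\<^esub> g x)"
  by (simp_all add: free_vs_def)

lemma vectorspace_free_vs: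
  assumes "field K"
  shows "vectorspace K (free_vs K X)"
proof -
  interpret K: field K by (rule assms)
  let ?F = "free_vs K X"
  have add: "(\<lambda>x. g x \<oplus>\<^bsub>K\<^esub> h x) \<in> carrier ?F" if "g \<in> carrier ?F" "h \<in> carrier ?F" for g h
    by (rule free_vs_memI[where Y = "{x. g x \<noteq> \<zero>\<^bsub>K\<^esub>} \<union> {x. h x \<noteq> \<zero>\<^bsub>K\<^esub>}"])
      (use free_vs_memD[OF that(1)] free_vs_memD[OF that(2)] in auto)
  have smult: "(\<lambda>x. c \<otimes>\<^bsub>K\<^esub> g x) \<in> carrier ?F" if "g \<in> carrier ?F" "c \<in> carrier K" for g c
    by (rule free_vs_memI[where Y = "{x. g x \<noteq> \<zero>\<^bsub>K\<^esub>}"])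
      (use free_vs_memD[OF that(1)] that(2) in auto)
  show ?thesis
  proof (rule vs_criteria, safe)
    fix g assume g: "g \<in> carrier ?F"
    note [simp] = free_vs_memD(1)[OF g]
    have "(\<lambda>x. \<ominus>\<^bsub>K\<^esub> g x) \<in> carrier ?F"
      by (rule free_vs_memI[where Y = "{x. g x \<noteq> \<zero>\<^bsub>K\<^esub>}"]) (use free_vs_memD[OF g] in auto)
    then show "\<exists>h\<in>carrier ?F. g \<oplus>\<^bsub>?F\<^esub> h = \<zero>\<^bsub>?F\<^esub>"
      by (rule bexI[rotated]) (simp add: K.r_neg)
  qed (auto simp: assms add smult free_vs_memD(1) K.a_ac K.m_ac K.l_distr K.r_distr
       intro!: free_vs_memI[where Y = "{}" and X = X])
qed

lemma free_basis_mem: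
  assumes "field K" "x \<in> X"
  shows "free_basis K x \<in> carrier (free_vs K X)"
proof -
  interpret K: field K by (rule assms)
  show ?thesis
    by (rule free_vs_memI[where Y = "{x}"]) (use assms in \<open>auto simp: free_basis_def\<close>)
qed

context
  fixes K :: "('k, 'r) ring_scheme" and U :: "('k, 'u, 'm) module_scheme" and X :: "'x set"
    and \<phi> :: "'x \<Rightarrow> 'u"
  assumes U: "vectorspace K U" and phi: "\<And>x. x \<in> X \<Longrightarrow> \<phi> x \<in> carrier U"
begin

interpretation U: vectorspace K U by (rule U)

text \<open>
  Evaluating over any finite set containing the support allows two functions with different
  supports to be compared term by term.
\<close>

lemma free_extension_superset:
  assumes "finite Y" "Y \<subseteq> X" "{x. g x \<noteq> \<zero>\<^bsub>K\<^esub>} \<subseteq> Y" "\<And>x. g x \<in> carrier K"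
  shows "free_extension K U \<phi> g = (\<Oplus>\<^bsub>U\<^esub>p\<in>Y. g p \<odot>\<^bsub>U\<^esub> \<phi> p)"
  unfolding free_extension_def
  by (rule U.M.add.finprod_mono_neutral_cong_left) (use assms phi in \<open>auto simp: subset_iff\<close>)

lemma free_extension_hom: "free_extension K U \<phi> \<in> module_hom K (free_vs K X) U"
proof (rule module_homI)
  let ?F = "free_vs K X"
  fix g assume g: "g \<in> carrier ?F"
  note g' = free_vs_memD[OF g]
  show "free_extension K U \<phi> g \<in> carrier U"
    unfolding free_extension_def using g' phi by (auto intro!: U.M.finsum_closed)
  { fix h assume h: "h \<in> carrier ?F"
    note h' = free_vs_memD[OF h]
    let ?Y = "{x. g x \<noteq> \<zero>\<^bsub>K\<^esub>} \<union> {x. h x \<noteq> \<zero>\<^bsub>K\<^esub>}"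
    have Y: "finite ?Y" "?Y \<subseteq> X" using g' h' by auto
    have mem: "x \<in> ?Y \<Longrightarrow> \<phi> x \<in> carrier U" for x using Y phi by blast
    have "free_extension K U \<phi> (g \<oplus>\<^bsub>?F\<^esub> h) = (\<Oplus>\<^bsub>U\<^esub>p\<in>?Y. (g p \<oplus>\<^bsub>K\<^esub> h p) \<odot>\<^bsub>U\<^esub> \<phi> p)"
      using g' h' by (subst free_extension_superset[OF Y]) auto
    also have "\<dots> = (\<Oplus>\<^bsub>U\<^esub>p\<in>?Y. g p \<odot>\<^bsub>U\<^esub> \<phi> p \<oplus>\<^bsub>U\<^esub> h p \<odot>\<^bsub>U\<^esub> \<phi> p)"
      by (rule U.M.finsum_cong') (use g' h' mem in \<open>auto simp: U.smult_l_distr\<close>)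
    also have "\<dots> = (\<Oplus>\<^bsub>U\<^esub>p\<in>?Y. g p \<odot>\<^bsub>U\<^esub> \<phi> p) \<oplus>\<^bsub>U\<^esub> (\<Oplus>\<^bsub>U\<^esub>p\<in>?Y. h p \<odot>\<^bsub>U\<^esub> \<phi> p)"
      by (rule U.M.finsum_addf) (use g' h' mem in auto)
    also have "\<dots> = free_extension K U \<phi> g \<oplus>\<^bsub>U\<^esub> free_extension K U \<phi> h"
      using free_extension_superset[OF Y, of g] free_extension_superset[OF Y, of h] g' h' by auto
    finally show "free_extension K U \<phi> (g \<oplus>\<^bsub>?F\<^esub> h) = free_extension K U \<phi> g \<oplus>\<^bsub>U\<^esub> free_extension K U \<phi> h" . }
  fix c assume c: "c \<in> carrier K"
  let ?Y = "{x. g x \<noteq> \<zero>\<^bsub>K\<^esub>}"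
  have mem: "x \<in> ?Y \<Longrightarrow> \<phi> x \<in> carrier U" for x using g' phi by blast
  have "free_extension K U \<phi> (c \<odot>\<^bsub>?F\<^esub> g) = (\<Oplus>\<^bsub>U\<^esub>p\<in>?Y. (c \<otimes>\<^bsub>K\<^esub> g p) \<odot>\<^bsub>U\<^esub> \<phi> p)"
    using g' c by (subst free_extension_superset[OF g'(3,2)]) auto
  also have "\<dots> = (\<Oplus>\<^bsub>U\<^esub>p\<in>?Y. c \<odot>\<^bsub>U\<^esub> (g p \<odot>\<^bsub>U\<^esub> \<phi> p))"
    by (rule U.M.finsum_cong') (use g' c mem in \<open>auto simp: U.smult_assoc1\<close>)
  also have "\<dots> = c \<odot>\<^bsub>U\<^esub> free_extension K U \<phi> g"
    unfolding free_extension_def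
    by (rule U.finsum_smult[symmetric]) (use g' c mem in auto)
  finally show "free_extension K U \<phi> (c \<odot>\<^bsub>?F\<^esub> g) = c \<odot>\<^bsub>U\<^esub> free_extension K U \<phi> g" .
qed

lemma free_extension_basis:
  assumes "x \<in> X"
  shows "free_extension K U \<phi> (free_basis K x) = \<phi> x"
proof -
  have "{y. free_basis K x y \<noteq> \<zero>\<^bsub>K\<^esub>} = {x}" by (auto simp: free_basis_def)
  then show ?thesis
    using phi[OF assms] by (simp add: free_extension_def free_basis_def)
qed

end

lemma free_vs_induct [consumes 2, case_names zero basis add]:
  assumes K: "field K" and g: "g \<in> carrier (free_vs K X)"
    and zero: "P (\<lambda>_. \<zero>\<^bsub>K\<^esub>)"
    and basis: "\<And>c x. \<lbrakk>c \<in> carrier K; x \<in> X\<rbrakk> \<Longrightarrow> P (c \<odot>\<^bsub>free_vs K X\<^esub> free_basis K x)"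
    and add: "\<And>g h. \<lbrakk>g \<in> carrier (free_vs K X); h \<in> carrier (free_vs K X); P g; P h\<rbrakk>
      \<Longrightarrow> P (g \<oplus>\<^bsub>free_vs K X\<^esub> h)"
  shows "P g"
proof -
  interpret K: field K by (rule K)
  interpret F: vectorspace K "free_vs K X" by (rule vectorspace_free_vs[OF K])
  have "P g" if "finite Y" "g \<in> carrier (free_vs K X)" "{x. g x \<noteq> \<zero>\<^bsub>K\<^esub>} = Y" for Y g
    using that
  proof (induction Y arbitrary: g rule: finite_induct)
    case empty
    then have "g = (\<lambda>_. \<zero>\<^bsub>K\<^esub>)" by auto
    then show ?case using zero by simp
  next
    case (insert x Y)
    note g = free_vs_memD[OF insert.prems(1)]
    have x: "x \<in> X" using insert.prems(2) g(2) by auto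
    let ?b = "g x \<odot>\<^bsub>free_vs K X\<^esub> free_basis K x" and ?h = "g(x := \<zero>\<^bsub>K\<^esub>)"
    have h: "?h \<in> carrier (free_vs K X)"
      by (rule free_vs_memI[where Y = Y]) (use g insert in \<open>auto simp: fun_upd_def\<close>)
    have b: "?b \<in> carrier (free_vs K X)"
      using F.smult_closed[OF g(1) free_basis_mem[OF K x]] .
    have "{y. ?h y \<noteq> \<zero>\<^bsub>K\<^esub>} = Y" using insert by (auto simp: fun_upd_def)
    then have "P ?h" by (rule insert.IH[OF h])
    moreover have "P ?b" by (rule basis[OF g(1) x])
    moreover have "g = ?b \<oplus>\<^bsub>free_vs K X\<^esub> ?h"
      by (rule ext) (use g in \<open>auto simp: free_basis_def\<close>)
    ultimately show ?case using add[OF b h] by simp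
  qed
  then show ?thesis using free_vs_memD(3)[OF g] g by blast
qed

section \<open>Linear and multilinear maps\<close>

named_theorems multilinear

text \<open>
  Both conditions are phrased with explicit abstractions \<open>\<lambda>w. \<phi> v w\<close>, so that after unfolding a
  concrete \<open>\<phi>\<close> the goals have the shape \<open>(\<lambda>z. t z) \<in> module_hom K Z U\<close> on which the rules in
  \<open>multilinear\<close> operate.  In a multilinear expression the variable \<open>z\<close> occurs exactly once, and each
  rule strips the outermost operation around that occurrence.
\<close>

definition bilinear ::
  "('k, 'r) ring_scheme \<Rightarrow> ('k, 'v, 'l) module_scheme \<Rightarrow> ('k, 'w, 'm) module_scheme
    \<Rightarrow> ('k, 'u, 'n) module_scheme \<Rightarrow> ('v \<Rightarrow> 'w \<Rightarrow> 'u) \<Rightarrow> bool" where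
  "bilinear K V W U \<phi> \<longleftrightarrow>
     (\<forall>v\<in>carrier V. (\<lambda>w. \<phi> v w) \<in> module_hom K W U) \<and>
     (\<forall>w\<in>carrier W. (\<lambda>v. \<phi> v w) \<in> module_hom K V U)"

definition trilinear ::
  "('k, 'r) ring_scheme \<Rightarrow> ('k, 'v, 'l) module_scheme \<Rightarrow> ('k, 'w, 'm) module_scheme
    \<Rightarrow> ('k, 'x, 'q) module_scheme
    \<Rightarrow> ('k, 'u, 'n) module_scheme \<Rightarrow> ('v \<Rightarrow> 'w \<Rightarrow> 'x \<Rightarrow> 'u) \<Rightarrow> bool" where
  "trilinear K V W X U \<phi> \<longleftrightarrow>
     (\<forall>v\<in>carrier V. bilinear K W X U (\<phi> v)) \<and>
     (\<forall>w\<in>carrier W. \<forall>x\<in>carrier X. (\<lambda>v. \<phi> v w x) \<in> module_hom K V U)"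

lemma bilinearI [multilinear]:
  assumes "\<And>v. v \<in> carrier V \<Longrightarrow> (\<lambda>w. \<phi> v w) \<in> module_hom K W U"
    and "\<And>w. w \<in> carrier W \<Longrightarrow> (\<lambda>v. \<phi> v w) \<in> module_hom K V U"
  shows "bilinear K V W U \<phi>"
  using assms by (simp add: bilinear_def)

lemma bilinearD:
  assumes "bilinear K V W U \<phi>"
  shows "v \<in> carrier V \<Longrightarrow> (\<lambda>w. \<phi> v w) \<in> module_hom K W U"
    and "w \<in> carrier W \<Longrightarrow> (\<lambda>v. \<phi> v w) \<in> module_hom K V U"
  using assms by (simp_all add: bilinear_def)

lemma bilinear_mem:
  "\<lbrakk>bilinear K V W U \<phi>; v \<in> carrier V; w \<in> carrier W\<rbrakk> \<Longrightarrow> \<phi> v w \<in> carrier U"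
  using bilinearD(1) module_hom_mem by metis

lemma trilinearI [multilinear]:
  assumes "\<And>w x. \<lbrakk>w \<in> carrier W; x \<in> carrier X\<rbrakk> \<Longrightarrow> (\<lambda>v. \<phi> v w x) \<in> module_hom K V U"
    and "\<And>v x. \<lbrakk>v \<in> carrier V; x \<in> carrier X\<rbrakk> \<Longrightarrow> (\<lambda>w. \<phi> v w x) \<in> module_hom K W U"
    and "\<And>v w. \<lbrakk>v \<in> carrier V; w \<in> carrier W\<rbrakk> \<Longrightarrow> (\<lambda>x. \<phi> v w x) \<in> module_hom K X U"
  shows "trilinear K V W X U \<phi>"
  using assms by (simp add: trilinear_def bilinear_def)

lemma trilinearD:
  assumes "trilinear K V W X U \<phi>"
  shows "\<lbrakk>w \<in> carrier W; x \<in> carrier X\<rbrakk> \<Longrightarrow> (\<lambda>v. \<phi> v w x) \<in> module_hom K V U"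
    and "\<lbrakk>v \<in> carrier V; x \<in> carrier X\<rbrakk> \<Longrightarrow> (\<lambda>w. \<phi> v w x) \<in> module_hom K W U"
    and "\<lbrakk>v \<in> carrier V; w \<in> carrier W\<rbrakk> \<Longrightarrow> (\<lambda>x. \<phi> v w x) \<in> module_hom K X U"
  using assms by (simp_all add: trilinear_def bilinear_def)

lemma module_hom_ident [multilinear]: "(\<lambda>v. v) \<in> module_hom K V V"
  by (rule module_homI) auto

lemma module_hom_cong:
  assumes "g \<in> module_hom K V W" "\<And>v. v \<in> carrier V \<Longrightarrow> g v = g' v" and V: "vectorspace K V"
  shows "g' \<in> module_hom K V W"
proof -
  interpret V: vectorspace K V by (rule V)
  show ?thesis
    by (rule module_homI)
      (simp_all add: assms(2)[symmetric] module_hom_mem[OF assms(1)] module_hom_add[OF assms(1)]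
        module_hom_smult[OF assms(1)])
qed

lemma module_hom_comp:
  assumes "g \<in> module_hom K V W" "h \<in> module_hom K U V"
  shows "(\<lambda>u. g (h u)) \<in> module_hom K U W"
  using assms by (auto simp: module_hom_def Pi_def)

lemma module_hom_add_hom:
  assumes "vectorspace K W" and g: "g \<in> module_hom K V W" and h: "h \<in> module_hom K V W"
  shows "(\<lambda>v. g v \<oplus>\<^bsub>W\<^esub> h v) \<in> module_hom K V W"
proof -
  interpret W: vectorspace K W by (rule assms)
  note [simp] = module_hom_mem[OF g] module_hom_mem[OF h]
  show ?thesis
    by (rule module_homI)
      (simp_all add: W.M.a_ac module_hom_add[OF g] module_hom_add[OF h]
        module_hom_smult[OF g] module_hom_smult[OF h] W.smult_r_distr)
qed

lemma module_hom_smult_const: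
  assumes "vectorspace K W" and g: "g \<in> module_hom K V W" and "c \<in> carrier K"
  shows "(\<lambda>v. c \<odot>\<^bsub>W\<^esub> g v) \<in> module_hom K V W"
proof -
  interpret W: vectorspace K W by (rule assms)
  note [simp] = module_hom_mem[OF g] assms
  show ?thesis
    by (rule module_homI)
      (simp_all add: module_hom_add[OF g] module_hom_smult[OF g] W.smult_r_distr
        W.smult_assoc1[symmetric] W.R.m_comm)
qed

lemma module_hom_smult_scalar:
  assumes "vectorspace K W" and g: "g \<in> module_hom K V (ground_vs K)" and "w \<in> carrier W"
  shows "(\<lambda>v. g v \<odot>\<^bsub>W\<^esub> w) \<in> module_hom K V W"
proof -
  interpret W: vectorspace K W by (rule assms)
  have "g \<in> carrier V \<rightarrow> carrier K"
    using g by (auto simp: module_hom_def ground_vs_def)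
  note [simp] = this[THEN funcset_mem] assms
  show ?thesis
    by (rule module_homI)
      (use g in \<open>simp_all add: module_hom_def ground_vs_def W.smult_l_distr W.smult_assoc1\<close>)
qed

section \<open>The universal property of the tensor product\<close>

context
  fixes K :: "('k, 'r) ring_scheme" and V :: "('k, 'v, 'l) module_scheme"
    and W :: "('k, 'w, 'm) module_scheme"
  assumes V: "vectorspace K V" and W: "vectorspace K W"
begin

interpretation V: vectorspace K V by (rule V)
interpretation W: vectorspace K W by (rule W)
interpretation F: vectorspace K "free_vs K (carrier V \<times> carrier W)"
  by (rule vectorspace_free_vs[OF V.field_axioms])

lemma free_basis_pair_mem:
  "\<lbrakk>v \<in> carrier V; w \<in> carrier W\<rbrakk>
    \<Longrightarrow> free_basis K (v, w) \<in> carrier (free_vs K (carrier V \<times> carrier W))"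
  by (rule free_basis_mem[OF V.field_axioms]) simp

lemma tensor_relations_subset:
  "tensor_relations K V W \<subseteq> carrier (free_vs K (carrier V \<times> carrier W))"
  unfolding tensor_relations_def Let_def
  by (auto simp del: free_vs_simps
      intro!: F.M.minus_closed F.M.add.m_closed F.smult_closed free_basis_pair_mem)

lemma subspace_tensor_kernel:
  "subspace K (tensor_kernel K V W) (free_vs K (carrier V \<times> carrier W))"
  unfolding tensor_kernel_def by (rule F.span_is_subspace[OF tensor_relations_subset])

interpretation Q: subspace K "tensor_kernel K V W" "free_vs K (carrier V \<times> carrier W)"
  by (rule subspace_tensor_kernel)

text \<open>
  The four families of relations have the form \<open>x - y\<close>; each therefore identifies the classes of
  \<open>x\<close> and \<open>y\<close>.
\<close>

lemma tensor_coset_minus_eq: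
  assumes "x \<in> carrier (free_vs K (carrier V \<times> carrier W))"
    "y \<in> carrier (free_vs K (carrier V \<times> carrier W))"
    "x \<ominus>\<^bsub>free_vs K (carrier V \<times> carrier W)\<^esub> y \<in> tensor_relations K V W"
  shows "tensor_kernel K V W +>\<^bsub>free_vs K (carrier V \<times> carrier W)\<^esub> x
    = tensor_kernel K V W +>\<^bsub>free_vs K (carrier V \<times> carrier W)\<^esub> y"
  using Q.coset_eqI[OF assms(1,2)] F.in_own_span[OF tensor_relations_subset] assms(3)
  by (auto simp: tensor_kernel_def)

lemma tensor_vs_simps [simp]:
  "carrier (tensor K V W) = carrier (tensor_vs K V W)"
  "add (tensor K V W) = add (tensor_vs K V W)"
  "zero (tensor K V W) = zero (tensor_vs K V W)"
  "smult (tensor K V W) = smult (tensor_vs K V W)"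
  by (simp_all add: tensor_def)

lemma module_hom_tensor_vs:
  "module_hom K (tensor K V W) U = module_hom K (tensor_vs K V W) U"
  "module_hom K U (tensor K V W) = module_hom K U (tensor_vs K V W)"
  by (simp_all add: module_hom_def)

lemma vectorspace_tensor [multilinear]: "vectorspace K (tensor K V W)"
proof -
  interpret T: vectorspace K "tensor_vs K V W"
    unfolding tensor_vs_def by (rule Q.vectorspace_quotient)
  have "abelian_group (tensor K V W)"
    using T.M.abelian_group_axioms
    by (simp add: abelian_group_def abelian_monoid_def abelian_group_axioms_def)
  then show ?thesis
    by (intro vectorspace.intro module.intro module_axioms.intro)
      (simp_all add: module.axioms(1)[OF vectorspace.axioms(1)[OF T.vectorspace_axioms]] V.field_axioms T.smult_l_distr T.smult_r_distr T.smult_assoc1)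
qed

lemma tens_mem [multilinear]:
  "\<lbrakk>v \<in> carrier V; w \<in> carrier W\<rbrakk> \<Longrightarrow> tens K V W v w \<in> carrier (tensor K V W)"
  by (simp add: tens_def tensor_vs_def Q.coset_mem free_basis_pair_mem)

lemma tens_bilinear: "bilinear K V W (tensor K V W) (tens K V W)"
proof -
  let ?F = "free_vs K (carrier V \<times> carrier W)"
  let ?c = "\<lambda>x. tensor_kernel K V W +>\<^bsub>?F\<^esub> x" and ?e = "\<lambda>v w. free_basis K (v, w)"
  note mem = free_basis_pair_mem F.M.add.m_closed F.smult_closed
  have add: "?c (x \<oplus>\<^bsub>?F\<^esub> y) = ?c x \<oplus>\<^bsub>tensor_vs K V W\<^esub> ?c y" if "x \<in> carrier ?F" "y \<in> carrier ?F" for x y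
    using that by (simp add: Q.coset_add tensor_vs_def del: free_vs_simps)
  have smult: "?c (a \<odot>\<^bsub>?F\<^esub> x) = a \<odot>\<^bsub>tensor_vs K V W\<^esub> ?c x" if "a \<in> carrier K" "x \<in> carrier ?F" for a x
    using that by (simp add: Q.coset_smult tensor_vs_def del: free_vs_simps)
  have rel:
    "\<lbrakk>v \<in> carrier V; v' \<in> carrier V; w \<in> carrier W\<rbrakk>
      \<Longrightarrow> ?e (v \<oplus>\<^bsub>V\<^esub> v') w \<ominus>\<^bsub>?F\<^esub> (?e v w \<oplus>\<^bsub>?F\<^esub> ?e v' w) \<in> tensor_relations K V W"
    "\<lbrakk>v \<in> carrier V; w \<in> carrier W; w' \<in> carrier W\<rbrakk>
      \<Longrightarrow> ?e v (w \<oplus>\<^bsub>W\<^esub> w') \<ominus>\<^bsub>?F\<^esub> (?e v w \<oplus>\<^bsub>?F\<^esub> ?e v w') \<in> tensor_relations K V W"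
    "\<lbrakk>a \<in> carrier K; v \<in> carrier V; w \<in> carrier W\<rbrakk>
      \<Longrightarrow> ?e (a \<odot>\<^bsub>V\<^esub> v) w \<ominus>\<^bsub>?F\<^esub> (a \<odot>\<^bsub>?F\<^esub> ?e v w) \<in> tensor_relations K V W"
    "\<lbrakk>a \<in> carrier K; v \<in> carrier V; w \<in> carrier W\<rbrakk>
      \<Longrightarrow> ?e v (a \<odot>\<^bsub>W\<^esub> w) \<ominus>\<^bsub>?F\<^esub> (a \<odot>\<^bsub>?F\<^esub> ?e v w) \<in> tensor_relations K V W"
    for v v' w w' a
    unfolding tensor_relations_def Let_def by blast+
  show ?thesis
  proof (intro bilinearI module_homI)
    fix v w assume vw: "v \<in> carrier V" "w \<in> carrier W"
    then show "tens K V W v w \<in> carrier (tensor K V W)" by (rule tens_mem)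
    then show "tens K V W v w \<in> carrier (tensor K V W)" .
    { fix w' assume w': "w' \<in> carrier W"
      have "?c (?e v (w \<oplus>\<^bsub>W\<^esub> w')) = ?c (?e v w \<oplus>\<^bsub>?F\<^esub> ?e v w')"
        by (intro tensor_coset_minus_eq mem rel vw w' W.M.add.m_closed)
      then show "tens K V W v (w \<oplus>\<^bsub>W\<^esub> w') = tens K V W v w \<oplus>\<^bsub>tensor K V W\<^esub> tens K V W v w'"
        using vw w' by (simp add: tens_def add mem del: free_vs_simps) }
    { fix v' assume v': "v' \<in> carrier V"
      have "?c (?e (v \<oplus>\<^bsub>V\<^esub> v') w) = ?c (?e v w \<oplus>\<^bsub>?F\<^esub> ?e v' w)"
        by (intro tensor_coset_minus_eq mem rel vw v' V.M.add.m_closed)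
      then show "tens K V W (v \<oplus>\<^bsub>V\<^esub> v') w = tens K V W v w \<oplus>\<^bsub>tensor K V W\<^esub> tens K V W v' w"
        using vw v' by (simp add: tens_def add mem del: free_vs_simps) }
    fix a assume a: "a \<in> carrier K"
    have "?c (?e v (a \<odot>\<^bsub>W\<^esub> w)) = ?c (a \<odot>\<^bsub>?F\<^esub> ?e v w)"
      by (intro tensor_coset_minus_eq mem rel vw a W.smult_closed)
    then show "tens K V W v (a \<odot>\<^bsub>W\<^esub> w) = a \<odot>\<^bsub>tensor K V W\<^esub> tens K V W v w"
      using vw a by (simp add: tens_def smult mem del: free_vs_simps)
    have "?c (?e (a \<odot>\<^bsub>V\<^esub> v) w) = ?c (a \<odot>\<^bsub>?F\<^esub> ?e v w)"
      by (intro tensor_coset_minus_eq mem rel vw a V.smult_closed)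
    then show "tens K V W (a \<odot>\<^bsub>V\<^esub> v) w = a \<odot>\<^bsub>tensor K V W\<^esub> tens K V W v w"
      using vw a by (simp add: tens_def smult mem del: free_vs_simps)
  qed
qed

lemma tens_left_hom [multilinear]:
  "\<lbrakk>g \<in> module_hom K Z V; w \<in> carrier W\<rbrakk>
    \<Longrightarrow> (\<lambda>z. tens K V W (g z) w) \<in> module_hom K Z (tensor K V W)"
  by (rule module_hom_comp[OF bilinearD(2)[OF tens_bilinear]])

lemma tens_right_hom [multilinear]:
  "\<lbrakk>g \<in> module_hom K Z W; v \<in> carrier V\<rbrakk>
    \<Longrightarrow> (\<lambda>z. tens K V W v (g z)) \<in> module_hom K Z (tensor K V W)"
  by (rule module_hom_comp[OF bilinearD(1)[OF tens_bilinear]])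

text \<open>
  Scalars are absorbed into the left factor and zero is itself an elementary tensor, so only
  elementary tensors and sums remain.
\<close>

lemma tensor_induct [consumes 1, case_names tens add]:
  assumes t: "t \<in> carrier (tensor K V W)"
    and tens: "\<And>v w. \<lbrakk>v \<in> carrier V; w \<in> carrier W\<rbrakk> \<Longrightarrow> P (tens K V W v w)"
    and add: "\<And>s t. \<lbrakk>s \<in> carrier (tensor K V W); t \<in> carrier (tensor K V W); P s; P t\<rbrakk>
      \<Longrightarrow> P (s \<oplus>\<^bsub>tensor K V W\<^esub> t)"
  shows "P t"
proof -
  let ?F = "free_vs K (carrier V \<times> carrier W)"
  let ?c = "\<lambda>x. tensor_kernel K V W +>\<^bsub>?F\<^esub> x"
  have smult_tens: "?c (a \<odot>\<^bsub>?F\<^esub> free_basis K (v, w)) = tens K V W (a \<odot>\<^bsub>V\<^esub> v) w"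
    if "a \<in> carrier K" "v \<in> carrier V" "w \<in> carrier W" for a v w
  proof -
    have "?c (a \<odot>\<^bsub>?F\<^esub> free_basis K (v, w)) = a \<odot>\<^bsub>tensor K V W\<^esub> tens K V W v w"
      using that by (simp add: tens_def Q.coset_smult free_basis_pair_mem tensor_vs_def del: free_vs_simps)
    also have "\<dots> = tens K V W (a \<odot>\<^bsub>V\<^esub> v) w"
      using module_hom_smult[OF bilinearD(2)[OF tens_bilinear that(3)] that(1,2)] by simp
    finally show ?thesis .
  qed
  from t obtain g where g: "g \<in> carrier ?F" "t = ?c g"
    by (auto simp: tensor_vs_def elim: Q.quotient_carrierE)
  from V.field_axioms g(1) have "P (?c g)"
  proof (induction rule: free_vs_induct)
    case zero
    have z: "(\<lambda>_. \<zero>\<^bsub>K\<^esub>) = \<zero>\<^bsub>K\<^esub> \<odot>\<^bsub>?F\<^esub> free_basis K (\<zero>\<^bsub>V\<^esub>, \<zero>\<^bsub>W\<^esub>)"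
      by (auto simp: free_basis_def)
    show ?case
      unfolding z smult_tens[OF V.R.zero_closed V.M.zero_closed W.M.zero_closed]
      by (intro tens V.smult_closed V.R.zero_closed V.M.zero_closed W.M.zero_closed)
  next
    case (basis a x)
    obtain v w where x: "x = (v, w)" by (cases x)
    with basis have vw: "v \<in> carrier V" "w \<in> carrier W" by auto
    show ?case
      unfolding x smult_tens[OF basis(1) vw] by (intro tens V.smult_closed vw basis)
  next
    case (add g h)
    then have "?c (g \<oplus>\<^bsub>?F\<^esub> h) = ?c g \<oplus>\<^bsub>tensor K V W\<^esub> ?c h"
      by (simp add: Q.coset_add tensor_vs_def del: free_vs_simps)
    moreover have "P (?c g \<oplus>\<^bsub>tensor K V W\<^esub> ?c h)"
      using add by (intro assms(3)) (simp_all add: tensor_vs_def Q.coset_mem del: free_vs_simps)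
    ultimately show ?case by simp
  qed
  with g show ?thesis by simp
qed

lemma tensor_hom_eqI:
  assumes "g \<in> module_hom K (tensor K V W) U" "h \<in> module_hom K (tensor K V W) U"
    and "\<And>v w. \<lbrakk>v \<in> carrier V; w \<in> carrier W\<rbrakk> \<Longrightarrow> g (tens K V W v w) = h (tens K V W v w)"
    and "t \<in> carrier (tensor K V W)"
  shows "g t = h t"
  using assms(4)
  by (induction rule: tensor_induct)
    (simp_all add: assms(3) module_hom_add[OF assms(1)] module_hom_add[OF assms(2)] del: tensor_vs_simps)

context
  fixes U :: "('k, 'u, 'n) module_scheme"
  assumes U: "vectorspace K U"
begin

interpretation U: vectorspace K U by (rule U)

lemma tensor_lift_free_extension:
  "tensor_lift K U \<phi> = descend (free_extension K U (\<lambda>p. \<phi> (fst p) (snd p)))"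
  by (simp add: tensor_lift_def free_extension_def[abs_def])

context
  fixes \<phi> assumes phi: "bilinear K V W U \<phi>"
begin

lemma free_extension_bilinear_vanishes:
  assumes "x \<in> tensor_kernel K V W"
  shows "free_extension K U (\<lambda>p. \<phi> (fst p) (snd p)) x = \<zero>\<^bsub>U\<^esub>"
proof -
  let ?F = "free_vs K (carrier V \<times> carrier W)"
  let ?E = "free_extension K U (\<lambda>p. \<phi> (fst p) (snd p))"
  note mem = free_basis_pair_mem F.M.add.m_closed F.smult_closed bilinear_mem[OF phi]
  have E: "?E \<in> module_hom K ?F U"
    by (rule free_extension_hom[OF U]) (auto intro: bilinear_mem[OF phi])
  have basis: "?E (free_basis K (v, w)) = \<phi> v w" if "v \<in> carrier V" "w \<in> carrier W" for v w
    using free_extension_basis[OF U, of "carrier V \<times> carrier W" "\<lambda>p. \<phi> (fst p) (snd p)" "(v, w)"]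
      that bilinear_mem[OF phi] by auto
  have minus_self: "u \<ominus>\<^bsub>U\<^esub> u = \<zero>\<^bsub>U\<^esub>" if "u \<in> carrier U" for u
    using that by (simp add: a_minus_def U.M.r_neg)
  note E_simps = module_hom_add[OF E] module_hom_smult[OF E]
    module_hom_minus[OF F.vectorspace_axioms U E]
  note phi_simps = bilinearD(1)[OF phi, THEN module_hom_add] bilinearD(1)[OF phi, THEN module_hom_smult]
    bilinearD(2)[OF phi, THEN module_hom_add] bilinearD(2)[OF phi, THEN module_hom_smult]
  \<comment> \<open>Every relation is a difference, so it suffices that \<open>?E\<close> agrees on the two terms.\<close>
  have diff: "?E (a \<ominus>\<^bsub>?F\<^esub> b) = \<zero>\<^bsub>U\<^esub>"
    if "a \<in> carrier ?F" "b \<in> carrier ?F" "?E a = ?E b" for a b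
    using that by (simp add: E_simps minus_self module_hom_mem[OF E])
  have "?E x = \<zero>\<^bsub>U\<^esub>" if "x \<in> tensor_relations K V W" for x
    using that unfolding tensor_relations_def Let_def
    by (elim UnE CollectE exE conjE; hypsubst; intro diff)
      (simp_all add: E_simps basis mem phi_simps del: free_vs_simps)
  then show ?thesis
    using module_hom_vanishes_on_span[OF F.vectorspace_axioms U E tensor_relations_subset] assms
    unfolding tensor_kernel_def by blast
qed

lemma free_extension_bilinear_hom:
  "free_extension K U (\<lambda>p. \<phi> (fst p) (snd p)) \<in> module_hom K (free_vs K (carrier V \<times> carrier W)) U"
  by (rule free_extension_hom[OF U]) (auto intro: bilinear_mem[OF phi])

lemma tensor_lift_hom: "tensor_lift K U \<phi> \<in> module_hom K (tensor K V W) U"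
  unfolding tensor_lift_free_extension module_hom_tensor_vs tensor_vs_def
  by (rule Q.descend_hom[OF U free_extension_bilinear_hom free_extension_bilinear_vanishes])

lemma tensor_lift_tens:
  assumes "v \<in> carrier V" "w \<in> carrier W"
  shows "tensor_lift K U \<phi> (tens K V W v w) = \<phi> v w"
  using free_extension_basis[OF U, of "carrier V \<times> carrier W" "\<lambda>p. \<phi> (fst p) (snd p)" "(v, w)"]
    assms bilinear_mem[OF phi]
  unfolding tensor_lift_free_extension tens_def
  by (subst Q.descend_coset[OF U free_extension_bilinear_hom free_extension_bilinear_vanishes])
    (auto intro: free_basis_pair_mem)

end

lemma tensor_lift_mem:
  "\<lbrakk>t \<in> carrier (tensor K V W); bilinear K V W U \<phi>\<rbrakk> \<Longrightarrow> tensor_lift K U \<phi> t \<in> carrier U"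
  by (rule module_hom_mem[OF tensor_lift_hom])

lemma tensor_lift_hom_comp:
  "\<lbrakk>g \<in> module_hom K Z (tensor K V W); bilinear K V W U \<phi>\<rbrakk>
    \<Longrightarrow> (\<lambda>z. tensor_lift K U \<phi> (g z)) \<in> module_hom K Z U"
  by (rule module_hom_comp[OF tensor_lift_hom])

lemma tensor_lift_parameter_hom:
  assumes t: "t \<in> carrier (tensor K V W)"
    and phi: "\<And>z. z \<in> carrier Z \<Longrightarrow> bilinear K V W U (\<phi> z)"
    and hom: "\<And>x y. \<lbrakk>x \<in> carrier V; y \<in> carrier W\<rbrakk> \<Longrightarrow> (\<lambda>z. \<phi> z x y) \<in> module_hom K Z U"
    and Z: "vectorspace K Z"
  shows "(\<lambda>z. tensor_lift K U (\<phi> z) t) \<in> module_hom K Z U"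
proof -
  show ?thesis
    using t
  proof (induction rule: tensor_induct)
    case (tens v w)
    then show ?case by (intro module_hom_cong[OF hom _ Z]) (simp_all add: tensor_lift_tens phi)
  next
    case (add s t)
    show ?case
      by (rule module_hom_cong[OF module_hom_add_hom[OF U add(3,4)] _ Z])
        (simp only: module_hom_add[OF tensor_lift_hom[OF phi] add(1,2)])
  qed
qed

end

end

text \<open>
  The premise about the tensor comes first: solving it determines the factors \<open>V\<close> and \<open>W\<close>, which do
  not occur in the conclusion.
\<close>

lemmas [multilinear] =
  tensor_lift_mem[rotated 3] tensor_lift_hom_comp[rotated 3] tensor_lift_parameter_hom[rotated 3]

text \<open>
  Both sides are linear in \<open>t\<close> and agree on elementary tensors.
\<close>

lemma hom_tensor_lift:
  assumes V: "vectorspace K V" and W: "vectorspace K W" and U: "vectorspace K U"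
    and U': "vectorspace K U'" and g: "g \<in> module_hom K U U'"
    and phi: "bilinear K V W U \<phi>" and t: "t \<in> carrier (tensor K V W)"
  shows "g (tensor_lift K U \<phi> t) = tensor_lift K U' (\<lambda>x y. g (\<phi> x y)) t"
proof -
  have g_phi: "bilinear K V W U' (\<lambda>x y. g (\<phi> x y))"
    by (intro bilinearI module_hom_comp[OF g] bilinearD[OF phi])
  show ?thesis
    by (rule tensor_hom_eqI[OF V W module_hom_comp[OF g tensor_lift_hom[OF V W U phi]]
          tensor_lift_hom[OF V W U' g_phi] _ t])
      (simp add: tensor_lift_tens[OF V W U phi] tensor_lift_tens[OF V W U' g_phi])
qed

lemma bilinear_cong:
  assumes "bilinear K V W U \<phi>"
    and "\<And>x y. \<lbrakk>x \<in> carrier V; y \<in> carrier W\<rbrakk> \<Longrightarrow> \<phi> x y = \<psi> x y"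
    and V: "vectorspace K V" and W: "vectorspace K W"
  shows "bilinear K V W U \<psi>"
  by (rule bilinearI)
    (use assms(2) in \<open>auto intro: module_hom_cong[OF bilinearD(1)[OF assms(1)] _ W]
      module_hom_cong[OF bilinearD(2)[OF assms(1)] _ V]\<close>)

lemma tensor_lift_cong:
  assumes V: "vectorspace K V" and W: "vectorspace K W" and U: "vectorspace K U"
    and t: "t \<in> carrier (tensor K V W)" and phi: "bilinear K V W U \<phi>"
    and eq: "\<And>x y. \<lbrakk>x \<in> carrier V; y \<in> carrier W\<rbrakk> \<Longrightarrow> \<phi> x y = \<psi> x y"
  shows "tensor_lift K U \<phi> t = tensor_lift K U \<psi> t"
proof -
  note psi = bilinear_cong[OF phi eq V W]
  show ?thesis
    by (rule tensor_hom_eqI[OF V W tensor_lift_hom[OF V W U phi] tensor_lift_hom[OF V W U psi] _ t])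
      (simp_all add: tensor_lift_tens[OF V W U phi] tensor_lift_tens[OF V W U psi] eq)
qed

lemma bilinear_comp:
  assumes "bilinear K V W U \<phi>"
  shows "\<lbrakk>g \<in> module_hom K Z V; w \<in> carrier W\<rbrakk> \<Longrightarrow> (\<lambda>z. \<phi> (g z) w) \<in> module_hom K Z U"
    and "\<lbrakk>h \<in> module_hom K Z W; v \<in> carrier V\<rbrakk> \<Longrightarrow> (\<lambda>z. \<phi> v (h z)) \<in> module_hom K Z U"
  by (rule module_hom_comp[OF bilinearD(2)[OF assms]], assumption+,
      rule module_hom_comp[OF bilinearD(1)[OF assms]])

lemma trilinear_comp:
  assumes "trilinear K V W X U \<phi>"
  shows "\<lbrakk>g \<in> module_hom K Z V; w \<in> carrier W; x \<in> carrier X\<rbrakk>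
      \<Longrightarrow> (\<lambda>z. \<phi> (g z) w x) \<in> module_hom K Z U"
    and "\<lbrakk>h \<in> module_hom K Z W; v \<in> carrier V; x \<in> carrier X\<rbrakk>
      \<Longrightarrow> (\<lambda>z. \<phi> v (h z) x) \<in> module_hom K Z U"
    and "\<lbrakk>k \<in> module_hom K Z X; v \<in> carrier V; w \<in> carrier W\<rbrakk>
      \<Longrightarrow> (\<lambda>z. \<phi> v w (k z)) \<in> module_hom K Z U"
  using module_hom_comp[OF trilinearD(1)[OF assms]] module_hom_comp[OF trilinearD(2)[OF assms]]
    module_hom_comp[OF trilinearD(3)[OF assms]] by blast+

lemmas [multilinear] = module_hom_smult_const[rotated] module_hom_smult_scalar[rotated]

lemma smult_mem [multilinear]:
  "\<lbrakk>c \<in> carrier K; v \<in> carrier V; vectorspace K V\<rbrakk> \<Longrightarrow> c \<odot>\<^bsub>V\<^esub> v \<in> carrier V"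
  using module.smult_closed[of K V c v] by (simp add: vectorspace_def)

text \<open>
  The product on \<open>V \<otimes> W\<close> is defined by lifts into \<open>tensor_vs K V W\<close>, whereas the rules for lifts
  speak of \<open>tensor K V W\<close>.  Only the additive structure and the scalars enter a lift.
\<close>

lemma tensor_lift_tensor_vs:
  assumes "vectorspace K V" "vectorspace K W"
  shows "tensor_lift K (tensor_vs K V W) \<phi> = tensor_lift K (tensor K V W) \<phi>"
  by (simp add: tensor_lift_def finsum_def tensor_vs_simps[OF assms])

lemma assoc_algebra_vectorspace [multilinear]: "assoc_algebra K A \<Longrightarrow> vectorspace K A"
  by (simp add: assoc_algebra_def)

lemma tensor_lift_tens_self:
  assumes V: "vectorspace K V" and W: "vectorspace K W" and t: "t \<in> carrier (tensor K V W)"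
  shows "tensor_lift K (tensor K V W) (tens K V W) t = t"
proof (rule tensor_hom_eqI[OF V W tensor_lift_hom module_hom_ident _ t])
  show "bilinear K V W (tensor K V W) (tens K V W)" by (rule tens_bilinear[OF V W])
  then show "tensor_lift K (tensor K V W) (tens K V W) (tens K V W v w) = tens K V W v w"
    if "v \<in> carrier V" "w \<in> carrier W" for v w
    by (rule tensor_lift_tens[OF V W vectorspace_tensor[OF V W] _ that])
qed (intro V W vectorspace_tensor)+

section \<open>Tensor products of algebras\<close>

lemma algebra_mult_left_hom [multilinear]:
  assumes g: "g \<in> module_hom K Z A" and "a \<in> carrier A" and "assoc_algebra K A"
  shows "(\<lambda>z. g z \<otimes>\<^bsub>A\<^esub> a) \<in> module_hom K Z A"
proof -
  interpret A: assoc_algebra K A by fact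
  show ?thesis
    by (rule module_homI)
      (simp_all add: module_hom_mem[OF g] module_hom_add[OF g] module_hom_smult[OF g] assms(2)
        A.l_distr A.smult_mult_left)
qed

lemma algebra_mult_right_hom [multilinear]:
  assumes g: "g \<in> module_hom K Z A" and "a \<in> carrier A" and "assoc_algebra K A"
  shows "(\<lambda>z. a \<otimes>\<^bsub>A\<^esub> g z) \<in> module_hom K Z A"
proof -
  interpret A: assoc_algebra K A by fact
  show ?thesis
    by (rule module_homI)
      (simp_all add: module_hom_mem[OF g] module_hom_add[OF g] module_hom_smult[OF g] assms(2)
        A.r_distr A.smult_mult_right)
qed

lemma algebra_mult_mem [multilinear]:
  "\<lbrakk>x \<in> carrier A; y \<in> carrier A; assoc_algebra K A\<rbrakk> \<Longrightarrow> x \<otimes>\<^bsub>A\<^esub> y \<in> carrier A"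
  by (meson assoc_algebra_def ring.ring_simprules(5))

lemma algebra_one_mem [multilinear]: "assoc_algebra K A \<Longrightarrow> \<one>\<^bsub>A\<^esub> \<in> carrier A"
  by (meson assoc_algebra_def ring.ring_simprules(6))

context
  fixes K :: "('k, 'r) ring_scheme" and V :: "('k, 'v, 'l) module_scheme"
    and W :: "('k, 'w, 'm) module_scheme"
  assumes V: "assoc_algebra K V" and W: "assoc_algebra K W"
begin

interpretation V: assoc_algebra K V by (rule V)
interpretation W: assoc_algebra K W by (rule W)

lemma left_factor_vs: "vectorspace K V" and right_factor_vs: "vectorspace K W" by unfold_locales

lemma tensor_algebra_vs: "vectorspace K (tensor K V W)"
  by (rule vectorspace_tensor[OF left_factor_vs right_factor_vs])

lemma tensor_mult_inner_bilinear:
  assumes "x \<in> carrier V" "y \<in> carrier W"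
  shows "bilinear K V W (tensor K V W) (\<lambda>x' y'. tens K V W (x \<otimes>\<^bsub>V\<^esub> x') (y \<otimes>\<^bsub>W\<^esub> y'))"
  by (assumption | rule multilinear V W assms)+

lemma tensor_mult_outer_bilinear:
  assumes "t \<in> carrier (tensor K V W)"
  shows "bilinear K V W (tensor K V W)
    (\<lambda>x y. tensor_lift K (tensor K V W) (\<lambda>x' y'. tens K V W (x \<otimes>\<^bsub>V\<^esub> x') (y \<otimes>\<^bsub>W\<^esub> y')) t)"
  by (assumption | rule multilinear V W assms)+

lemma tensor_mult:
  "s \<otimes>\<^bsub>tensor K V W\<^esub> t = tensor_lift K (tensor K V W) (\<lambda>x y.
     tensor_lift K (tensor K V W) (\<lambda>x' y'. tens K V W (x \<otimes>\<^bsub>V\<^esub> x') (y \<otimes>\<^bsub>W\<^esub> y')) t) s"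
  by (simp add: tensor_lift_tensor_vs[OF left_factor_vs right_factor_vs, symmetric]) (simp add: tensor_def)

lemma tensor_mult_bilinear:
  "bilinear K (tensor K V W) (tensor K V W) (tensor K V W) (\<lambda>s t. s \<otimes>\<^bsub>tensor K V W\<^esub> t)"
  unfolding tensor_mult
  by (assumption | rule multilinear V W)+

lemma tensor_mult_tens:
  assumes "x \<in> carrier V" "y \<in> carrier W" "x' \<in> carrier V" "y' \<in> carrier W"
  shows "tens K V W x y \<otimes>\<^bsub>tensor K V W\<^esub> tens K V W x' y' = tens K V W (x \<otimes>\<^bsub>V\<^esub> x') (y \<otimes>\<^bsub>W\<^esub> y')"
  unfolding tensor_mult
  using assms
  by (simp add: tensor_lift_tens[OF left_factor_vs right_factor_vs tensor_algebra_vs]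
      tensor_mult_inner_bilinear tensor_mult_outer_bilinear tens_mem[OF left_factor_vs right_factor_vs] del: tensor_vs_simps)

lemma tensor_one: "\<one>\<^bsub>tensor K V W\<^esub> = tens K V W \<one>\<^bsub>V\<^esub> \<one>\<^bsub>W\<^esub>"
  by (simp add: tensor_def)

text \<open>
  By trilinearity, associativity need only be checked on elementary tensors, where it is
  associativity in the factors.
\<close>

lemma assoc_algebra_tensor [multilinear]: "assoc_algebra K (tensor K V W)"
proof -
  let ?T = "tensor K V W"
  interpret T: vectorspace K ?T by (rule tensor_algebra_vs)
  note b = bilinear_comp[OF tensor_mult_bilinear]
  note mem = bilinear_mem[OF tensor_mult_bilinear]
  note tens_mem = tens_mem[OF left_factor_vs right_factor_vs]
  have assoc: "(s \<otimes>\<^bsub>?T\<^esub> t) \<otimes>\<^bsub>?T\<^esub> u = s \<otimes>\<^bsub>?T\<^esub> (t \<otimes>\<^bsub>?T\<^esub> u)"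
    if s: "s \<in> carrier ?T" and t: "t \<in> carrier ?T" and u: "u \<in> carrier ?T" for s t u
  proof (rule tensor_hom_eqI[OF left_factor_vs right_factor_vs _ _ _ s])
    fix x y assume xy: "x \<in> carrier V" "y \<in> carrier W"
    show "(tens K V W x y \<otimes>\<^bsub>?T\<^esub> t) \<otimes>\<^bsub>?T\<^esub> u = tens K V W x y \<otimes>\<^bsub>?T\<^esub> (t \<otimes>\<^bsub>?T\<^esub> u)"
    proof (rule tensor_hom_eqI[OF left_factor_vs right_factor_vs _ _ _ t])
      fix x' y' assume xy': "x' \<in> carrier V" "y' \<in> carrier W"
      show "(tens K V W x y \<otimes>\<^bsub>?T\<^esub> tens K V W x' y') \<otimes>\<^bsub>?T\<^esub> u
        = tens K V W x y \<otimes>\<^bsub>?T\<^esub> (tens K V W x' y' \<otimes>\<^bsub>?T\<^esub> u)"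
        by (rule tensor_hom_eqI[OF left_factor_vs right_factor_vs _ _ _ u])
          ((rule b multilinear tens_mem mem xy xy' V W)+,
           use xy xy' in \<open>simp add: tensor_mult_tens V.m_assoc W.m_assoc\<close>)
    qed (rule b multilinear tens_mem xy u mem | simp add: V W)+
  qed (rule b multilinear tens_mem t u mem | simp add: V W)+
  have one_l: "\<one>\<^bsub>?T\<^esub> \<otimes>\<^bsub>?T\<^esub> s = s" and one_r: "s \<otimes>\<^bsub>?T\<^esub> \<one>\<^bsub>?T\<^esub> = s" if s: "s \<in> carrier ?T" for s
    unfolding tensor_one
    by (rule tensor_hom_eqI[OF left_factor_vs right_factor_vs _ _ _ s],
        (rule b multilinear tens_mem V W)+, simp add: tensor_mult_tens)+
  show ?thesis
  proof (intro assoc_algebra.intro assoc_algebra_axioms.intro tensor_algebra_vs ringI monoidI)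
    show "\<one>\<^bsub>?T\<^esub> \<in> carrier ?T" unfolding tensor_one by (intro tens_mem V.one_closed W.one_closed)
    fix x y assume x: "x \<in> carrier ?T" and y: "y \<in> carrier ?T"
    show "x \<otimes>\<^bsub>?T\<^esub> y \<in> carrier ?T" by (rule mem[OF x y])
    fix c assume c: "c \<in> carrier K"
    show "(c \<odot>\<^bsub>?T\<^esub> x) \<otimes>\<^bsub>?T\<^esub> y = c \<odot>\<^bsub>?T\<^esub> (x \<otimes>\<^bsub>?T\<^esub> y)"
      using module_hom_smult[OF bilinearD(2)[OF tensor_mult_bilinear y] c x] .
    show "x \<otimes>\<^bsub>?T\<^esub> (c \<odot>\<^bsub>?T\<^esub> y) = c \<odot>\<^bsub>?T\<^esub> (x \<otimes>\<^bsub>?T\<^esub> y)"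
      using module_hom_smult[OF bilinearD(1)[OF tensor_mult_bilinear x] c y] .
  next
    fix x y z assume x: "x \<in> carrier ?T" and y: "y \<in> carrier ?T" and z: "z \<in> carrier ?T"
    show "(x \<oplus>\<^bsub>?T\<^esub> y) \<otimes>\<^bsub>?T\<^esub> z = x \<otimes>\<^bsub>?T\<^esub> z \<oplus>\<^bsub>?T\<^esub> y \<otimes>\<^bsub>?T\<^esub> z"
      using module_hom_add[OF bilinearD(2)[OF tensor_mult_bilinear z] x y] .
    show "z \<otimes>\<^bsub>?T\<^esub> (x \<oplus>\<^bsub>?T\<^esub> y) = z \<otimes>\<^bsub>?T\<^esub> x \<oplus>\<^bsub>?T\<^esub> z \<otimes>\<^bsub>?T\<^esub> y"
      using module_hom_add[OF bilinearD(1)[OF tensor_mult_bilinear z] x y] .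
  qed (simp_all add: assoc one_l one_r T.M.abelian_group_axioms del: tensor_vs_simps)
qed

end

section \<open>Sweedler calculus\<close>

lemma tensor_map_bilinear:
  assumes "f \<in> module_hom K V V'" "g \<in> module_hom K W W'"
    and "vectorspace K V'" "vectorspace K W'"
  shows "bilinear K V W (tensor K V' W') (\<lambda>x y. tens K V' W' (f x) (g y))"
  by (assumption | rule multilinear assms | rule module_hom_mem[OF assms(1)] module_hom_mem[OF assms(2)])+

lemma tensor_map_tens:
  assumes "vectorspace K V" "vectorspace K W" "vectorspace K V'" "vectorspace K W'"
    and "f \<in> module_hom K V V'" "g \<in> module_hom K W W'" and "v \<in> carrier V" "w \<in> carrier W"
  shows "tensor_map K V' W' f g (tens K V W v w) = tens K V' W' (f v) (g w)"
  unfolding tensor_map_def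
  by (rule tensor_lift_tens[OF assms(1,2) vectorspace_tensor[OF assms(3,4)]
        tensor_map_bilinear[OF assms(5,6,3,4)] assms(7,8)])

lemma id_hom: "id \<in> module_hom K V V"
  by (auto intro!: module_homI)

lemma tensor_map_hom [multilinear]:
  assumes "h \<in> module_hom K Z (tensor K V W)" "f \<in> module_hom K V V'" "g \<in> module_hom K W W'"
    and "vectorspace K V" "vectorspace K W" "vectorspace K V'" "vectorspace K W'"
  shows "(\<lambda>z. tensor_map K V' W' f g (h z)) \<in> module_hom K Z (tensor K V' W')"
  unfolding tensor_map_def
  by (rule tensor_lift_hom_comp[OF assms(4,5) vectorspace_tensor[OF assms(6,7)] assms(1)
        tensor_map_bilinear[OF assms(2,3,6,7)]])

lemma tensor_lift_tensor_map:
  assumes V: "vectorspace K V" and W: "vectorspace K W" and V': "vectorspace K V'"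
    and W': "vectorspace K W'" and U: "vectorspace K U"
    and f: "f \<in> module_hom K V V'" and g: "g \<in> module_hom K W W'"
    and phi: "bilinear K V' W' U \<phi>" and t: "t \<in> carrier (tensor K V W)"
  shows "tensor_lift K U \<phi> (tensor_map K V' W' f g t) = tensor_lift K U (\<lambda>x y. \<phi> (f x) (g y)) t"
proof -
  have phi': "bilinear K V W U (\<lambda>x y. \<phi> (f x) (g y))"
    by (assumption | rule bilinearI bilinear_comp[OF phi] f g module_hom_mem[OF f] module_hom_mem[OF g])+
  show ?thesis
    unfolding tensor_map_def
    by (subst hom_tensor_lift[OF V W vectorspace_tensor[OF V' W'] U tensor_lift_hom[OF V' W' U phi]
          tensor_map_bilinear[OF f g V' W'] t], rule tensor_lift_cong[OF V W U t])
      (auto intro!: bilinear_cong[OF phi' _ V W] simp: tensor_lift_tens[OF V' W' U phi]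
        module_hom_mem[OF f] module_hom_mem[OF g])
qed

context right_comodule
begin

lemma C_vs: "vectorspace K C" and M_vs: "vectorspace K M" by unfold_locales

lemma coaction_mem: "m \<in> carrier M \<Longrightarrow> \<rho> m \<in> carrier (tensor K M C)"
  by (rule module_hom_mem[OF coaction_linear])

lemma comult_mem: "c \<in> carrier C \<Longrightarrow> \<Delta> c \<in> carrier (tensor K C C)"
  by (rule module_hom_mem[OF C.comult_linear])

lemmas coaction_hom_comp = module_hom_comp[OF coaction_linear]
lemmas comult_hom_comp = module_hom_comp[OF C.comult_linear]

text \<open>
  Coassociativity in the form used in computations: for trilinear \<open>\<phi>\<close> the expression
  \<open>\<phi>(m\<^sub>0, m\<^sub>1, m\<^sub>2)\<close> does not depend on whether \<open>m\<^sub>0\<close> or \<open>m\<^sub>1\<close> was split first.  It is obtained by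
  applying to the coassociativity axiom the linear map on \<open>M \<otimes> (C \<otimes> C)\<close> induced by \<open>\<phi>\<close>.
\<close>

lemma coassoc_lift:
  assumes U: "vectorspace K U" and phi: "trilinear K M C C U \<phi>" and m: "m \<in> carrier M"
  shows "tensor_lift K U (\<lambda>u z. tensor_lift K U (\<lambda>x y. \<phi> x y z) (\<rho> u)) (\<rho> m)
    = tensor_lift K U (\<lambda>x u. tensor_lift K U (\<lambda>y z. \<phi> x y z) (\<Delta> u)) (\<rho> m)"
proof -
  let ?CC = "tensor K C C" and ?MC = "tensor K M C"
  let ?MCC = "tensor K M ?CC"
  note vs = M_vs C_vs U
  note rules = multilinear vs trilinear_comp[OF phi] coaction_mem comult_mem coaction_hom_comp comult_hom_comp
  let ?L = "tensor_lift K U (\<lambda>x s. tensor_lift K U (\<lambda>y z. \<phi> x y z) s)"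
  have inner: "bilinear K M ?CC U (\<lambda>x s. tensor_lift K U (\<lambda>y z. \<phi> x y z) s)"
    by (assumption | rule rules)+
  have L: "?L \<in> module_hom K ?MCC U"
    by (rule tensor_lift_hom[OF _ _ _ inner]) (assumption | rule rules)+
  have A: "(\<lambda>t. tensor_assoc K M C C t) \<in> module_hom K (tensor K ?MC C) ?MCC"
    unfolding tensor_assoc_def by (assumption | rule rules)+
  have yz: "bilinear K C C U (\<lambda>y z. \<phi> x y z)" if "x \<in> carrier M" for x
    by (assumption | rule rules that)+
  have "?L (tensor_assoc K M C C (tensor_map K ?MC C \<rho> id (\<rho> m)))
      = tensor_lift K U (\<lambda>u z. ?L (tensor_assoc K M C C (tens K ?MC C (\<rho> u) (id z)))) (\<rho> m)"
    unfolding tensor_map_def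
    by (rule hom_tensor_lift[OF _ _ _ _ module_hom_comp[OF L A]])
      (assumption | rule rules tensor_map_bilinear id_hom coaction_linear m)+
  also have "\<dots> = tensor_lift K U (\<lambda>u z. tensor_lift K U (\<lambda>x y. \<phi> x y z) (\<rho> u)) (\<rho> m)"
  proof (rule sym, rule tensor_lift_cong[OF M_vs C_vs U coaction_mem[OF m]])
    show "bilinear K M C U (\<lambda>u z. tensor_lift K U (\<lambda>x y. \<phi> x y z) (\<rho> u))"
      by (assumption | rule rules)+
    fix u z assume u: "u \<in> carrier M" and z: "z \<in> carrier C"
    have "tensor_assoc K M C C (tens K ?MC C (\<rho> u) z)
      = tensor_lift K ?MCC (\<lambda>x y. tens K M ?CC x (tens K C C y z)) (\<rho> u)"
      unfolding tensor_assoc_def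
      by (rule tensor_lift_tens) (assumption | rule rules u z)+
    then have "?L (tensor_assoc K M C C (tens K ?MC C (\<rho> u) z))
      = tensor_lift K U (\<lambda>x y. ?L (tens K M ?CC x (tens K C C y z))) (\<rho> u)"
      by (simp only:) (rule hom_tensor_lift[OF _ _ _ _ L]; (assumption | rule rules u z)+)
    also have "\<dots> = tensor_lift K U (\<lambda>x y. \<phi> x y z) (\<rho> u)"
    proof (rule sym, rule tensor_lift_cong[OF M_vs C_vs U coaction_mem[OF u]])
      show "bilinear K M C U (\<lambda>x y. \<phi> x y z)" by (assumption | rule rules z)+
      fix x y assume x: "x \<in> carrier M" and y: "y \<in> carrier C"
      show "\<phi> x y z = ?L (tens K M ?CC x (tens K C C y z))"
        by (subst tensor_lift_tens[OF M_vs _ U inner x],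
            (rule vectorspace_tensor tens_mem C_vs y z)+,
            subst tensor_lift_tens[OF C_vs C_vs U yz[OF x] y z], rule refl)
    qed
    finally show "tensor_lift K U (\<lambda>x y. \<phi> x y z) (\<rho> u)
      = ?L (tensor_assoc K M C C (tens K ?MC C (\<rho> u) (id z)))" by simp
  qed
  finally have "tensor_lift K U (\<lambda>u z. tensor_lift K U (\<lambda>x y. \<phi> x y z) (\<rho> u)) (\<rho> m)
    = ?L (tensor_assoc K M C C (tensor_map K ?MC C \<rho> id (\<rho> m)))" by simp
  also have "\<dots> = ?L (tensor_map K M ?CC id \<Delta> (\<rho> m))"
    by (simp only: coaction_coassoc[OF m])
  also have "\<dots> = tensor_lift K U (\<lambda>x u. tensor_lift K U (\<lambda>y z. \<phi> (id x) y z) (\<Delta> u)) (\<rho> m)"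
    by (rule tensor_lift_tensor_map[OF M_vs C_vs M_vs _ U id_hom C.comult_linear inner])
      (rule rules m)+
  finally show ?thesis by simp
qed

end

text \<open>
  This makes every statement about comodules available for coproducts.
\<close>

lemma (in coalgebra) regular_comodule: "right_comodule K C \<Delta> \<epsilon> C \<Delta>"
  by (intro right_comodule.intro right_comodule_axioms.intro coalgebra_axioms vectorspace_axioms
      comult_linear coassoc counit_right)

lemma mult_tensor_lift:
  assumes V: "vectorspace K V" and W: "vectorspace K W" and V': "vectorspace K V'" and W': "vectorspace K W'"
    and R: "assoc_algebra K R"
    and phi: "bilinear K V W R \<phi>" and psi: "bilinear K V' W' R \<psi>"
    and s: "s \<in> carrier (tensor K V W)" and t: "t \<in> carrier (tensor K V' W')"
  shows "tensor_lift K R \<phi> s \<otimes>\<^bsub>R\<^esub> tensor_lift K R \<psi> t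
    = tensor_lift K R (\<lambda>x y. tensor_lift K R (\<lambda>u v. \<phi> x y \<otimes>\<^bsub>R\<^esub> \<psi> u v) t) s"
proof -
  note rules = multilinear assms bilinear_comp[OF phi] bilinear_comp[OF psi]
    bilinear_mem[OF phi] bilinear_mem[OF psi]
  note R_vs = assoc_algebra_vectorspace[OF R]
  have "tensor_lift K R \<phi> s \<otimes>\<^bsub>R\<^esub> tensor_lift K R \<psi> t
    = tensor_lift K R (\<lambda>x y. \<phi> x y \<otimes>\<^bsub>R\<^esub> tensor_lift K R \<psi> t) s"
    by (rule hom_tensor_lift[OF V W R_vs R_vs, where g = "\<lambda>x. x \<otimes>\<^bsub>R\<^esub> tensor_lift K R \<psi> t"])
      (assumption | rule rules)+
  also have "\<dots> = tensor_lift K R (\<lambda>x y. tensor_lift K R (\<lambda>u v. \<phi> x y \<otimes>\<^bsub>R\<^esub> \<psi> u v) t) s"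
  proof (rule tensor_lift_cong[OF V W R_vs s])
    show "bilinear K V W R (\<lambda>x y. \<phi> x y \<otimes>\<^bsub>R\<^esub> tensor_lift K R \<psi> t)"
      by (assumption | rule rules)+
    fix x y assume xy: "x \<in> carrier V" "y \<in> carrier W"
    show "\<phi> x y \<otimes>\<^bsub>R\<^esub> tensor_lift K R \<psi> t = tensor_lift K R (\<lambda>u v. \<phi> x y \<otimes>\<^bsub>R\<^esub> \<psi> u v) t"
      by (rule hom_tensor_lift[OF V' W' R_vs R_vs _ psi t]) (assumption | rule rules xy)+
  qed
  finally show ?thesis .
qed

lemma tensor_lift_tensor_mult:
  assumes V: "assoc_algebra K V" and W: "assoc_algebra K W" and U: "vectorspace K U"
    and phi: "bilinear K V W U \<phi>"
    and s: "s \<in> carrier (tensor K V W)" and t: "t \<in> carrier (tensor K V W)"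
  shows "tensor_lift K U \<phi> (s \<otimes>\<^bsub>tensor K V W\<^esub> t)
    = tensor_lift K U (\<lambda>x y. tensor_lift K U (\<lambda>x' y'. \<phi> (x \<otimes>\<^bsub>V\<^esub> x') (y \<otimes>\<^bsub>W\<^esub> y')) t) s"
proof -
  note vs = V[THEN assoc_algebra_vectorspace] W[THEN assoc_algebra_vectorspace] U
  note T = vectorspace_tensor[OF vs(1,2)]
  note rules = multilinear assms bilinear_comp[OF phi] bilinear_mem[OF phi]
  note L = tensor_lift_hom[OF vs phi]
  have "tensor_lift K U \<phi> (s \<otimes>\<^bsub>tensor K V W\<^esub> t) = tensor_lift K U (\<lambda>x y. tensor_lift K U \<phi>
     (tensor_lift K (tensor K V W) (\<lambda>x' y'. tens K V W (x \<otimes>\<^bsub>V\<^esub> x') (y \<otimes>\<^bsub>W\<^esub> y')) t)) s"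
    unfolding tensor_mult[OF V W]
    by (rule hom_tensor_lift[OF vs(1,2) T U L _ s]) (assumption | rule rules)+
  also have "\<dots> = tensor_lift K U (\<lambda>x y. tensor_lift K U (\<lambda>x' y'. \<phi> (x \<otimes>\<^bsub>V\<^esub> x') (y \<otimes>\<^bsub>W\<^esub> y')) t) s"
  proof (rule sym, rule tensor_lift_cong[OF vs s])
    show "bilinear K V W U (\<lambda>x y. tensor_lift K U (\<lambda>x' y'. \<phi> (x \<otimes>\<^bsub>V\<^esub> x') (y \<otimes>\<^bsub>W\<^esub> y')) t)"
      by (assumption | rule rules)+
    fix x y assume xy: "x \<in> carrier V" "y \<in> carrier W"
    note xy_mem = algebra_mult_mem[OF xy(1) _ V] algebra_mult_mem[OF xy(2) _ W]
    have "tensor_lift K U \<phi>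
       (tensor_lift K (tensor K V W) (\<lambda>x' y'. tens K V W (x \<otimes>\<^bsub>V\<^esub> x') (y \<otimes>\<^bsub>W\<^esub> y')) t)
      = tensor_lift K U (\<lambda>x' y'. tensor_lift K U \<phi> (tens K V W (x \<otimes>\<^bsub>V\<^esub> x') (y \<otimes>\<^bsub>W\<^esub> y'))) t"
      by (rule hom_tensor_lift[OF vs(1,2) T U L _ t]) (assumption | rule rules xy)+
    also have "\<dots> = tensor_lift K U (\<lambda>x' y'. \<phi> (x \<otimes>\<^bsub>V\<^esub> x') (y \<otimes>\<^bsub>W\<^esub> y')) t"
      by (rule sym, rule tensor_lift_cong[OF vs t])
        ((assumption | rule rules xy)+, simp add: tensor_lift_tens[OF vs phi] xy_mem)
    finally show "tensor_lift K U (\<lambda>x' y'. \<phi> (x \<otimes>\<^bsub>V\<^esub> x') (y \<otimes>\<^bsub>W\<^esub> y')) t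
      = tensor_lift K U \<phi>
       (tensor_lift K (tensor K V W) (\<lambda>x' y'. tens K V W (x \<otimes>\<^bsub>V\<^esub> x') (y \<otimes>\<^bsub>W\<^esub> y')) t)" by simp
  qed
  finally show ?thesis .
qed

lemma ground_vs_hom_mem: "g \<in> module_hom K V (ground_vs K) \<Longrightarrow> v \<in> carrier V \<Longrightarrow> g v \<in> carrier K"
  by (auto simp: module_hom_def ground_vs_def)

lemma (in right_comodule) counit_lift:
  assumes U: "vectorspace K U" and g: "g \<in> module_hom K M U" and m: "m \<in> carrier M"
  shows "tensor_lift K U (\<lambda>x c. \<epsilon> c \<odot>\<^bsub>U\<^esub> g x) (\<rho> m) = g m"
proof -
  note rules = multilinear module_hom_comp[OF C.counit_linear] module_hom_comp[OF g]
    ground_vs_hom_mem[OF C.counit_linear] module_hom_mem[OF g] C_vs M_vs U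
  have "g m = g (tensor_lift K M (\<lambda>x c. \<epsilon> c \<odot>\<^bsub>M\<^esub> x) (\<rho> m))"
    by (simp only: coaction_counit[OF m])
  also have "\<dots> = tensor_lift K U (\<lambda>x c. g (\<epsilon> c \<odot>\<^bsub>M\<^esub> x)) (\<rho> m)"
    by (rule hom_tensor_lift[OF M_vs C_vs M_vs U g _ coaction_mem[OF m]]) (assumption | rule rules)+
  also have "\<dots> = tensor_lift K U (\<lambda>x c. \<epsilon> c \<odot>\<^bsub>U\<^esub> g x) (\<rho> m)"
    by (rule tensor_lift_cong[OF M_vs C_vs U coaction_mem[OF m]])
      ((assumption | rule rules)+, simp add: module_hom_smult[OF g] ground_vs_hom_mem[OF C.counit_linear])
  finally show ?thesis by simp
qed

section \<open>Convolution and the antipode\<close>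

context coalgebra
begin

lemma vs: "vectorspace K C" ..

lemmas comult_mem = module_hom_mem[OF comult_linear]
  and counit_mem = ground_vs_hom_mem[OF counit_linear]
  and comult_coassoc_lift = right_comodule.coassoc_lift[OF regular_comodule]
  and counit_right_lift = right_comodule.counit_lift[OF regular_comodule]

lemmas multilinear_comult = multilinear vs comult_mem counit_mem
  module_hom_comp[OF comult_linear] module_hom_comp[OF counit_linear]

lemma counit_left_lift:
  assumes U: "vectorspace K U" and g: "g \<in> module_hom K C U" and m: "m \<in> carrier C"
  shows "tensor_lift K U (\<lambda>c x. \<epsilon> c \<odot>\<^bsub>U\<^esub> g x) (\<Delta> m) = g m"
proof -
  note rules = multilinear_comult U module_hom_comp[OF g] module_hom_mem[OF g]
  have "g m = g (tensor_lift K C (\<lambda>c x. \<epsilon> c \<odot>\<^bsub>C\<^esub> x) (\<Delta> m))"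
    by (simp only: counit_left[OF m])
  also have "\<dots> = tensor_lift K U (\<lambda>c x. g (\<epsilon> c \<odot>\<^bsub>C\<^esub> x)) (\<Delta> m)"
    by (rule hom_tensor_lift[OF vs vs vs U g _ comult_mem[OF m]]) (assumption | rule rules)+
  also have "\<dots> = tensor_lift K U (\<lambda>c x. \<epsilon> c \<odot>\<^bsub>U\<^esub> g x) (\<Delta> m)"
    by (rule tensor_lift_cong[OF vs vs U comult_mem[OF m]])
      ((assumption | rule rules)+, simp add: module_hom_smult[OF g] counit_mem)
  finally show ?thesis by simp
qed

text \<open>
  \<open>P = (G * F) * P = G * (F * P) = G * Q\<close>.  The lemma replaces uniqueness of convolution inverses:
  it determines \<open>P\<close> from \<open>F * P\<close> without first making the maps \<open>C \<rightarrow> R\<close> into an algebra.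
\<close>

lemma convolution_cancel_left:
  assumes R: "assoc_algebra K R" and P: "P \<in> module_hom K C R" and F: "F \<in> module_hom K C R"
    and G: "G \<in> module_hom K C R"
    and GF: "\<And>c. c \<in> carrier C \<Longrightarrow> convolution K \<Delta> R G F c = \<epsilon> c \<odot>\<^bsub>R\<^esub> \<one>\<^bsub>R\<^esub>"
    and FP: "\<And>c. c \<in> carrier C \<Longrightarrow> convolution K \<Delta> R F P c = Q c" and c: "c \<in> carrier C"
  shows "P c = convolution K \<Delta> R G Q c"
proof -
  interpret R: assoc_algebra K R by (rule R)
  note R_vs = assoc_algebra_vectorspace[OF R]
  note mem = module_hom_mem[OF P] module_hom_mem[OF F] module_hom_mem[OF G]
  note rules = multilinear_comult R mem module_hom_comp[OF P] module_hom_comp[OF F] module_hom_comp[OF G]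
  note cong = tensor_lift_cong[OF vs vs R_vs]
  have "P c = tensor_lift K R (\<lambda>x y. \<epsilon> x \<odot>\<^bsub>R\<^esub> P y) (\<Delta> c)"
    by (rule counit_left_lift[OF R_vs P c, symmetric])
  also have "\<dots> = tensor_lift K R (\<lambda>u z. tensor_lift K R (\<lambda>x y. G x \<otimes>\<^bsub>R\<^esub> F y \<otimes>\<^bsub>R\<^esub> P z) (\<Delta> u)) (\<Delta> c)"
  proof (rule cong[OF comult_mem[OF c]])
    show "bilinear K C C R (\<lambda>x y. \<epsilon> x \<odot>\<^bsub>R\<^esub> P y)" by (assumption | rule rules)+
    fix u z assume u: "u \<in> carrier C" and z: "z \<in> carrier C"
    have "\<epsilon> u \<odot>\<^bsub>R\<^esub> P z = (\<epsilon> u \<odot>\<^bsub>R\<^esub> \<one>\<^bsub>R\<^esub>) \<otimes>\<^bsub>R\<^esub> P z"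
      using mem(1)[OF z] counit_mem[OF u] by (simp add: R.smult_mult_left)
    also have "\<dots> = tensor_lift K R (\<lambda>x y. G x \<otimes>\<^bsub>R\<^esub> F y) (\<Delta> u) \<otimes>\<^bsub>R\<^esub> P z"
      using GF[OF u] by (simp add: convolution_def)
    also have "\<dots> = tensor_lift K R (\<lambda>x y. G x \<otimes>\<^bsub>R\<^esub> F y \<otimes>\<^bsub>R\<^esub> P z) (\<Delta> u)"
      by (rule hom_tensor_lift[OF vs vs R_vs R_vs _ _ comult_mem[OF u], where g = "\<lambda>r. r \<otimes>\<^bsub>R\<^esub> P z"])
        (assumption | rule rules z)+
    finally show "\<epsilon> u \<odot>\<^bsub>R\<^esub> P z = tensor_lift K R (\<lambda>x y. G x \<otimes>\<^bsub>R\<^esub> F y \<otimes>\<^bsub>R\<^esub> P z) (\<Delta> u)" .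
  qed
  also have "\<dots> = tensor_lift K R (\<lambda>x u. tensor_lift K R (\<lambda>y z. G x \<otimes>\<^bsub>R\<^esub> F y \<otimes>\<^bsub>R\<^esub> P z) (\<Delta> u)) (\<Delta> c)"
    by (rule comult_coassoc_lift[OF R_vs _ c]) (assumption | rule rules)+
  also have "\<dots> = convolution K \<Delta> R G Q c"
    unfolding convolution_def
  proof (rule cong[OF comult_mem[OF c]])
    show "bilinear K C C R (\<lambda>x u. tensor_lift K R (\<lambda>y z. G x \<otimes>\<^bsub>R\<^esub> F y \<otimes>\<^bsub>R\<^esub> P z) (\<Delta> u))"
      by (assumption | rule rules)+
    fix x u assume x: "x \<in> carrier C" and u: "u \<in> carrier C"
    have "G x \<otimes>\<^bsub>R\<^esub> Q u = G x \<otimes>\<^bsub>R\<^esub> tensor_lift K R (\<lambda>y z. F y \<otimes>\<^bsub>R\<^esub> P z) (\<Delta> u)"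
      using FP[OF u] by (simp add: convolution_def)
    also have "\<dots> = tensor_lift K R (\<lambda>y z. G x \<otimes>\<^bsub>R\<^esub> (F y \<otimes>\<^bsub>R\<^esub> P z)) (\<Delta> u)"
      by (rule hom_tensor_lift[OF vs vs R_vs R_vs _ _ comult_mem[OF u]]) (assumption | rule rules x)+
    also have "\<dots> = tensor_lift K R (\<lambda>y z. G x \<otimes>\<^bsub>R\<^esub> F y \<otimes>\<^bsub>R\<^esub> P z) (\<Delta> u)"
      by (rule cong[OF comult_mem[OF u]]) ((assumption | rule rules x)+, simp add: R.m_assoc mem x)
    finally show "tensor_lift K R (\<lambda>y z. G x \<otimes>\<^bsub>R\<^esub> F y \<otimes>\<^bsub>R\<^esub> P z) (\<Delta> u) = G x \<otimes>\<^bsub>R\<^esub> Q u" by simp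
  qed
  finally show ?thesis .
qed

end

context hopf_algebra
begin

lemma H_alg: "assoc_algebra K H" ..

lemmas antipode_mem = module_hom_mem[OF antipode_linear]

lemmas multilinear_hopf = multilinear_comult H_alg antipode_mem module_hom_comp[OF antipode_linear]

lemma antipode_left_lift:
  assumes U: "vectorspace K U" and g: "g \<in> module_hom K H U" and h: "h \<in> carrier H"
  shows "tensor_lift K U (\<lambda>x y. g (S x \<otimes>\<^bsub>H\<^esub> y)) (\<Delta> h) = \<epsilon> h \<odot>\<^bsub>U\<^esub> g \<one>\<^bsub>H\<^esub>"
proof -
  have "g (tensor_lift K H (\<lambda>x y. S x \<otimes>\<^bsub>H\<^esub> y) (\<Delta> h)) = tensor_lift K U (\<lambda>x y. g (S x \<otimes>\<^bsub>H\<^esub> y)) (\<Delta> h)"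
    by (rule hom_tensor_lift[OF vs vs vs U g _ comult_mem[OF h]]) (assumption | rule multilinear_hopf)+
  then show ?thesis
    using h by (simp add: antipode_left module_hom_smult[OF g] counit_mem)
qed

lemma antipode_right_lift:
  assumes U: "vectorspace K U" and g: "g \<in> module_hom K H U" and h: "h \<in> carrier H"
  shows "tensor_lift K U (\<lambda>x y. g (x \<otimes>\<^bsub>H\<^esub> S y)) (\<Delta> h) = \<epsilon> h \<odot>\<^bsub>U\<^esub> g \<one>\<^bsub>H\<^esub>"
proof -
  have "g (tensor_lift K H (\<lambda>x y. x \<otimes>\<^bsub>H\<^esub> S y) (\<Delta> h)) = tensor_lift K U (\<lambda>x y. g (x \<otimes>\<^bsub>H\<^esub> S y)) (\<Delta> h)"
    by (rule hom_tensor_lift[OF vs vs vs U g _ comult_mem[OF h]]) (assumption | rule multilinear_hopf)+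
  then show ?thesis
    using h by (simp add: antipode_right module_hom_smult[OF g] counit_mem)
qed

lemma antipode_one: "S \<one>\<^bsub>H\<^esub> = \<one>\<^bsub>H\<^esub>"
proof -
  have "tensor_lift K H (\<lambda>x y. S x \<otimes>\<^bsub>H\<^esub> y) (\<Delta> \<one>\<^bsub>H\<^esub>) = S \<one>\<^bsub>H\<^esub> \<otimes>\<^bsub>H\<^esub> \<one>\<^bsub>H\<^esub>"
    unfolding ring_hom_one[OF comult_hom] tensor_one[OF H_alg H_alg]
    by (rule tensor_lift_tens[OF vs vs vs]) (assumption | rule multilinear_hopf)+
  then show ?thesis
    using antipode_left[OF one_closed] ring_hom_one[OF counit_hom] antipode_mem by simp
qed

text \<open>
  In Sweedler notation, \<open>h\<^sub>1 S(g h\<^sub>2) = \<epsilon>(h) S(g)\<close>.  For fixed \<open>h\<close>, convolving the left side, as a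
  function of \<open>g\<close>, with the identity from the left gives \<open>g\<^sub>1 h\<^sub>1 S(g\<^sub>2 h\<^sub>2) = \<epsilon>(g) \<epsilon>(h)\<close>, and \<open>S\<close> is a
  left convolution inverse of the identity.
\<close>

lemma antipode_partial_mult:
  assumes g: "g \<in> carrier H" and h: "h \<in> carrier H"
  shows "tensor_lift K H (\<lambda>x y. x \<otimes>\<^bsub>H\<^esub> S (g \<otimes>\<^bsub>H\<^esub> y)) (\<Delta> h) = \<epsilon> h \<odot>\<^bsub>H\<^esub> S g"
proof -
  let ?P = "\<lambda>g. tensor_lift K H (\<lambda>x y. x \<otimes>\<^bsub>H\<^esub> S (g \<otimes>\<^bsub>H\<^esub> y)) (\<Delta> h)"
  note rules = multilinear_hopf h
  have "?P g = convolution K \<Delta> H S (\<lambda>g. \<epsilon> h \<odot>\<^bsub>H\<^esub> (\<epsilon> g \<odot>\<^bsub>H\<^esub> \<one>\<^bsub>H\<^esub>)) g"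
  proof (rule convolution_cancel_left[OF H_alg _ module_hom_ident antipode_linear _ _ g])
    show "?P \<in> module_hom K H H" by (assumption | rule rules)+
    fix c assume c: "c \<in> carrier H"
    show "convolution K \<Delta> H S (\<lambda>v. v) c = \<epsilon> c \<odot>\<^bsub>H\<^esub> \<one>\<^bsub>H\<^esub>"
      unfolding convolution_def by (rule antipode_left[OF c])
    have "convolution K \<Delta> H (\<lambda>v. v) ?P c
      = tensor_lift K H (\<lambda>x y. tensor_lift K H (\<lambda>x' y'. x \<otimes>\<^bsub>H\<^esub> x' \<otimes>\<^bsub>H\<^esub> S (y \<otimes>\<^bsub>H\<^esub> y')) (\<Delta> h)) (\<Delta> c)"
      unfolding convolution_def
    proof (rule tensor_lift_cong[OF vs vs vs comult_mem[OF c]])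
      show "bilinear K H H H (\<lambda>x y. x \<otimes>\<^bsub>H\<^esub> tensor_lift K H (\<lambda>x' y'. x' \<otimes>\<^bsub>H\<^esub> S (y \<otimes>\<^bsub>H\<^esub> y')) (\<Delta> h))"
        by (assumption | rule rules)+
      fix x y assume x: "x \<in> carrier H" and y: "y \<in> carrier H"
      have "x \<otimes>\<^bsub>H\<^esub> tensor_lift K H (\<lambda>x' y'. x' \<otimes>\<^bsub>H\<^esub> S (y \<otimes>\<^bsub>H\<^esub> y')) (\<Delta> h)
        = tensor_lift K H (\<lambda>x' y'. x \<otimes>\<^bsub>H\<^esub> (x' \<otimes>\<^bsub>H\<^esub> S (y \<otimes>\<^bsub>H\<^esub> y'))) (\<Delta> h)"
        by (rule hom_tensor_lift[OF vs vs vs vs]) (assumption | rule rules x y)+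
      also have "\<dots> = tensor_lift K H (\<lambda>x' y'. x \<otimes>\<^bsub>H\<^esub> x' \<otimes>\<^bsub>H\<^esub> S (y \<otimes>\<^bsub>H\<^esub> y')) (\<Delta> h)"
        by (rule tensor_lift_cong[OF vs vs vs comult_mem[OF h]])
          ((assumption | rule rules x y)+, simp add: m_assoc antipode_mem x y)
      finally show "x \<otimes>\<^bsub>H\<^esub> tensor_lift K H (\<lambda>x' y'. x' \<otimes>\<^bsub>H\<^esub> S (y \<otimes>\<^bsub>H\<^esub> y')) (\<Delta> h)
        = tensor_lift K H (\<lambda>x' y'. x \<otimes>\<^bsub>H\<^esub> x' \<otimes>\<^bsub>H\<^esub> S (y \<otimes>\<^bsub>H\<^esub> y')) (\<Delta> h)" .
    qed
    also have "\<dots> = tensor_lift K H (\<lambda>x y. x \<otimes>\<^bsub>H\<^esub> S y) (\<Delta> (c \<otimes>\<^bsub>H\<^esub> h))"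
      unfolding ring_hom_mult[OF comult_hom c h]
      by (rule sym, rule tensor_lift_tensor_mult[OF H_alg H_alg vs]) (assumption | rule rules c)+
    also have "\<dots> = \<epsilon> h \<odot>\<^bsub>H\<^esub> (\<epsilon> c \<odot>\<^bsub>H\<^esub> \<one>\<^bsub>H\<^esub>)"
      using c h by (simp add: antipode_right ring_hom_mult[OF counit_hom] counit_mem smult_assoc1[symmetric]
          R.m_comm)
    finally show "convolution K \<Delta> H (\<lambda>v. v) ?P c = \<epsilon> h \<odot>\<^bsub>H\<^esub> (\<epsilon> c \<odot>\<^bsub>H\<^esub> \<one>\<^bsub>H\<^esub>)" .
  qed
  also have "\<dots> = tensor_lift K H (\<lambda>x y. \<epsilon> y \<odot>\<^bsub>H\<^esub> (\<epsilon> h \<odot>\<^bsub>H\<^esub> S x)) (\<Delta> g)"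
    unfolding convolution_def
    by (rule tensor_lift_cong[OF vs vs vs comult_mem[OF g]])
      ((assumption | rule rules)+, use h in \<open>simp add: smult_mult_right counit_mem antipode_mem
        smult_assoc1[symmetric] R.m_comm\<close>)
  also have "\<dots> = \<epsilon> h \<odot>\<^bsub>H\<^esub> S g"
    by (rule counit_right_lift[OF vs _ g]) (assumption | rule rules)+
  finally show ?thesis .
qed

text \<open>
  Now \<open>g\<close> is fixed: by the previous lemma, convolving \<open>h \<mapsto> S(g h)\<close> with the identity from the left
  gives \<open>h \<mapsto> \<epsilon>(h) S(g)\<close>, whence \<open>S(g h) = S(h\<^sub>1) \<epsilon>(h\<^sub>2) S(g)\<close>.  Treating the two variables one after
  the other avoids convolution on the coalgebra \<open>H \<otimes> H\<close>.
\<close>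

lemma antipode_mult:
  assumes g: "g \<in> carrier H" and h: "h \<in> carrier H"
  shows "S (g \<otimes>\<^bsub>H\<^esub> h) = S h \<otimes>\<^bsub>H\<^esub> S g"
proof -
  note rules = multilinear_hopf g
  have "S (g \<otimes>\<^bsub>H\<^esub> h) = convolution K \<Delta> H S (\<lambda>h. \<epsilon> h \<odot>\<^bsub>H\<^esub> S g) h"
  proof (rule convolution_cancel_left[OF H_alg _ module_hom_ident antipode_linear _ _ h])
    show "(\<lambda>h. S (g \<otimes>\<^bsub>H\<^esub> h)) \<in> module_hom K H H" by (assumption | rule rules)+
    fix c assume c: "c \<in> carrier H"
    show "convolution K \<Delta> H S (\<lambda>v. v) c = \<epsilon> c \<odot>\<^bsub>H\<^esub> \<one>\<^bsub>H\<^esub>"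
      unfolding convolution_def by (rule antipode_left[OF c])
    show "convolution K \<Delta> H (\<lambda>v. v) (\<lambda>h. S (g \<otimes>\<^bsub>H\<^esub> h)) c = \<epsilon> c \<odot>\<^bsub>H\<^esub> S g"
      unfolding convolution_def by (rule antipode_partial_mult[OF g c])
  qed
  also have "\<dots> = tensor_lift K H (\<lambda>x y. \<epsilon> y \<odot>\<^bsub>H\<^esub> (S x \<otimes>\<^bsub>H\<^esub> S g)) (\<Delta> h)"
    unfolding convolution_def
    by (rule tensor_lift_cong[OF vs vs vs comult_mem[OF h]])
      ((assumption | rule rules)+, use g in \<open>simp add: smult_mult_right counit_mem antipode_mem\<close>)
  also have "\<dots> = S h \<otimes>\<^bsub>H\<^esub> S g"
    by (rule counit_right_lift[OF vs _ h]) (assumption | rule rules)+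
  finally show ?thesis .
qed

text \<open>
  In Sweedler notation, \<open>\<psi>(m\<^sub>0, m\<^sub>3, m\<^sub>1 S(m\<^sub>2)) = \<psi>(m\<^sub>0, m\<^sub>1, 1)\<close>.  Coassociativity is used twice to bring
  \<open>m\<^sub>1\<close> and \<open>m\<^sub>2\<close> together under one coproduct.
\<close>

lemma comodule_antipode_cancel:
  assumes M: "right_comodule K H \<Delta> \<epsilon> M \<rho>" and U: "vectorspace K U"
    and psi: "trilinear K M H H U \<psi>" and m: "m \<in> carrier M"
  shows "tensor_lift K U (\<lambda>u h. tensor_lift K U (\<lambda>u0 u1. tensor_lift K U
       (\<lambda>h1 h2. \<psi> u0 h2 (u1 \<otimes>\<^bsub>H\<^esub> S h1)) (\<Delta> h)) (\<rho> u)) (\<rho> m)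
    = tensor_lift K U (\<lambda>u h. \<psi> u h \<one>\<^bsub>H\<^esub>) (\<rho> m)"
proof -
  interpret M: right_comodule K H \<Delta> \<epsilon> M \<rho> by (rule M)
  note rules = multilinear_hopf M.M_vs U trilinear_comp[OF psi] M.coaction_mem m
    module_hom_comp[OF M.coaction_linear]
  have "tensor_lift K U (\<lambda>u h. tensor_lift K U (\<lambda>u0 u1. tensor_lift K U
       (\<lambda>h1 h2. \<psi> u0 h2 (u1 \<otimes>\<^bsub>H\<^esub> S h1)) (\<Delta> h)) (\<rho> u)) (\<rho> m)
    = tensor_lift K U (\<lambda>u z. tensor_lift K U (\<lambda>u1 h. tensor_lift K U
       (\<lambda>h1 h2. \<psi> u h2 (u1 \<otimes>\<^bsub>H\<^esub> S h1)) (\<Delta> h)) (\<Delta> z)) (\<rho> m)"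
    by (rule M.coassoc_lift[OF U _ m]) (assumption | rule rules)+
  also have "\<dots> = tensor_lift K U (\<lambda>u h. \<psi> u h \<one>\<^bsub>H\<^esub>) (\<rho> m)"
  proof (rule tensor_lift_cong[OF M.M_vs vs U M.coaction_mem[OF m]])
    show "bilinear K M H U (\<lambda>u z. tensor_lift K U (\<lambda>u1 h. tensor_lift K U
       (\<lambda>h1 h2. \<psi> u h2 (u1 \<otimes>\<^bsub>H\<^esub> S h1)) (\<Delta> h)) (\<Delta> z))"
      by (assumption | rule rules)+
    fix u z assume u: "u \<in> carrier M" and z: "z \<in> carrier H"
    have "tensor_lift K U (\<lambda>u1 h. tensor_lift K U (\<lambda>h1 h2. \<psi> u h2 (u1 \<otimes>\<^bsub>H\<^esub> S h1)) (\<Delta> h)) (\<Delta> z)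
      = tensor_lift K U (\<lambda>w h2. tensor_lift K U (\<lambda>u1 h1. \<psi> u h2 (u1 \<otimes>\<^bsub>H\<^esub> S h1)) (\<Delta> w)) (\<Delta> z)"
      by (rule comult_coassoc_lift[OF U _ z, symmetric]) (assumption | rule rules u)+
    also have "\<dots> = tensor_lift K U (\<lambda>w h2. \<epsilon> w \<odot>\<^bsub>U\<^esub> \<psi> u h2 \<one>\<^bsub>H\<^esub>) (\<Delta> z)"
    proof (rule tensor_lift_cong[OF vs vs U comult_mem[OF z]])
      show "bilinear K H H U
        (\<lambda>w h2. tensor_lift K U (\<lambda>u1 h1. \<psi> u h2 (u1 \<otimes>\<^bsub>H\<^esub> S h1)) (\<Delta> w))"
        by (assumption | rule rules u)+
      fix w h2 assume w: "w \<in> carrier H" and h2: "h2 \<in> carrier H"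
      show "tensor_lift K U (\<lambda>u1 h1. \<psi> u h2 (u1 \<otimes>\<^bsub>H\<^esub> S h1)) (\<Delta> w) = \<epsilon> w \<odot>\<^bsub>U\<^esub> \<psi> u h2 \<one>\<^bsub>H\<^esub>"
        by (rule antipode_right_lift[OF U trilinearD(3)[OF psi u h2] w])
    qed
    also have "\<dots> = \<psi> u z \<one>\<^bsub>H\<^esub>"
      by (rule counit_left_lift[OF U _ z]) (assumption | rule rules u)+
    finally show "tensor_lift K U (\<lambda>u1 h. tensor_lift K U
       (\<lambda>h1 h2. \<psi> u h2 (u1 \<otimes>\<^bsub>H\<^esub> S h1)) (\<Delta> h)) (\<Delta> z) = \<psi> u z \<one>\<^bsub>H\<^esub>" .
  qed
  finally show ?thesis .
qed

end

section \<open>Multiplicative total integrals\<close>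

locale integral_comodule_algebra = comodule_algebra K H \<Delta> \<epsilon> S A \<rho>
  for K :: "('k, 'r) ring_scheme" and H :: "('k, 'h, 'm) module_scheme" and \<Delta> and \<epsilon> and S
    and A :: "('k, 'a, 'n) module_scheme" and \<rho> +
  fixes f :: "'h \<Rightarrow> 'a"
  assumes integral: "total_integral K H \<Delta> A \<rho> f"
    and integral_hom: "f \<in> ring_hom H A"
begin

abbreviation AH where "AH \<equiv> tensor K A H"

lemma A_alg: "assoc_algebra K A" ..

lemmas H_vs = H.vs and A_vs = M_vs

lemma integral_linear: "f \<in> module_hom K H A"
  using integral by (simp add: total_integral_def)

lemmas f_mem = module_hom_mem[OF integral_linear]
  and f_mult = ring_hom_mult[OF integral_hom]
  and f_one = ring_hom_one[OF integral_hom]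
  and \<rho>_mult = ring_hom_mult[OF coaction_hom]
  and \<rho>_one = ring_hom_one[OF coaction_hom]

lemmas coaction_rules = H.multilinear_hopf A_alg A_vs coaction_mem module_hom_comp[OF coaction_linear]
  f_mem module_hom_comp[OF integral_linear]

lemma AH_alg: "assoc_algebra K AH" and AH_vs: "vectorspace K AH"
  by (rule coaction_rules)+

lemma convolution_inverse_integral: "convolution_inverse K H \<Delta> \<epsilon> A f (f \<circ> S)"
  unfolding convolution_inverse_def
proof (intro conjI ballI)
  show "f \<circ> S \<in> module_hom K H A"
    unfolding comp_def by (assumption | rule coaction_rules)+
  fix h assume h: "h \<in> carrier H"
  have "tensor_lift K A (\<lambda>x y. f (x \<otimes>\<^bsub>H\<^esub> S y)) (\<Delta> h) = \<epsilon> h \<odot>\<^bsub>A\<^esub> f \<one>\<^bsub>H\<^esub>"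
    by (rule H.antipode_right_lift[OF A_vs integral_linear h])
  moreover have "tensor_lift K A (\<lambda>x y. f x \<otimes>\<^bsub>A\<^esub> f (S y)) (\<Delta> h)
    = tensor_lift K A (\<lambda>x y. f (x \<otimes>\<^bsub>H\<^esub> S y)) (\<Delta> h)"
    by (rule tensor_lift_cong[OF H_vs H_vs A_vs H.comult_mem[OF h]])
      ((assumption | rule coaction_rules)+, simp add: f_mult H.antipode_mem)
  ultimately show "convolution K \<Delta> A f (f \<circ> S) h = \<epsilon> h \<odot>\<^bsub>A\<^esub> \<one>\<^bsub>A\<^esub>"
    by (simp add: convolution_def f_one)
  have "tensor_lift K A (\<lambda>x y. f (S x \<otimes>\<^bsub>H\<^esub> y)) (\<Delta> h) = \<epsilon> h \<odot>\<^bsub>A\<^esub> f \<one>\<^bsub>H\<^esub>"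
    by (rule H.antipode_left_lift[OF A_vs integral_linear h])
  moreover have "tensor_lift K A (\<lambda>x y. f (S x) \<otimes>\<^bsub>A\<^esub> f y) (\<Delta> h)
    = tensor_lift K A (\<lambda>x y. f (S x \<otimes>\<^bsub>H\<^esub> y)) (\<Delta> h)"
    by (rule tensor_lift_cong[OF H_vs H_vs A_vs H.comult_mem[OF h]])
      ((assumption | rule coaction_rules)+, simp add: f_mult H.antipode_mem)
  ultimately show "convolution K \<Delta> A (f \<circ> S) f h = \<epsilon> h \<odot>\<^bsub>A\<^esub> \<one>\<^bsub>A\<^esub>"
    by (simp add: convolution_def f_one)
qed

lemma f_antipode_right:
  "h \<in> carrier H \<Longrightarrow> tensor_lift K A (\<lambda>x y. f x \<otimes>\<^bsub>A\<^esub> f (S y)) (\<Delta> h) = \<epsilon> h \<odot>\<^bsub>A\<^esub> \<one>\<^bsub>A\<^esub>"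
  and f_antipode_left:
  "h \<in> carrier H \<Longrightarrow> tensor_lift K A (\<lambda>x y. f (S x) \<otimes>\<^bsub>A\<^esub> f y) (\<Delta> h) = \<epsilon> h \<odot>\<^bsub>A\<^esub> \<one>\<^bsub>A\<^esub>"
  using convolution_inverse_integral by (simp_all add: convolution_inverse_def convolution_def)

lemma coaction_f: "h \<in> carrier H \<Longrightarrow> \<rho> (f h) = tensor_lift K AH (\<lambda>x y. tens K A H (f x) y) (\<Delta> h)"
  using integral by (simp add: total_integral_def tensor_map_def)

text \<open>
  Both \<open>h \<mapsto> \<rho>(f(S h))\<close> and \<open>h \<mapsto> f(S h\<^sub>2) \<otimes> S h\<^sub>1\<close> are convolution inverses of \<open>\<rho> \<circ> f\<close> in \<open>A \<otimes> H\<close>: the first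
  because \<open>\<rho> \<circ> f\<close> is an algebra map, the second because
  \<open>f(h\<^sub>1) f(S h\<^sub>4) \<otimes> h\<^sub>2 S(h\<^sub>3) = f(h\<^sub>1) f(S h\<^sub>2) \<otimes> 1\<close>.
\<close>

lemma coaction_f_antipode:
  assumes h: "h \<in> carrier H"
  shows "\<rho> (f (S h)) = tensor_lift K AH (\<lambda>x y. tens K A H (f (S y)) (S x)) (\<Delta> h)"
proof -
  let ?G = "\<lambda>h. tensor_lift K AH (\<lambda>x y. tens K A H (f (S y)) (S x)) (\<Delta> h)"
  interpret AH: assoc_algebra K AH by (rule AH_alg)
  have "?G h = convolution K \<Delta> AH (\<lambda>h. \<rho> (f (S h))) (\<lambda>h. \<epsilon> h \<odot>\<^bsub>AH\<^esub> \<one>\<^bsub>AH\<^esub>) h"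
  proof (rule H.convolution_cancel_left[OF AH_alg _ _ _ _ _ h, where F = "\<lambda>h. \<rho> (f h)"])
    show "?G \<in> module_hom K H AH" by (assumption | rule coaction_rules)+
    show "(\<lambda>h. \<rho> (f h)) \<in> module_hom K H AH" by (assumption | rule coaction_rules)+
    show "(\<lambda>h. \<rho> (f (S h))) \<in> module_hom K H AH" by (assumption | rule coaction_rules)+
    fix c assume c: "c \<in> carrier H"
    have "convolution K \<Delta> AH (\<lambda>h. \<rho> (f (S h))) (\<lambda>h. \<rho> (f h)) c
      = tensor_lift K AH (\<lambda>x y. \<rho> (f (S x \<otimes>\<^bsub>H\<^esub> y))) (\<Delta> c)"
      unfolding convolution_def
      by (rule tensor_lift_cong[OF H_vs H_vs AH_vs H.comult_mem[OF c]])
        ((assumption | rule coaction_rules)+, simp add: f_mult \<rho>_mult f_mem H.antipode_mem)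
    also have "\<dots> = \<epsilon> c \<odot>\<^bsub>AH\<^esub> \<rho> (f \<one>\<^bsub>H\<^esub>)"
      by (rule H.antipode_left_lift[OF AH_vs _ c]) (assumption | rule coaction_rules)+
    finally show "convolution K \<Delta> AH (\<lambda>h. \<rho> (f (S h))) (\<lambda>h. \<rho> (f h)) c = \<epsilon> c \<odot>\<^bsub>AH\<^esub> \<one>\<^bsub>AH\<^esub>"
      by (simp add: f_one \<rho>_one)
    have "convolution K \<Delta> AH (\<lambda>h. \<rho> (f h)) ?G c
      = tensor_lift K AH (\<lambda>x y. tensor_lift K AH (\<lambda>x1 x2. tensor_lift K AH
          (\<lambda>y1 y2. tens K A H (f x1 \<otimes>\<^bsub>A\<^esub> f (S y2)) (x2 \<otimes>\<^bsub>H\<^esub> S y1)) (\<Delta> y)) (\<Delta> x)) (\<Delta> c)"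
      unfolding convolution_def
    proof (rule tensor_lift_cong[OF H_vs H_vs AH_vs H.comult_mem[OF c]])
      show "bilinear K H H AH (\<lambda>x y. \<rho> (f x) \<otimes>\<^bsub>AH\<^esub> ?G y)" by (assumption | rule coaction_rules)+
      fix x y assume x: "x \<in> carrier H" and y: "y \<in> carrier H"
      have "\<rho> (f x) \<otimes>\<^bsub>AH\<^esub> ?G y
        = tensor_lift K AH (\<lambda>x1 x2. tensor_lift K AH
            (\<lambda>y1 y2. tens K A H (f x1) x2 \<otimes>\<^bsub>AH\<^esub> tens K A H (f (S y2)) (S y1)) (\<Delta> y)) (\<Delta> x)"
        unfolding coaction_f[OF x]
        by (rule mult_tensor_lift[OF H_vs H_vs H_vs H_vs AH_alg]) (assumption | rule coaction_rules x y)+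
      also have "\<dots> = tensor_lift K AH (\<lambda>x1 x2. tensor_lift K AH
            (\<lambda>y1 y2. tens K A H (f x1 \<otimes>\<^bsub>A\<^esub> f (S y2)) (x2 \<otimes>\<^bsub>H\<^esub> S y1)) (\<Delta> y)) (\<Delta> x)"
        by (rule tensor_lift_cong[OF H_vs H_vs AH_vs H.comult_mem[OF x]], (assumption | rule coaction_rules y)+,
            rule tensor_lift_cong[OF H_vs H_vs AH_vs H.comult_mem[OF y]], (assumption | rule coaction_rules y)+,
            simp add: tensor_mult_tens[OF A_alg H.H_alg] f_mem H.antipode_mem)
      finally show "\<rho> (f x) \<otimes>\<^bsub>AH\<^esub> ?G y = tensor_lift K AH (\<lambda>x1 x2. tensor_lift K AH
            (\<lambda>y1 y2. tens K A H (f x1 \<otimes>\<^bsub>A\<^esub> f (S y2)) (x2 \<otimes>\<^bsub>H\<^esub> S y1)) (\<Delta> y)) (\<Delta> x)" .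
    qed
    also have "\<dots> = tensor_lift K AH (\<lambda>x y. tens K A H (f x \<otimes>\<^bsub>A\<^esub> f (S y)) \<one>\<^bsub>H\<^esub>) (\<Delta> c)"
      by (rule H.comodule_antipode_cancel[OF H.regular_comodule AH_vs _ c,
            where \<psi> = "\<lambda>u h p. tens K A H (f u \<otimes>\<^bsub>A\<^esub> f (S h)) p"])
        (assumption | rule coaction_rules)+
    also have "\<dots> = tens K A H (tensor_lift K A (\<lambda>x y. f x \<otimes>\<^bsub>A\<^esub> f (S y)) (\<Delta> c)) \<one>\<^bsub>H\<^esub>"
      by (rule sym, rule hom_tensor_lift[OF H_vs H_vs A_vs AH_vs _ _ H.comult_mem[OF c],
            where g = "\<lambda>r. tens K A H r \<one>\<^bsub>H\<^esub>"])
        (assumption | rule coaction_rules)+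
    also have "\<dots> = \<epsilon> c \<odot>\<^bsub>AH\<^esub> tens K A H \<one>\<^bsub>A\<^esub> \<one>\<^bsub>H\<^esub>"
      unfolding f_antipode_right[OF c]
      by (rule module_hom_smult[of "\<lambda>r. tens K A H r \<one>\<^bsub>H\<^esub>"]) (assumption | rule coaction_rules c)+
    finally show "convolution K \<Delta> AH (\<lambda>h. \<rho> (f h)) ?G c = \<epsilon> c \<odot>\<^bsub>AH\<^esub> \<one>\<^bsub>AH\<^esub>"
      by (simp add: tensor_one[OF A_alg H.H_alg])
  qed
  also have "\<dots> = tensor_lift K AH (\<lambda>x y. \<epsilon> y \<odot>\<^bsub>AH\<^esub> \<rho> (f (S x))) (\<Delta> h)"
    unfolding convolution_def
  proof (rule tensor_lift_cong[OF H_vs H_vs AH_vs H.comult_mem[OF h]])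
    fix x y assume x: "x \<in> carrier H" and y: "y \<in> carrier H"
    have "\<rho> (f (S x)) \<in> carrier AH" by (assumption | rule coaction_rules x)+
    then show "\<rho> (f (S x)) \<otimes>\<^bsub>AH\<^esub> (\<epsilon> y \<odot>\<^bsub>AH\<^esub> \<one>\<^bsub>AH\<^esub>) = \<epsilon> y \<odot>\<^bsub>AH\<^esub> \<rho> (f (S x))"
      using AH.smult_mult_right[OF H.counit_mem[OF y] _ AH.one_closed] AH.r_one by simp
  qed (assumption | rule coaction_rules)+
  also have "\<dots> = \<rho> (f (S h))"
    by (rule H.counit_right_lift[OF AH_vs _ h]) (assumption | rule coaction_rules)+
  finally show ?thesis by simp
qed

section \<open>The projection onto the coinvariants\<close>

text \<open>
  The projection \<open>a \<mapsto> a\<^sub>0 f(S a\<^sub>1)\<close> onto the coinvariants that belongs to a cleft extension.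
\<close>

definition coinvariant_projection :: "'a \<Rightarrow> 'a" where
  "coinvariant_projection a = tensor_lift K A (\<lambda>u h. u \<otimes>\<^bsub>A\<^esub> f (S h)) (\<rho> a)"

lemma coinvariant_projection_hom: "coinvariant_projection \<in> module_hom K A A"
  unfolding coinvariant_projection_def[abs_def] by (assumption | rule coaction_rules)+

lemmas coinvariant_projection_mem = module_hom_mem[OF coinvariant_projection_hom]

lemma coinvariant_projection_coinvariant:
  assumes a: "a \<in> carrier A"
  shows "coinvariant_projection a \<in> coinvariants K H A \<rho>"
proof -
  have "\<rho> (coinvariant_projection a) = tensor_lift K AH (\<lambda>u h. \<rho> (u \<otimes>\<^bsub>A\<^esub> f (S h))) (\<rho> a)"
    unfolding coinvariant_projection_def
    by (rule hom_tensor_lift[OF A_vs H_vs A_vs AH_vs coaction_linear]) (assumption | rule coaction_rules a)+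
  also have "\<dots> = tensor_lift K AH (\<lambda>u h. tensor_lift K AH (\<lambda>u0 u1. tensor_lift K AH
       (\<lambda>h1 h2. tens K A H (u0 \<otimes>\<^bsub>A\<^esub> f (S h2)) (u1 \<otimes>\<^bsub>H\<^esub> S h1)) (\<Delta> h)) (\<rho> u)) (\<rho> a)"
  proof (rule tensor_lift_cong[OF A_vs H_vs AH_vs coaction_mem[OF a]])
    show "bilinear K A H AH (\<lambda>u h. \<rho> (u \<otimes>\<^bsub>A\<^esub> f (S h)))" by (assumption | rule coaction_rules)+
    fix u h assume u: "u \<in> carrier A" and h: "h \<in> carrier H"
    have "\<rho> (u \<otimes>\<^bsub>A\<^esub> f (S h)) = tensor_lift K AH (tens K A H) (\<rho> u)
        \<otimes>\<^bsub>AH\<^esub> tensor_lift K AH (\<lambda>x y. tens K A H (f (S y)) (S x)) (\<Delta> h)"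
      using u h by (simp add: \<rho>_mult f_mem H.antipode_mem coaction_f_antipode
          tensor_lift_tens_self[OF A_vs H_vs coaction_mem[OF u]])
    also have "\<dots> = tensor_lift K AH (\<lambda>u0 u1. tensor_lift K AH
       (\<lambda>h1 h2. tens K A H u0 u1 \<otimes>\<^bsub>AH\<^esub> tens K A H (f (S h2)) (S h1)) (\<Delta> h)) (\<rho> u)"
      by (rule mult_tensor_lift[OF A_vs H_vs H_vs H_vs AH_alg]) (assumption | rule coaction_rules u h)+
    also have "\<dots> = tensor_lift K AH (\<lambda>u0 u1. tensor_lift K AH
       (\<lambda>h1 h2. tens K A H (u0 \<otimes>\<^bsub>A\<^esub> f (S h2)) (u1 \<otimes>\<^bsub>H\<^esub> S h1)) (\<Delta> h)) (\<rho> u)"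
      by (rule tensor_lift_cong[OF A_vs H_vs AH_vs coaction_mem[OF u]], (assumption | rule coaction_rules h)+,
          rule tensor_lift_cong[OF H_vs H_vs AH_vs H.comult_mem[OF h]], (assumption | rule coaction_rules h)+,
          simp add: tensor_mult_tens[OF A_alg H.H_alg] f_mem H.antipode_mem)
    finally show "\<rho> (u \<otimes>\<^bsub>A\<^esub> f (S h)) = tensor_lift K AH (\<lambda>u0 u1. tensor_lift K AH
       (\<lambda>h1 h2. tens K A H (u0 \<otimes>\<^bsub>A\<^esub> f (S h2)) (u1 \<otimes>\<^bsub>H\<^esub> S h1)) (\<Delta> h)) (\<rho> u)" .
  qed
  also have "\<dots> = tensor_lift K AH (\<lambda>u h. tens K A H (u \<otimes>\<^bsub>A\<^esub> f (S h)) \<one>\<^bsub>H\<^esub>) (\<rho> a)"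
    by (rule H.comodule_antipode_cancel[OF right_comodule_axioms AH_vs _ a,
          where \<psi> = "\<lambda>u h p. tens K A H (u \<otimes>\<^bsub>A\<^esub> f (S h)) p"])
      (assumption | rule coaction_rules)+
  also have "\<dots> = tens K A H (coinvariant_projection a) \<one>\<^bsub>H\<^esub>"
    unfolding coinvariant_projection_def
    by (rule sym, rule hom_tensor_lift[OF A_vs H_vs A_vs AH_vs _ _ coaction_mem[OF a],
          where g = "\<lambda>r. tens K A H r \<one>\<^bsub>H\<^esub>"])
      (assumption | rule coaction_rules)+
  finally show ?thesis
    using coinvariant_projection_mem[OF a] by (simp add: coinvariants_def)
qed

lemma coaction_mult_coinvariant:
  assumes a: "a \<in> carrier A" and b: "b \<in> coinvariants K H A \<rho>"
  shows "\<rho> (a \<otimes>\<^bsub>A\<^esub> b) = tensor_lift K AH (\<lambda>u h. tens K A H (u \<otimes>\<^bsub>A\<^esub> b) h) (\<rho> a)"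
    and "\<rho> (b \<otimes>\<^bsub>A\<^esub> a) = tensor_lift K AH (\<lambda>u h. tens K A H (b \<otimes>\<^bsub>A\<^esub> u) h) (\<rho> a)"
proof -
  have bA: "b \<in> carrier A" and \<rho>b: "\<rho> b = tens K A H b \<one>\<^bsub>H\<^esub>"
    using b by (auto simp: coinvariants_def)
  have "\<rho> (a \<otimes>\<^bsub>A\<^esub> b) = tensor_lift K AH (tens K A H) (\<rho> a) \<otimes>\<^bsub>AH\<^esub> tens K A H b \<one>\<^bsub>H\<^esub>"
    using a bA by (simp add: \<rho>_mult \<rho>b tensor_lift_tens_self[OF A_vs H_vs coaction_mem[OF a]])
  also have "\<dots> = tensor_lift K AH (\<lambda>u h. tens K A H u h \<otimes>\<^bsub>AH\<^esub> tens K A H b \<one>\<^bsub>H\<^esub>) (\<rho> a)"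
    by (rule hom_tensor_lift[OF A_vs H_vs AH_vs AH_vs _ _ coaction_mem[OF a],
          where g = "\<lambda>r. r \<otimes>\<^bsub>AH\<^esub> tens K A H b \<one>\<^bsub>H\<^esub>"])
      (assumption | rule coaction_rules bA)+
  also have "\<dots> = tensor_lift K AH (\<lambda>u h. tens K A H (u \<otimes>\<^bsub>A\<^esub> b) h) (\<rho> a)"
    by (rule tensor_lift_cong[OF A_vs H_vs AH_vs coaction_mem[OF a]])
      ((assumption | rule coaction_rules bA)+, simp add: tensor_mult_tens[OF A_alg H.H_alg] bA)
  finally show "\<rho> (a \<otimes>\<^bsub>A\<^esub> b) = tensor_lift K AH (\<lambda>u h. tens K A H (u \<otimes>\<^bsub>A\<^esub> b) h) (\<rho> a)" .
  have "\<rho> (b \<otimes>\<^bsub>A\<^esub> a) = tens K A H b \<one>\<^bsub>H\<^esub> \<otimes>\<^bsub>AH\<^esub> tensor_lift K AH (tens K A H) (\<rho> a)"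
    using a bA by (simp add: \<rho>_mult \<rho>b tensor_lift_tens_self[OF A_vs H_vs coaction_mem[OF a]])
  also have "\<dots> = tensor_lift K AH (\<lambda>u h. tens K A H b \<one>\<^bsub>H\<^esub> \<otimes>\<^bsub>AH\<^esub> tens K A H u h) (\<rho> a)"
    by (rule hom_tensor_lift[OF A_vs H_vs AH_vs AH_vs _ _ coaction_mem[OF a],
          where g = "\<lambda>r. tens K A H b \<one>\<^bsub>H\<^esub> \<otimes>\<^bsub>AH\<^esub> r"])
      (assumption | rule coaction_rules bA)+
  also have "\<dots> = tensor_lift K AH (\<lambda>u h. tens K A H (b \<otimes>\<^bsub>A\<^esub> u) h) (\<rho> a)"
    by (rule tensor_lift_cong[OF A_vs H_vs AH_vs coaction_mem[OF a]])
      ((assumption | rule coaction_rules bA)+, simp add: tensor_mult_tens[OF A_alg H.H_alg] bA)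
  finally show "\<rho> (b \<otimes>\<^bsub>A\<^esub> a) = tensor_lift K AH (\<lambda>u h. tens K A H (b \<otimes>\<^bsub>A\<^esub> u) h) (\<rho> a)" .
qed

text \<open>
  The elements \<open>f(h\<^sub>1) b f(S h\<^sub>2)\<close> through which coinvariants are moved past values of \<open>f\<close> are
  themselves projections, hence coinvariant.
\<close>

lemma coinvariant_projection_f_mult:
  assumes h: "h \<in> carrier H" and b: "b \<in> coinvariants K H A \<rho>"
  shows "coinvariant_projection (f h \<otimes>\<^bsub>A\<^esub> b)
    = tensor_lift K A (\<lambda>x y. f x \<otimes>\<^bsub>A\<^esub> b \<otimes>\<^bsub>A\<^esub> f (S y)) (\<Delta> h)"
proof -
  have bA: "b \<in> carrier A" and \<rho>b: "\<rho> b = tens K A H b \<one>\<^bsub>H\<^esub>"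
    using b by (auto simp: coinvariants_def)
  let ?L = "\<lambda>t. tensor_lift K A (\<lambda>u h. u \<otimes>\<^bsub>A\<^esub> f (S h)) t"
  have fH: "tensor_map K A H f id (\<Delta> h) = \<rho> (f h)"
    using integral h by (simp add: total_integral_def)
  have "coinvariant_projection (f h \<otimes>\<^bsub>A\<^esub> b)
    = tensor_lift K A (\<lambda>u k. ?L (tens K A H (u \<otimes>\<^bsub>A\<^esub> b) k)) (\<rho> (f h))"
    unfolding coinvariant_projection_def coaction_mult_coinvariant(1)[OF f_mem[OF h] b]
    by (rule hom_tensor_lift[OF A_vs H_vs AH_vs A_vs]) (assumption | rule coaction_rules bA h)+
  also have "\<dots> = tensor_lift K A (\<lambda>u k. u \<otimes>\<^bsub>A\<^esub> b \<otimes>\<^bsub>A\<^esub> f (S k)) (\<rho> (f h))"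
  proof (rule sym, rule tensor_lift_cong[OF A_vs H_vs A_vs coaction_mem[OF f_mem[OF h]]])
    fix u k assume u: "u \<in> carrier A" and k: "k \<in> carrier H"
    show "u \<otimes>\<^bsub>A\<^esub> b \<otimes>\<^bsub>A\<^esub> f (S k) = ?L (tens K A H (u \<otimes>\<^bsub>A\<^esub> b) k)"
      by (rule sym, rule tensor_lift_tens[OF A_vs H_vs A_vs]) (assumption | rule coaction_rules bA u k)+
  qed (assumption | rule coaction_rules bA)+
  also have "\<dots> = tensor_lift K A (\<lambda>x y. f x \<otimes>\<^bsub>A\<^esub> b \<otimes>\<^bsub>A\<^esub> f (S (id y))) (\<Delta> h)"
    unfolding fH[symmetric]
    by (rule tensor_lift_tensor_map[OF H_vs H_vs A_vs H_vs A_vs integral_linear id_hom _ H.comult_mem[OF h]])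
      (assumption | rule coaction_rules bA)+
  finally show ?thesis by simp
qed

lemmas projection_rules = coaction_rules coinvariant_projection_mem
  module_hom_comp[OF coinvariant_projection_hom]

text \<open>
  Insert \<open>f(S h\<^sub>1) f(h\<^sub>2) = \<epsilon>(h) 1\<close> to the left of \<open>b\<close>.  The next lemma inserts \<open>f(S h\<^sub>2) f(h\<^sub>3)\<close> to
  the right of \<open>f(h) b\<close>.
\<close>

lemma coinvariant_mult_f_antipode:
  assumes h: "h \<in> carrier H" and b: "b \<in> coinvariants K H A \<rho>"
  shows "b \<otimes>\<^bsub>A\<^esub> f (S h)
    = tensor_lift K A (\<lambda>x y. f (S x) \<otimes>\<^bsub>A\<^esub> coinvariant_projection (f y \<otimes>\<^bsub>A\<^esub> b)) (\<Delta> h)"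
proof -
  have bA: "b \<in> carrier A" using b by (auto simp: coinvariants_def)
  note rules' = projection_rules bA
  have "tensor_lift K A (\<lambda>x y. f (S x) \<otimes>\<^bsub>A\<^esub> coinvariant_projection (f y \<otimes>\<^bsub>A\<^esub> b)) (\<Delta> h)
    = tensor_lift K A (\<lambda>x z. tensor_lift K A
        (\<lambda>y w. f (S x) \<otimes>\<^bsub>A\<^esub> (f y \<otimes>\<^bsub>A\<^esub> b \<otimes>\<^bsub>A\<^esub> f (S w))) (\<Delta> z)) (\<Delta> h)"
  proof (rule tensor_lift_cong[OF H_vs H_vs A_vs H.comult_mem[OF h]])
    fix x z assume x: "x \<in> carrier H" and z: "z \<in> carrier H"
    show "f (S x) \<otimes>\<^bsub>A\<^esub> coinvariant_projection (f z \<otimes>\<^bsub>A\<^esub> b)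
      = tensor_lift K A (\<lambda>y w. f (S x) \<otimes>\<^bsub>A\<^esub> (f y \<otimes>\<^bsub>A\<^esub> b \<otimes>\<^bsub>A\<^esub> f (S w))) (\<Delta> z)"
      unfolding coinvariant_projection_f_mult[OF z b]
      by (rule hom_tensor_lift[OF H_vs H_vs A_vs A_vs]) (assumption | rule rules' x z)+
  qed (assumption | rule rules')+
  also have "\<dots> = tensor_lift K A (\<lambda>z w. tensor_lift K A
        (\<lambda>x y. f (S x) \<otimes>\<^bsub>A\<^esub> (f y \<otimes>\<^bsub>A\<^esub> b \<otimes>\<^bsub>A\<^esub> f (S w))) (\<Delta> z)) (\<Delta> h)"
    by (rule H.comult_coassoc_lift[OF A_vs _ h, symmetric]) (assumption | rule rules')+
  also have "\<dots> = tensor_lift K A (\<lambda>z w. \<epsilon> z \<odot>\<^bsub>A\<^esub> (b \<otimes>\<^bsub>A\<^esub> f (S w))) (\<Delta> h)"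
  proof (rule tensor_lift_cong[OF H_vs H_vs A_vs H.comult_mem[OF h]])
    fix z w assume z: "z \<in> carrier H" and w: "w \<in> carrier H"
    have "tensor_lift K A (\<lambda>x y. f (S x) \<otimes>\<^bsub>A\<^esub> (f y \<otimes>\<^bsub>A\<^esub> b \<otimes>\<^bsub>A\<^esub> f (S w))) (\<Delta> z)
      = tensor_lift K A (\<lambda>x y. f (S x) \<otimes>\<^bsub>A\<^esub> f y \<otimes>\<^bsub>A\<^esub> (b \<otimes>\<^bsub>A\<^esub> f (S w))) (\<Delta> z)"
      by (rule tensor_lift_cong[OF H_vs H_vs A_vs H.comult_mem[OF z]])
        ((assumption | rule rules' w)+, simp add: A.m_assoc f_mem H.antipode_mem bA w)
    also have "\<dots> = tensor_lift K A (\<lambda>x y. f (S x) \<otimes>\<^bsub>A\<^esub> f y) (\<Delta> z) \<otimes>\<^bsub>A\<^esub> (b \<otimes>\<^bsub>A\<^esub> f (S w))"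
      by (rule sym, rule hom_tensor_lift[OF H_vs H_vs A_vs A_vs _ _ H.comult_mem[OF z],
            where g = "\<lambda>r. r \<otimes>\<^bsub>A\<^esub> (b \<otimes>\<^bsub>A\<^esub> f (S w))"]) (assumption | rule rules' w)+
    also have "\<dots> = \<epsilon> z \<odot>\<^bsub>A\<^esub> (b \<otimes>\<^bsub>A\<^esub> f (S w))"
      unfolding f_antipode_left[OF z]
      using z w bA by (simp add: A.smult_mult_left H.counit_mem f_mem H.antipode_mem)
    finally show "tensor_lift K A (\<lambda>x y. f (S x) \<otimes>\<^bsub>A\<^esub> (f y \<otimes>\<^bsub>A\<^esub> b \<otimes>\<^bsub>A\<^esub> f (S w))) (\<Delta> z)
      = \<epsilon> z \<odot>\<^bsub>A\<^esub> (b \<otimes>\<^bsub>A\<^esub> f (S w))" .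
  qed (assumption | rule rules')+
  also have "\<dots> = b \<otimes>\<^bsub>A\<^esub> f (S h)"
    by (rule H.counit_left_lift[OF A_vs _ h]) (assumption | rule rules')+
  finally show ?thesis by simp
qed

lemma f_mult_coinvariant:
  assumes h: "h \<in> carrier H" and b: "b \<in> coinvariants K H A \<rho>"
  shows "f h \<otimes>\<^bsub>A\<^esub> b
    = tensor_lift K A (\<lambda>x y. coinvariant_projection (f x \<otimes>\<^bsub>A\<^esub> b) \<otimes>\<^bsub>A\<^esub> f y) (\<Delta> h)"
proof -
  have bA: "b \<in> carrier A" using b by (auto simp: coinvariants_def)
  note rules' = projection_rules bA
  have "tensor_lift K A (\<lambda>x y. coinvariant_projection (f x \<otimes>\<^bsub>A\<^esub> b) \<otimes>\<^bsub>A\<^esub> f y) (\<Delta> h)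
    = tensor_lift K A (\<lambda>z w. tensor_lift K A
        (\<lambda>x y. f x \<otimes>\<^bsub>A\<^esub> b \<otimes>\<^bsub>A\<^esub> f (S y) \<otimes>\<^bsub>A\<^esub> f w) (\<Delta> z)) (\<Delta> h)"
  proof (rule tensor_lift_cong[OF H_vs H_vs A_vs H.comult_mem[OF h]])
    fix z w assume z: "z \<in> carrier H" and w: "w \<in> carrier H"
    show "coinvariant_projection (f z \<otimes>\<^bsub>A\<^esub> b) \<otimes>\<^bsub>A\<^esub> f w
      = tensor_lift K A (\<lambda>x y. f x \<otimes>\<^bsub>A\<^esub> b \<otimes>\<^bsub>A\<^esub> f (S y) \<otimes>\<^bsub>A\<^esub> f w) (\<Delta> z)"
      unfolding coinvariant_projection_f_mult[OF z b]
      by (rule hom_tensor_lift[OF H_vs H_vs A_vs A_vs, where g = "\<lambda>r. r \<otimes>\<^bsub>A\<^esub> f w"])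
        (assumption | rule rules' z w)+
  qed (assumption | rule rules')+
  also have "\<dots> = tensor_lift K A (\<lambda>x z. tensor_lift K A
        (\<lambda>y w. f x \<otimes>\<^bsub>A\<^esub> b \<otimes>\<^bsub>A\<^esub> f (S y) \<otimes>\<^bsub>A\<^esub> f w) (\<Delta> z)) (\<Delta> h)"
    by (rule H.comult_coassoc_lift[OF A_vs _ h]) (assumption | rule rules')+
  also have "\<dots> = tensor_lift K A (\<lambda>x z. \<epsilon> z \<odot>\<^bsub>A\<^esub> (f x \<otimes>\<^bsub>A\<^esub> b)) (\<Delta> h)"
  proof (rule tensor_lift_cong[OF H_vs H_vs A_vs H.comult_mem[OF h]])
    fix x z assume x: "x \<in> carrier H" and z: "z \<in> carrier H"
    have "tensor_lift K A (\<lambda>y w. f x \<otimes>\<^bsub>A\<^esub> b \<otimes>\<^bsub>A\<^esub> f (S y) \<otimes>\<^bsub>A\<^esub> f w) (\<Delta> z)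
      = tensor_lift K A (\<lambda>y w. f x \<otimes>\<^bsub>A\<^esub> b \<otimes>\<^bsub>A\<^esub> (f (S y) \<otimes>\<^bsub>A\<^esub> f w)) (\<Delta> z)"
      by (rule tensor_lift_cong[OF H_vs H_vs A_vs H.comult_mem[OF z]])
        ((assumption | rule rules' x)+, simp add: A.m_assoc f_mem H.antipode_mem bA x)
    also have "\<dots> = f x \<otimes>\<^bsub>A\<^esub> b \<otimes>\<^bsub>A\<^esub> tensor_lift K A (\<lambda>y w. f (S y) \<otimes>\<^bsub>A\<^esub> f w) (\<Delta> z)"
      by (rule sym, rule hom_tensor_lift[OF H_vs H_vs A_vs A_vs _ _ H.comult_mem[OF z],
            where g = "\<lambda>r. f x \<otimes>\<^bsub>A\<^esub> b \<otimes>\<^bsub>A\<^esub> r"]) (assumption | rule rules' x)+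
    also have "\<dots> = \<epsilon> z \<odot>\<^bsub>A\<^esub> (f x \<otimes>\<^bsub>A\<^esub> b)"
      unfolding f_antipode_left[OF z]
      using z x bA by (simp add: A.smult_mult_right H.counit_mem f_mem H.antipode_mem)
    finally show "tensor_lift K A (\<lambda>y w. f x \<otimes>\<^bsub>A\<^esub> b \<otimes>\<^bsub>A\<^esub> f (S y) \<otimes>\<^bsub>A\<^esub> f w) (\<Delta> z)
      = \<epsilon> z \<odot>\<^bsub>A\<^esub> (f x \<otimes>\<^bsub>A\<^esub> b)" .
  qed (assumption | rule rules')+
  also have "\<dots> = f h \<otimes>\<^bsub>A\<^esub> b"
    by (rule H.counit_right_lift[OF A_vs _ h]) (assumption | rule rules')+
  finally show ?thesis by simp
qed

section \<open>The quotient by the commutators with coinvariants\<close>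

abbreviation N where "N \<equiv> AB_kernel K H A \<rho>"
abbreviation Q where "Q \<equiv> AB K H A \<rho>"
abbreviation cls where "cls \<equiv> AB_class K H A \<rho>"
abbreviation QH where "QH \<equiv> tensor K Q H"
abbreviation hact where "hact \<equiv> twisted_action K \<Delta> A f (f \<circ> S)"
abbreviation Qact where "Qact \<equiv> AB_action K H \<Delta> A \<rho> f (f \<circ> S)"
abbreviation Qco where "Qco \<equiv> AB_coaction K H A \<rho>"

lemma commutators_subset:
  "{a \<otimes>\<^bsub>A\<^esub> b \<ominus>\<^bsub>A\<^esub> b \<otimes>\<^bsub>A\<^esub> a | a b. a \<in> carrier A \<and> b \<in> coinvariants K H A \<rho>} \<subseteq> carrier A"
  by (auto simp: coinvariants_def)

lemma subspace_N: "subspace K N A"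
  unfolding AB_kernel_def commutator_span_def
  by (rule vectorspace.span_is_subspace[OF A_vs commutators_subset])

lemma Q_vs: "vectorspace K Q"
  unfolding AB_def by (rule subspace.vectorspace_quotient[OF subspace_N])

lemma QH_vs: "vectorspace K QH" by (rule vectorspace_tensor[OF Q_vs H_vs])

lemma cls_hom: "cls \<in> module_hom K A Q"
  using subspace.coset_hom[OF subspace_N] by (simp add: AB_def AB_class_def[abs_def])

lemmas cls_mem = module_hom_mem[OF cls_hom]

lemma Q_carrierE:
  assumes "m \<in> carrier Q"
  obtains a where "a \<in> carrier A" "m = cls a"
  using assms subspace.quotient_carrierE[OF subspace_N] unfolding AB_def AB_class_def by metis

text \<open>
  A linear map that does not distinguish \<open>a b\<close> from \<open>b a\<close> for coinvariant \<open>b\<close> kills the commutators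
  spanning \<open>[A, B]\<close>.  Both structure maps descend by this criterion.
\<close>

lemma trace_vanishes:
  assumes U: "vectorspace K U" and g: "g \<in> module_hom K A U"
    and tr: "\<And>a b. \<lbrakk>a \<in> carrier A; b \<in> coinvariants K H A \<rho>\<rbrakk> \<Longrightarrow> g (a \<otimes>\<^bsub>A\<^esub> b) = g (b \<otimes>\<^bsub>A\<^esub> a)"
    and x: "x \<in> N"
  shows "g x = \<zero>\<^bsub>U\<^esub>"
proof (rule module_hom_vanishes_on_span[OF A_vs U g commutators_subset])
  interpret U: vectorspace K U by (rule U)
  show "x \<in> LinearCombinations.module.span K A
    {a \<otimes>\<^bsub>A\<^esub> b \<ominus>\<^bsub>A\<^esub> b \<otimes>\<^bsub>A\<^esub> a | a b. a \<in> carrier A \<and> b \<in> coinvariants K H A \<rho>}"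
    using x by (simp add: AB_kernel_def commutator_span_def)
  fix y assume "y \<in> {a \<otimes>\<^bsub>A\<^esub> b \<ominus>\<^bsub>A\<^esub> b \<otimes>\<^bsub>A\<^esub> a | a b. a \<in> carrier A \<and> b \<in> coinvariants K H A \<rho>}"
  then obtain a b where y: "y = a \<otimes>\<^bsub>A\<^esub> b \<ominus>\<^bsub>A\<^esub> b \<otimes>\<^bsub>A\<^esub> a" "a \<in> carrier A" "b \<in> coinvariants K H A \<rho>"
    by blast
  have b: "b \<in> carrier A" using y by (simp add: coinvariants_def)
  have "g y = g (b \<otimes>\<^bsub>A\<^esub> a) \<ominus>\<^bsub>U\<^esub> g (b \<otimes>\<^bsub>A\<^esub> a)"
    unfolding y(1) using y(2) b by (subst module_hom_minus[OF A_vs U g]) (simp_all add: tr[OF y(2,3)])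
  then show "g y = \<zero>\<^bsub>U\<^esub>"
    using y(2) b by (simp add: module_hom_mem[OF g] a_minus_def U.M.r_neg)
qed

lemma descend_trace:
  assumes "vectorspace K U" and "g \<in> module_hom K A U"
    and "\<And>a b. \<lbrakk>a \<in> carrier A; b \<in> coinvariants K H A \<rho>\<rbrakk> \<Longrightarrow> g (a \<otimes>\<^bsub>A\<^esub> b) = g (b \<otimes>\<^bsub>A\<^esub> a)"
  shows "descend g \<in> module_hom K Q U"
    and "a \<in> carrier A \<Longrightarrow> descend g (cls a) = g a"
  unfolding AB_def AB_class_def
  by (rule subspace.descend_hom[OF subspace_N assms(1,2) trace_vanishes[OF assms]], assumption+)
    (rule subspace.descend_coset[OF subspace_N assms(1,2) trace_vanishes[OF assms]])

lemma cls_commute: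
  assumes "a \<in> carrier A" "b \<in> coinvariants K H A \<rho>"
  shows "cls (a \<otimes>\<^bsub>A\<^esub> b) = cls (b \<otimes>\<^bsub>A\<^esub> a)"
proof -
  have b: "b \<in> carrier A" using assms by (simp add: coinvariants_def)
  have "a \<otimes>\<^bsub>A\<^esub> b \<ominus>\<^bsub>A\<^esub> b \<otimes>\<^bsub>A\<^esub> a \<in> N"
    unfolding AB_kernel_def commutator_span_def
    using module.in_own_span[OF vectorspace.axioms(1)[OF A_vs] commutators_subset] assms by blast
  then show ?thesis
    unfolding AB_class_def using assms b by (intro subspace.coset_eqI[OF subspace_N]) auto
qed

section \<open>The action on the quotient\<close>

lemma hact_eq: "hact h a = tensor_lift K A (\<lambda>x y. f y \<otimes>\<^bsub>A\<^esub> a \<otimes>\<^bsub>A\<^esub> f (S x)) (\<Delta> h)"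
  by (simp add: twisted_action_def)

lemma hact_hom: "h \<in> carrier H \<Longrightarrow> g \<in> module_hom K Z A \<Longrightarrow> vectorspace K Z
    \<Longrightarrow> (\<lambda>z. hact h (g z)) \<in> module_hom K Z A"
  and hact_hom_left: "a \<in> carrier A \<Longrightarrow> g' \<in> module_hom K Z' H \<Longrightarrow> vectorspace K Z'
    \<Longrightarrow> (\<lambda>z. hact (g' z) a) \<in> module_hom K Z' A"
  and hact_mem: "h \<in> carrier H \<Longrightarrow> a \<in> carrier A \<Longrightarrow> hact h a \<in> carrier A"
  unfolding hact_eq
  by ((assumption | rule coaction_rules | erule module_hom_mem)+)

text \<open>
  With \<open>p(y) = \<pi>(f(y) b)\<close>, the class of \<open>h(ab)\<close> is that of \<open>f(h\<^sub>3) a f(S h\<^sub>1) p(h\<^sub>2)\<close>.  Since \<open>p(h\<^sub>2)\<close> is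
  coinvariant, it may be moved to the front, and \<open>p(h\<^sub>2) f(h\<^sub>3)\<close> collapses to \<open>f(h\<^sub>2) b\<close>.
\<close>

lemma hact_trace:
  assumes h: "h \<in> carrier H" and a: "a \<in> carrier A" and b: "b \<in> coinvariants K H A \<rho>"
  shows "cls (hact h (a \<otimes>\<^bsub>A\<^esub> b)) = cls (hact h (b \<otimes>\<^bsub>A\<^esub> a))"
proof -
  have bA: "b \<in> carrier A" using b by (auto simp: coinvariants_def)
  let ?p = "\<lambda>y. coinvariant_projection (f y \<otimes>\<^bsub>A\<^esub> b)"
  note rules' = projection_rules bA a module_hom_comp[OF cls_hom] cls_mem Q_vs
  have p: "?p y \<in> coinvariants K H A \<rho>" if "y \<in> carrier H" for y
    by (rule coinvariant_projection_coinvariant) (assumption | rule rules' that)+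
  have "cls (hact h (a \<otimes>\<^bsub>A\<^esub> b)) = tensor_lift K Q (\<lambda>x y. cls (f y \<otimes>\<^bsub>A\<^esub> (a \<otimes>\<^bsub>A\<^esub> b) \<otimes>\<^bsub>A\<^esub> f (S x))) (\<Delta> h)"
    unfolding hact_eq
    by (rule hom_tensor_lift[OF H_vs H_vs A_vs Q_vs cls_hom]) (assumption | rule rules' h)+
  also have "\<dots> = tensor_lift K Q (\<lambda>z y. tensor_lift K Q
      (\<lambda>x w. cls (f y \<otimes>\<^bsub>A\<^esub> a \<otimes>\<^bsub>A\<^esub> (f (S x) \<otimes>\<^bsub>A\<^esub> ?p w))) (\<Delta> z)) (\<Delta> h)"
  proof (rule tensor_lift_cong[OF H_vs H_vs Q_vs H.comult_mem[OF h]])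
    fix z y assume z: "z \<in> carrier H" and y: "y \<in> carrier H"
    have "f y \<otimes>\<^bsub>A\<^esub> (a \<otimes>\<^bsub>A\<^esub> b) \<otimes>\<^bsub>A\<^esub> f (S z) = f y \<otimes>\<^bsub>A\<^esub> a \<otimes>\<^bsub>A\<^esub> (b \<otimes>\<^bsub>A\<^esub> f (S z))"
      using a bA z y by (simp add: A.m_assoc f_mem H.antipode_mem)
    also have "cls \<dots> = tensor_lift K Q (\<lambda>x w. cls (f y \<otimes>\<^bsub>A\<^esub> a \<otimes>\<^bsub>A\<^esub> (f (S x) \<otimes>\<^bsub>A\<^esub> ?p w))) (\<Delta> z)"
      unfolding coinvariant_mult_f_antipode[OF z b]
      by (rule hom_tensor_lift[OF H_vs H_vs A_vs Q_vs, where g = "\<lambda>r. cls (f y \<otimes>\<^bsub>A\<^esub> a \<otimes>\<^bsub>A\<^esub> r)"])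
        (assumption | rule rules' z y)+
    finally show "cls (f y \<otimes>\<^bsub>A\<^esub> (a \<otimes>\<^bsub>A\<^esub> b) \<otimes>\<^bsub>A\<^esub> f (S z))
      = tensor_lift K Q (\<lambda>x w. cls (f y \<otimes>\<^bsub>A\<^esub> a \<otimes>\<^bsub>A\<^esub> (f (S x) \<otimes>\<^bsub>A\<^esub> ?p w))) (\<Delta> z)" .
  qed (assumption | rule rules')+
  also have "\<dots> = tensor_lift K Q (\<lambda>x z. tensor_lift K Q
      (\<lambda>w y. cls (f y \<otimes>\<^bsub>A\<^esub> a \<otimes>\<^bsub>A\<^esub> (f (S x) \<otimes>\<^bsub>A\<^esub> ?p w))) (\<Delta> z)) (\<Delta> h)"
    by (rule H.comult_coassoc_lift[OF Q_vs _ h]) (assumption | rule rules')+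
  also have "\<dots> = tensor_lift K Q (\<lambda>x z. cls (f z \<otimes>\<^bsub>A\<^esub> (b \<otimes>\<^bsub>A\<^esub> a) \<otimes>\<^bsub>A\<^esub> f (S x))) (\<Delta> h)"
  proof (rule tensor_lift_cong[OF H_vs H_vs Q_vs H.comult_mem[OF h]])
    fix x z assume x: "x \<in> carrier H" and z: "z \<in> carrier H"
    have "tensor_lift K Q (\<lambda>w y. cls (f y \<otimes>\<^bsub>A\<^esub> a \<otimes>\<^bsub>A\<^esub> (f (S x) \<otimes>\<^bsub>A\<^esub> ?p w))) (\<Delta> z)
      = tensor_lift K Q (\<lambda>w y. cls (?p w \<otimes>\<^bsub>A\<^esub> f y \<otimes>\<^bsub>A\<^esub> (a \<otimes>\<^bsub>A\<^esub> f (S x)))) (\<Delta> z)"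
    proof (rule tensor_lift_cong[OF H_vs H_vs Q_vs H.comult_mem[OF z]])
      fix w y assume w: "w \<in> carrier H" and y: "y \<in> carrier H"
      have pA: "?p w \<in> carrier A" using p[OF w] by (simp add: coinvariants_def)
      have "cls ((f y \<otimes>\<^bsub>A\<^esub> a \<otimes>\<^bsub>A\<^esub> f (S x)) \<otimes>\<^bsub>A\<^esub> ?p w) = cls (?p w \<otimes>\<^bsub>A\<^esub> (f y \<otimes>\<^bsub>A\<^esub> a \<otimes>\<^bsub>A\<^esub> f (S x)))"
        by (rule cls_commute[OF _ p[OF w]]) (assumption | rule rules' x y)+
      then show "cls (f y \<otimes>\<^bsub>A\<^esub> a \<otimes>\<^bsub>A\<^esub> (f (S x) \<otimes>\<^bsub>A\<^esub> ?p w))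
        = cls (?p w \<otimes>\<^bsub>A\<^esub> f y \<otimes>\<^bsub>A\<^esub> (a \<otimes>\<^bsub>A\<^esub> f (S x)))"
        using a x y pA by (simp add: A.m_assoc f_mem H.antipode_mem)
    qed (assumption | rule rules' x)+
    also have "\<dots> = cls (tensor_lift K A (\<lambda>w y. ?p w \<otimes>\<^bsub>A\<^esub> f y) (\<Delta> z) \<otimes>\<^bsub>A\<^esub> (a \<otimes>\<^bsub>A\<^esub> f (S x)))"
      by (rule sym, rule hom_tensor_lift[OF H_vs H_vs A_vs Q_vs _ _ H.comult_mem[OF z],
            where g = "\<lambda>r. cls (r \<otimes>\<^bsub>A\<^esub> (a \<otimes>\<^bsub>A\<^esub> f (S x)))"])
        (assumption | rule rules' x)+
    also have "\<dots> = cls (f z \<otimes>\<^bsub>A\<^esub> (b \<otimes>\<^bsub>A\<^esub> a) \<otimes>\<^bsub>A\<^esub> f (S x))"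
      unfolding f_mult_coinvariant[OF z b, symmetric]
      using a bA z x by (simp add: A.m_assoc f_mem H.antipode_mem)
    finally show "tensor_lift K Q (\<lambda>w y. cls (f y \<otimes>\<^bsub>A\<^esub> a \<otimes>\<^bsub>A\<^esub> (f (S x) \<otimes>\<^bsub>A\<^esub> ?p w))) (\<Delta> z)
      = cls (f z \<otimes>\<^bsub>A\<^esub> (b \<otimes>\<^bsub>A\<^esub> a) \<otimes>\<^bsub>A\<^esub> f (S x))" .
  qed (assumption | rule rules')+
  also have "\<dots> = cls (hact h (b \<otimes>\<^bsub>A\<^esub> a))"
    unfolding hact_eq
    by (rule sym, rule hom_tensor_lift[OF H_vs H_vs A_vs Q_vs cls_hom]) (assumption | rule rules' h)+
  finally show ?thesis .
qed

lemma cls_hact_hom: "h \<in> carrier H \<Longrightarrow> (\<lambda>a. cls (hact h a)) \<in> module_hom K A Q"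
  by (rule module_hom_comp[OF cls_hom hact_hom[OF _ module_hom_ident A_vs]])

lemma Qact_hom: "h \<in> carrier H \<Longrightarrow> Qact h \<in> module_hom K Q Q"
  unfolding AB_action_def by (rule descend_trace(1)[OF Q_vs cls_hact_hom hact_trace])

lemma Qact_cls: "\<lbrakk>h \<in> carrier H; a \<in> carrier A\<rbrakk> \<Longrightarrow> Qact h (cls a) = cls (hact h a)"
  unfolding AB_action_def by (rule descend_trace(2)[OF Q_vs cls_hact_hom hact_trace])

lemma Qact_hom_left:
  assumes "m \<in> carrier Q"
  shows "(\<lambda>h. Qact h m) \<in> module_hom K H Q"
proof -
  obtain a where a: "a \<in> carrier A" "m = cls a" using Q_carrierE[OF assms] .
  have "(\<lambda>h. cls (hact h a)) \<in> module_hom K H Q"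
    by (rule module_hom_comp[OF cls_hom hact_hom_left[OF a(1) module_hom_ident H_vs]])
  then show ?thesis
    by (rule module_hom_cong[OF _ _ H_vs]) (simp add: a Qact_cls)
qed

lemma hact_one: "a \<in> carrier A \<Longrightarrow> hact \<one>\<^bsub>H\<^esub> a = a"
proof -
  assume a: "a \<in> carrier A"
  have "hact \<one>\<^bsub>H\<^esub> a = f \<one>\<^bsub>H\<^esub> \<otimes>\<^bsub>A\<^esub> a \<otimes>\<^bsub>A\<^esub> f (S \<one>\<^bsub>H\<^esub>)"
    unfolding hact_eq ring_hom_one[OF H.comult_hom] tensor_one[OF H.H_alg H.H_alg]
    by (rule tensor_lift_tens[OF H_vs H_vs A_vs]) (assumption | rule coaction_rules a)+
  then show ?thesis using a by (simp add: H.antipode_one f_one)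
qed

lemma hact_mult:
  assumes g: "g \<in> carrier H" and h: "h \<in> carrier H" and a: "a \<in> carrier A"
  shows "hact (g \<otimes>\<^bsub>H\<^esub> h) a = hact g (hact h a)"
proof -
  have "hact (g \<otimes>\<^bsub>H\<^esub> h) a = tensor_lift K A (\<lambda>x y. tensor_lift K A (\<lambda>x' y'.
      f (y \<otimes>\<^bsub>H\<^esub> y') \<otimes>\<^bsub>A\<^esub> a \<otimes>\<^bsub>A\<^esub> f (S (x \<otimes>\<^bsub>H\<^esub> x'))) (\<Delta> h)) (\<Delta> g)"
    unfolding hact_eq ring_hom_mult[OF H.comult_hom g h]
    by (rule tensor_lift_tensor_mult[OF H.H_alg H.H_alg A_vs]) (assumption | rule coaction_rules g h a)+
  also have "\<dots> = tensor_lift K A (\<lambda>x y. f y \<otimes>\<^bsub>A\<^esub> hact h a \<otimes>\<^bsub>A\<^esub> f (S x)) (\<Delta> g)"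
  proof (rule tensor_lift_cong[OF H_vs H_vs A_vs H.comult_mem[OF g]])
    fix x y assume x: "x \<in> carrier H" and y: "y \<in> carrier H"
    have "tensor_lift K A (\<lambda>x' y'. f (y \<otimes>\<^bsub>H\<^esub> y') \<otimes>\<^bsub>A\<^esub> a \<otimes>\<^bsub>A\<^esub> f (S (x \<otimes>\<^bsub>H\<^esub> x'))) (\<Delta> h)
      = tensor_lift K A (\<lambda>x' y'. f y \<otimes>\<^bsub>A\<^esub> (f y' \<otimes>\<^bsub>A\<^esub> a \<otimes>\<^bsub>A\<^esub> f (S x')) \<otimes>\<^bsub>A\<^esub> f (S x)) (\<Delta> h)"
      by (rule tensor_lift_cong[OF H_vs H_vs A_vs H.comult_mem[OF h]])
        ((assumption | rule coaction_rules x y a)+,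
         simp add: x y a f_mult f_mem H.antipode_mem H.antipode_mult A.m_assoc)
    also have "\<dots> = f y \<otimes>\<^bsub>A\<^esub> hact h a \<otimes>\<^bsub>A\<^esub> f (S x)"
      unfolding hact_eq
      by (rule sym, rule hom_tensor_lift[OF H_vs H_vs A_vs A_vs,
            where g = "\<lambda>r. f y \<otimes>\<^bsub>A\<^esub> r \<otimes>\<^bsub>A\<^esub> f (S x)"])
        (assumption | rule coaction_rules x y a h)+
    finally show "tensor_lift K A (\<lambda>x' y'. f (y \<otimes>\<^bsub>H\<^esub> y') \<otimes>\<^bsub>A\<^esub> a \<otimes>\<^bsub>A\<^esub> f (S (x \<otimes>\<^bsub>H\<^esub> x'))) (\<Delta> h)
      = f y \<otimes>\<^bsub>A\<^esub> hact h a \<otimes>\<^bsub>A\<^esub> f (S x)" .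
  qed (assumption | rule coaction_rules g h a)+
  finally show ?thesis by (simp only: hact_eq)
qed

lemma left_module_AB: "left_module K H Q Qact"
proof (intro left_module.intro left_module_axioms.intro H.H_alg Q_vs Qact_hom Qact_hom_left)
  fix g h m assume g: "g \<in> carrier H" and h: "h \<in> carrier H" and "m \<in> carrier Q"
  then obtain a where "a \<in> carrier A" "m = cls a" by (elim Q_carrierE)
  then show "Qact (g \<otimes>\<^bsub>H\<^esub> h) m = Qact g (Qact h m)"
    using g h by (simp add: Qact_cls hact_mult hact_mem)
next
  fix m assume "m \<in> carrier Q"
  then obtain a where "a \<in> carrier A" "m = cls a" by (elim Q_carrierE)
  then show "Qact \<one>\<^bsub>H\<^esub> m = m" by (simp add: Qact_cls hact_one)
qed

section \<open>The coaction on the quotient\<close>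

abbreviation proj where "proj \<equiv> tensor_map K Q H cls id"

lemma proj_hom: "proj \<in> module_hom K AH QH"
  by (rule tensor_map_hom[OF module_hom_ident cls_hom id_hom A_vs H_vs Q_vs H_vs])

lemma proj_tens: "\<lbrakk>u \<in> carrier A; h \<in> carrier H\<rbrakk> \<Longrightarrow> proj (tens K A H u h) = tens K Q H (cls u) h"
  using tensor_map_tens[OF A_vs H_vs Q_vs H_vs cls_hom id_hom] by simp

lemma lift_proj:
  assumes U: "vectorspace K U" and phi: "bilinear K Q H U \<phi>" and t: "t \<in> carrier AH"
  shows "tensor_lift K U \<phi> (proj t) = tensor_lift K U (\<lambda>u h. \<phi> (cls u) h) t"
  using tensor_lift_tensor_map[OF A_vs H_vs Q_vs H_vs U cls_hom id_hom phi t] by simp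

lemma AB_pre_coaction_trace:
  assumes a: "a \<in> carrier A" and b: "b \<in> coinvariants K H A \<rho>"
  shows "proj (\<rho> (a \<otimes>\<^bsub>A\<^esub> b)) = proj (\<rho> (b \<otimes>\<^bsub>A\<^esub> a))"
proof -
  have bA: "b \<in> carrier A" using b by (auto simp: coinvariants_def)
  note rules' = coaction_rules bA Q_vs cls_mem module_hom_comp[OF cls_hom] module_hom_comp[OF proj_hom]
  have "proj (\<rho> (a \<otimes>\<^bsub>A\<^esub> b)) = tensor_lift K QH (\<lambda>u h. proj (tens K A H (u \<otimes>\<^bsub>A\<^esub> b) h)) (\<rho> a)"
    unfolding coaction_mult_coinvariant(1)[OF a b]
    by (rule hom_tensor_lift[OF A_vs H_vs AH_vs QH_vs proj_hom]) (assumption | rule rules' a)+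
  also have "\<dots> = tensor_lift K QH (\<lambda>u h. proj (tens K A H (b \<otimes>\<^bsub>A\<^esub> u) h)) (\<rho> a)"
    by (rule tensor_lift_cong[OF A_vs H_vs QH_vs coaction_mem[OF a]])
      ((assumption | rule rules' a)+, simp add: proj_tens bA cls_commute[OF _ b])
  also have "\<dots> = proj (\<rho> (b \<otimes>\<^bsub>A\<^esub> a))"
    unfolding coaction_mult_coinvariant(2)[OF a b]
    by (rule sym, rule hom_tensor_lift[OF A_vs H_vs AH_vs QH_vs proj_hom]) (assumption | rule rules' a)+
  finally show ?thesis .
qed

lemma proj_coaction_hom: "(\<lambda>a. proj (\<rho> a)) \<in> module_hom K A QH"
  by (rule module_hom_comp[OF proj_hom coaction_linear])

lemma Qco_hom: "Qco \<in> module_hom K Q QH"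
  unfolding AB_coaction_def AB_pre_coaction_def[abs_def]
  by (rule descend_trace(1)[OF QH_vs proj_coaction_hom AB_pre_coaction_trace])

lemma Qco_cls: "a \<in> carrier A \<Longrightarrow> Qco (cls a) = proj (\<rho> a)"
  unfolding AB_coaction_def AB_pre_coaction_def[abs_def]
  by (rule descend_trace(2)[OF QH_vs proj_coaction_hom AB_pre_coaction_trace])

lemma lift_Qco_cls:
  assumes U: "vectorspace K U" and phi: "bilinear K Q H U \<phi>" and a: "a \<in> carrier A"
  shows "tensor_lift K U \<phi> (Qco (cls a)) = tensor_lift K U (\<lambda>u h. \<phi> (cls u) h) (\<rho> a)"
  unfolding Qco_cls[OF a] by (rule lift_proj[OF U phi coaction_mem[OF a]])

text \<open>
  The facts special to the quotient precede the general ones, because \<open>multilinear\<close> would reduce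
  \<open>vectorspace K Q\<close> to the claim that \<open>Q\<close> is an algebra.
\<close>

lemmas quotient_rules = Q_vs QH_vs A_vs H_vs AH_vs id_hom cls_mem module_hom_comp[OF cls_hom]
  module_hom_mem[OF proj_hom] module_hom_comp[OF proj_hom]
  module_hom_mem[OF Qco_hom] module_hom_comp[OF Qco_hom] Qact_hom[THEN module_hom_comp]
  Qact_hom[THEN module_hom_mem] Qact_hom_left[THEN module_hom_comp]
  hact_hom hact_hom_left hact_mem coaction_rules

text \<open>
  Both sides equal the image of \<open>a\<^sub>0 \<otimes> (a\<^sub>1 \<otimes> a\<^sub>2)\<close>, with the first factor reduced modulo \<open>[A, B]\<close>,
  for any representative \<open>a\<close> of \<open>m\<close>.
\<close>

lemma AB_coassoc:
  assumes m: "m \<in> carrier Q"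
  shows "tensor_assoc K Q H H (tensor_map K QH H Qco id (Qco m))
    = tensor_map K Q (tensor K H H) id \<Delta> (Qco m)"
proof -
  let ?HH = "tensor K H H"
  let ?QHH = "tensor K Q ?HH"
  let ?a = "tensor_assoc K Q H H"
  obtain a where a: "a \<in> carrier A" and m_eq: "m = cls a" using Q_carrierE[OF m] .
  have HH: "vectorspace K ?HH" and QHH: "vectorspace K ?QHH" by (rule quotient_rules)+
  have assoc_hom: "?a \<in> module_hom K (tensor K QH H) ?QHH"
    unfolding tensor_assoc_def by (rule tensor_lift_hom) (assumption | rule quotient_rules)+
  have "?a (tensor_map K QH H Qco id (Qco m)) = ?a (tensor_lift K (tensor K QH H)
      (\<lambda>u h. tens K QH H (Qco (cls u)) (id h)) (\<rho> a))"
    unfolding tensor_map_def m_eq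
    by (subst lift_Qco_cls[OF _ tensor_map_bilinear[OF Qco_hom id_hom QH_vs H_vs] a])
      ((assumption | rule quotient_rules)+, simp add: tensor_map_def)
  also have "\<dots> = tensor_lift K ?QHH (\<lambda>u h. ?a (tens K QH H (Qco (cls u)) h)) (\<rho> a)"
    unfolding id_apply
    by (rule hom_tensor_lift[OF A_vs H_vs _ QHH assoc_hom]) (assumption | rule quotient_rules a)+
  also have "\<dots> = tensor_lift K ?QHH (\<lambda>u h. tensor_lift K ?QHH
      (\<lambda>v k. tens K Q ?HH (cls v) (tens K H H k h)) (\<rho> u)) (\<rho> a)"
  proof (rule sym, rule tensor_lift_cong[OF A_vs H_vs QHH coaction_mem[OF a]])
    fix u h assume u: "u \<in> carrier A" and h: "h \<in> carrier H"
    have "?a (tens K QH H (Qco (cls u)) h)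
      = tensor_lift K ?QHH (\<lambda>q k. tens K Q ?HH q (tens K H H k h)) (Qco (cls u))"
      unfolding tensor_assoc_def by (rule tensor_lift_tens) (assumption | rule quotient_rules u h)+
    also have "\<dots> = tensor_lift K ?QHH (\<lambda>v k. tens K Q ?HH (cls v) (tens K H H k h)) (\<rho> u)"
      by (rule lift_Qco_cls[OF QHH _ u]) (assumption | rule quotient_rules h)+
    finally show "tensor_lift K ?QHH (\<lambda>v k. tens K Q ?HH (cls v) (tens K H H k h)) (\<rho> u)
      = ?a (tens K QH H (Qco (cls u)) h)" by simp
  qed (assumption | rule quotient_rules)+
  also have "\<dots> = tensor_lift K ?QHH (\<lambda>v z. tensor_lift K ?QHH
      (\<lambda>k h. tens K Q ?HH (cls v) (tens K H H k h)) (\<Delta> z)) (\<rho> a)"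
    by (rule coassoc_lift[OF QHH _ a]) (assumption | rule quotient_rules)+
  also have "\<dots> = tensor_lift K ?QHH (\<lambda>v z. tens K Q ?HH (id (cls v)) (\<Delta> z)) (\<rho> a)"
  proof (rule tensor_lift_cong[OF A_vs H_vs QHH coaction_mem[OF a]])
    fix v z assume v: "v \<in> carrier A" and z: "z \<in> carrier H"
    have "tens K Q ?HH (cls v) (tensor_lift K ?HH (tens K H H) (\<Delta> z))
      = tensor_lift K ?QHH (\<lambda>k h. tens K Q ?HH (cls v) (tens K H H k h)) (\<Delta> z)"
      by (rule hom_tensor_lift[OF H_vs H_vs HH QHH]) (assumption | rule quotient_rules v z)+
    then show "tensor_lift K ?QHH (\<lambda>k h. tens K Q ?HH (cls v) (tens K H H k h)) (\<Delta> z)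
      = tens K Q ?HH (id (cls v)) (\<Delta> z)"
      by (simp add: tensor_lift_tens_self[OF H_vs H_vs H.comult_mem[OF z]])
  qed (assumption | rule quotient_rules)+
  also have "\<dots> = tensor_map K Q ?HH id \<Delta> (Qco m)"
    unfolding tensor_map_def m_eq
    by (rule lift_Qco_cls[OF QHH tensor_map_bilinear[OF id_hom H.comult_linear Q_vs HH] a, symmetric])
  finally show ?thesis .
qed

lemma right_comodule_AB: "right_comodule K H \<Delta> \<epsilon> Q Qco"
proof (intro right_comodule.intro right_comodule_axioms.intro H.coalgebra_axioms Q_vs Qco_hom AB_coassoc)
  fix m assume m: "m \<in> carrier Q"
  obtain a where a: "a \<in> carrier A" and m_eq: "m = cls a" using Q_carrierE[OF m] .
  have "tensor_lift K Q (\<lambda>x c. \<epsilon> c \<odot>\<^bsub>Q\<^esub> x) (Qco (cls a))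
    = tensor_lift K Q (\<lambda>x c. \<epsilon> c \<odot>\<^bsub>Q\<^esub> cls x) (\<rho> a)"
    by (rule lift_Qco_cls[OF Q_vs _ a]) (assumption | rule quotient_rules)+
  also have "\<dots> = cls a" by (rule counit_lift[OF Q_vs cls_hom a])
  finally show "tensor_lift K Q (\<lambda>x c. \<epsilon> c \<odot>\<^bsub>Q\<^esub> x) (Qco m) = m" by (simp only: m_eq)
qed

section \<open>The anti Yetter-Drinfeld condition\<close>

text \<open>
  The anti Yetter-Drinfeld identity with \<open>\<rho>(a)\<close> replaced by an elementary tensor \<open>u \<otimes> p\<close>.  Both sides
  are linear in this tensor, so this case suffices.  The four coproduct legs are reached from \<open>\<Delta>\<close> of both legs of \<open>\<Delta> h\<close> on the left and from
  \<open>\<Delta>\<close> of the middle leg of a threefold coproduct on the right; two applications of coassociativity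
  relate them.
\<close>

lemma coaction_hact_tens:
  assumes h: "h \<in> carrier H" and u: "u \<in> carrier A" and p: "p \<in> carrier H"
  shows "tensor_lift K AH (\<lambda>x y. \<rho> (f y) \<otimes>\<^bsub>AH\<^esub> tens K A H u p \<otimes>\<^bsub>AH\<^esub> \<rho> (f (S x))) (\<Delta> h)
    = sweedler3 K \<Delta> AH (\<lambda>h1 h2 h3. tens K A H (hact h2 u) (h3 \<otimes>\<^bsub>H\<^esub> p \<otimes>\<^bsub>H\<^esub> S h1)) h"
proof -
  let ?\<Phi> = "\<lambda>x1 x2 y1 y2. tens K A H (f y1 \<otimes>\<^bsub>A\<^esub> u \<otimes>\<^bsub>A\<^esub> f (S x2)) (y2 \<otimes>\<^bsub>H\<^esub> p \<otimes>\<^bsub>H\<^esub> S x1)"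
  let ?L = "tensor_lift K AH"
  interpret AH: assoc_algebra K AH by (rule AH_alg)
  note rules' = quotient_rules u p h
  have "?L (\<lambda>x y. \<rho> (f y) \<otimes>\<^bsub>AH\<^esub> tens K A H u p \<otimes>\<^bsub>AH\<^esub> \<rho> (f (S x))) (\<Delta> h)
    = ?L (\<lambda>x y. ?L (\<lambda>y1 y2. ?L (\<lambda>x1 x2. ?\<Phi> x1 x2 y1 y2) (\<Delta> x)) (\<Delta> y)) (\<Delta> h)"
  proof (rule tensor_lift_cong[OF H_vs H_vs AH_vs H.comult_mem[OF h]])
    fix x y assume x: "x \<in> carrier H" and y: "y \<in> carrier H"
    have "\<rho> (f y) \<otimes>\<^bsub>AH\<^esub> tens K A H u p
      = ?L (\<lambda>y1 y2. tens K A H (f y1) y2 \<otimes>\<^bsub>AH\<^esub> tens K A H u p) (\<Delta> y)"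
      unfolding coaction_f[OF y]
      by (rule hom_tensor_lift[OF H_vs H_vs AH_vs AH_vs, where g = "\<lambda>r. r \<otimes>\<^bsub>AH\<^esub> tens K A H u p"])
        (assumption | rule rules' x y)+
    then have "\<rho> (f y) \<otimes>\<^bsub>AH\<^esub> tens K A H u p \<otimes>\<^bsub>AH\<^esub> \<rho> (f (S x))
      = ?L (\<lambda>y1 y2. tens K A H (f y1) y2 \<otimes>\<^bsub>AH\<^esub> tens K A H u p) (\<Delta> y)
        \<otimes>\<^bsub>AH\<^esub> ?L (\<lambda>x1 x2. tens K A H (f (S x2)) (S x1)) (\<Delta> x)"
      by (simp only: coaction_f_antipode[OF x])
    also have "\<dots> = ?L (\<lambda>y1 y2. ?L (\<lambda>x1 x2. tens K A H (f y1) y2 \<otimes>\<^bsub>AH\<^esub> tens K A H u p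
        \<otimes>\<^bsub>AH\<^esub> tens K A H (f (S x2)) (S x1)) (\<Delta> x)) (\<Delta> y)"
      by (rule mult_tensor_lift[OF H_vs H_vs H_vs H_vs AH_alg]) (assumption | rule rules' x y)+
    also have "\<dots> = ?L (\<lambda>y1 y2. ?L (\<lambda>x1 x2. ?\<Phi> x1 x2 y1 y2) (\<Delta> x)) (\<Delta> y)"
      by (rule tensor_lift_cong[OF H_vs H_vs AH_vs H.comult_mem[OF y]], (assumption | rule rules' x)+,
          rule tensor_lift_cong[OF H_vs H_vs AH_vs H.comult_mem[OF x]], (assumption | rule rules')+,
          simp add: tensor_mult_tens[OF A_alg H.H_alg] f_mem H.antipode_mem u p)
    finally show "\<rho> (f y) \<otimes>\<^bsub>AH\<^esub> tens K A H u p \<otimes>\<^bsub>AH\<^esub> \<rho> (f (S x))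
      = ?L (\<lambda>y1 y2. ?L (\<lambda>x1 x2. ?\<Phi> x1 x2 y1 y2) (\<Delta> x)) (\<Delta> y)" .
  qed (assumption | rule rules')+
  also have "\<dots> = ?L (\<lambda>w z. ?L (\<lambda>x y1. ?L (\<lambda>x1 x2. ?\<Phi> x1 x2 y1 z) (\<Delta> x)) (\<Delta> w)) (\<Delta> h)"
    by (rule H.comult_coassoc_lift[OF AH_vs _ h, symmetric]) (assumption | rule rules')+
  also have "\<dots> = ?L (\<lambda>w z. ?L (\<lambda>h1 h2. tens K A H (hact h2 u) (z \<otimes>\<^bsub>H\<^esub> p \<otimes>\<^bsub>H\<^esub> S h1)) (\<Delta> w)) (\<Delta> h)"
  proof (rule tensor_lift_cong[OF H_vs H_vs AH_vs H.comult_mem[OF h]])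
    fix w z assume w: "w \<in> carrier H" and z: "z \<in> carrier H"
    have "?L (\<lambda>x y1. ?L (\<lambda>x1 x2. ?\<Phi> x1 x2 y1 z) (\<Delta> x)) (\<Delta> w)
      = ?L (\<lambda>x1 v. ?L (\<lambda>x2 y1. ?\<Phi> x1 x2 y1 z) (\<Delta> v)) (\<Delta> w)"
      by (rule H.comult_coassoc_lift[OF AH_vs _ w]) (assumption | rule rules' z)+
    also have "\<dots> = ?L (\<lambda>h1 h2. tens K A H (hact h2 u) (z \<otimes>\<^bsub>H\<^esub> p \<otimes>\<^bsub>H\<^esub> S h1)) (\<Delta> w)"
    proof (rule tensor_lift_cong[OF H_vs H_vs AH_vs H.comult_mem[OF w]])
      fix x v assume x: "x \<in> carrier H" and v: "v \<in> carrier H"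
      show "?L (\<lambda>x2 y1. ?\<Phi> x x2 y1 z) (\<Delta> v) = tens K A H (hact v u) (z \<otimes>\<^bsub>H\<^esub> p \<otimes>\<^bsub>H\<^esub> S x)"
        unfolding hact_eq
        by (rule sym, rule hom_tensor_lift[OF H_vs H_vs A_vs AH_vs _ _ H.comult_mem[OF v],
              where g = "\<lambda>r. tens K A H r (z \<otimes>\<^bsub>H\<^esub> p \<otimes>\<^bsub>H\<^esub> S x)"])
          (assumption | rule rules' x z)+
    qed (assumption | rule rules' z)+
    finally show "?L (\<lambda>x y1. ?L (\<lambda>x1 x2. ?\<Phi> x1 x2 y1 z) (\<Delta> x)) (\<Delta> w)
      = ?L (\<lambda>h1 h2. tens K A H (hact h2 u) (z \<otimes>\<^bsub>H\<^esub> p \<otimes>\<^bsub>H\<^esub> S h1)) (\<Delta> w)" .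
  qed (assumption | rule rules')+
  finally show ?thesis by (simp add: sweedler3_def)
qed

lemma coaction_hact:
  assumes h: "h \<in> carrier H" and a: "a \<in> carrier A"
  shows "\<rho> (hact h a) = sweedler3 K \<Delta> AH (\<lambda>h1 h2 h3. tensor_lift K AH
      (\<lambda>u p. tens K A H (hact h2 u) (h3 \<otimes>\<^bsub>H\<^esub> p \<otimes>\<^bsub>H\<^esub> S h1)) (\<rho> a)) h"
proof -
  let ?L = "tensor_lift K AH"
  let ?G = "\<lambda>t. ?L (\<lambda>x y. \<rho> (f y) \<otimes>\<^bsub>AH\<^esub> t \<otimes>\<^bsub>AH\<^esub> \<rho> (f (S x))) (\<Delta> h)"
  let ?R = "\<lambda>t. ?L (\<lambda>w z. ?L (\<lambda>h1 h2. ?L (\<lambda>u p. tens K A H (hact h2 u) (z \<otimes>\<^bsub>H\<^esub> p \<otimes>\<^bsub>H\<^esub> S h1)) t) (\<Delta> w)) (\<Delta> h)"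
  note rules' = quotient_rules h
  have "\<rho> (hact h a) = ?L (\<lambda>x y. \<rho> (f y \<otimes>\<^bsub>A\<^esub> a \<otimes>\<^bsub>A\<^esub> f (S x))) (\<Delta> h)"
    unfolding hact_eq
    by (rule hom_tensor_lift[OF H_vs H_vs A_vs AH_vs coaction_linear]) (assumption | rule rules' a)+
  also have "\<dots> = ?G (\<rho> a)"
    by (rule tensor_lift_cong[OF H_vs H_vs AH_vs H.comult_mem[OF h]])
      ((assumption | rule rules' a)+, simp add: \<rho>_mult f_mem H.antipode_mem a)
  \<comment> \<open>Both sides are values at \<open>t = \<rho> a\<close> of linear functions of \<open>t\<close>.\<close>
  also have "\<dots> = ?R (\<rho> a)"
  proof (rule tensor_hom_eqI[OF A_vs H_vs _ _ _ coaction_mem[OF a], where g = ?G and h = ?R])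
    show "?G \<in> module_hom K AH AH" by (assumption | rule rules')+
    show "?R \<in> module_hom K AH AH" by (assumption | rule rules')+
    fix u p assume u: "u \<in> carrier A" and p: "p \<in> carrier H"
    have "?R (tens K A H u p)
      = ?L (\<lambda>w z. ?L (\<lambda>h1 h2. tens K A H (hact h2 u) (z \<otimes>\<^bsub>H\<^esub> p \<otimes>\<^bsub>H\<^esub> S h1)) (\<Delta> w)) (\<Delta> h)"
      by (rule tensor_lift_cong[OF H_vs H_vs AH_vs H.comult_mem[OF h]], (assumption | rule rules' u p)+,
          rule tensor_lift_cong[OF H_vs H_vs AH_vs H.comult_mem], assumption, (assumption | rule rules' u p)+,
          rule tensor_lift_tens[OF A_vs H_vs AH_vs]; (assumption | rule rules' u p)+)
    then show "?G (tens K A H u p) = ?R (tens K A H u p)"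
      using coaction_hact_tens[OF h u p] by (simp add: sweedler3_def)
  qed
  finally show ?thesis by (simp add: sweedler3_def)
qed

lemma AB_ayd:
  assumes h: "h \<in> carrier H" and m: "m \<in> carrier Q"
  shows "Qco (Qact h m) = sweedler3 K \<Delta> QH (\<lambda>h1 h2 h3. tensor_lift K QH (\<lambda>m0 m1.
        tens K Q H (Qact h2 m0) (h3 \<otimes>\<^bsub>H\<^esub> m1 \<otimes>\<^bsub>H\<^esub> S h1)) (Qco m)) h"
proof -
  let ?L = "tensor_lift K QH"
  obtain a where a: "a \<in> carrier A" and m_eq: "m = cls a" using Q_carrierE[OF m] .
  note rules' = quotient_rules h a
  have "Qco (Qact h m) = proj (\<rho> (hact h a))"
    by (simp add: m_eq Qact_cls Qco_cls h a hact_mem)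
  also have "\<dots> = ?L (\<lambda>w z. proj (tensor_lift K AH (\<lambda>x y. tensor_lift K AH
      (\<lambda>u p. tens K A H (hact y u) (z \<otimes>\<^bsub>H\<^esub> p \<otimes>\<^bsub>H\<^esub> S x)) (\<rho> a)) (\<Delta> w))) (\<Delta> h)"
    unfolding coaction_hact[OF h a] sweedler3_def
    by (rule hom_tensor_lift[OF H_vs H_vs AH_vs QH_vs proj_hom]) (assumption | rule rules')+
  also have "\<dots> = ?L (\<lambda>w z. ?L (\<lambda>x y. proj (tensor_lift K AH
      (\<lambda>u p. tens K A H (hact y u) (z \<otimes>\<^bsub>H\<^esub> p \<otimes>\<^bsub>H\<^esub> S x)) (\<rho> a))) (\<Delta> w)) (\<Delta> h)"
    by (rule tensor_lift_cong[OF H_vs H_vs QH_vs H.comult_mem[OF h]], (assumption | rule rules')+,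
        rule hom_tensor_lift[OF H_vs H_vs AH_vs QH_vs proj_hom]; (assumption | rule rules')+)
  also have "\<dots> = ?L (\<lambda>w z. ?L (\<lambda>x y. ?L
      (\<lambda>u p. tens K Q H (Qact y u) (z \<otimes>\<^bsub>H\<^esub> p \<otimes>\<^bsub>H\<^esub> S x)) (Qco m)) (\<Delta> w)) (\<Delta> h)"
  proof (rule tensor_lift_cong[OF H_vs H_vs QH_vs H.comult_mem[OF h]], (assumption | rule rules')+,
      rule tensor_lift_cong[OF H_vs H_vs QH_vs H.comult_mem], assumption, (assumption | rule rules')+)
    fix w z x y assume z: "z \<in> carrier H" and x: "x \<in> carrier H" and y: "y \<in> carrier H"
    have "proj (tensor_lift K AH (\<lambda>u p. tens K A H (hact y u) (z \<otimes>\<^bsub>H\<^esub> p \<otimes>\<^bsub>H\<^esub> S x)) (\<rho> a))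
      = ?L (\<lambda>u p. proj (tens K A H (hact y u) (z \<otimes>\<^bsub>H\<^esub> p \<otimes>\<^bsub>H\<^esub> S x))) (\<rho> a)"
      by (rule hom_tensor_lift[OF A_vs H_vs AH_vs QH_vs proj_hom]) (assumption | rule rules' x y z)+
    also have "\<dots> = ?L (\<lambda>u p. tens K Q H (Qact y (cls u)) (z \<otimes>\<^bsub>H\<^esub> p \<otimes>\<^bsub>H\<^esub> S x)) (\<rho> a)"
      by (rule tensor_lift_cong[OF A_vs H_vs QH_vs coaction_mem[OF a]])
        ((assumption | rule rules' x y z)+,
         simp add: Qact_cls proj_tens hact_mem H.antipode_mem x y z)
    also have "\<dots> = ?L (\<lambda>u p. tens K Q H (Qact y u) (z \<otimes>\<^bsub>H\<^esub> p \<otimes>\<^bsub>H\<^esub> S x)) (Qco m)"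
      unfolding m_eq by (rule lift_Qco_cls[OF QH_vs _ a, symmetric]) (assumption | rule rules' x y z)+
    finally show "proj (tensor_lift K AH (\<lambda>u p. tens K A H (hact y u) (z \<otimes>\<^bsub>H\<^esub> p \<otimes>\<^bsub>H\<^esub> S x)) (\<rho> a))
      = ?L (\<lambda>u p. tens K Q H (Qact y u) (z \<otimes>\<^bsub>H\<^esub> p \<otimes>\<^bsub>H\<^esub> S x)) (Qco m)" .
  qed
  finally show ?thesis by (simp add: sweedler3_def)
qed

lemma anti_yetter_drinfeld_AB: "anti_yetter_drinfeld K H \<Delta> \<epsilon> S Q Qact Qco"
  by (intro anti_yetter_drinfeld.intro anti_yetter_drinfeld_axioms.intro H.hopf_algebra_axioms
      left_module_AB right_comodule_AB AB_ayd)

section \<open>Stability\<close>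

text \<open>
  The summands \<open>f(a\<^sub>2) a\<^sub>0 f(S a\<^sub>1)\<close> regroup to \<open>f(a\<^sub>1) \<pi>(a\<^sub>0)\<close>; the coinvariant factor commutes with
  \<open>f(a\<^sub>1)\<close> modulo \<open>[A, B]\<close>, and \<open>\<pi>(a\<^sub>0) f(a\<^sub>1)\<close> is the expression in the stability hypothesis.
\<close>

lemma stable_AB:
  assumes stab: "\<And>a. a \<in> carrier A \<Longrightarrow> tensor_lift K A (\<lambda>a0 a1.
      tensor_lift K A (\<lambda>x y. a0 \<otimes>\<^bsub>A\<^esub> f (S x) \<otimes>\<^bsub>A\<^esub> f y) (\<Delta> a1)) (\<rho> a) = a"
  shows "stable_module K Q Qact Qco"
  unfolding stable_module_def
proof
  fix m assume m: "m \<in> carrier Q"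
  obtain a where a: "a \<in> carrier A" and m_eq: "m = cls a" using Q_carrierE[OF m] .
  note rules' = quotient_rules a coinvariant_projection_mem module_hom_comp[OF coinvariant_projection_hom]
  have "tensor_lift K Q (\<lambda>m0 m1. Qact m1 m0) (Qco m) = tensor_lift K Q (\<lambda>u h. Qact h (cls u)) (\<rho> a)"
    unfolding m_eq by (rule lift_Qco_cls[OF Q_vs _ a]) (assumption | rule rules')+
  also have "\<dots> = tensor_lift K Q (\<lambda>u h. tensor_lift K Q
      (\<lambda>x y. cls (f y \<otimes>\<^bsub>A\<^esub> u \<otimes>\<^bsub>A\<^esub> f (S x))) (\<Delta> h)) (\<rho> a)"
  proof (rule tensor_lift_cong[OF A_vs H_vs Q_vs coaction_mem[OF a]])
    fix u h assume u: "u \<in> carrier A" and h: "h \<in> carrier H"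
    show "Qact h (cls u) = tensor_lift K Q (\<lambda>x y. cls (f y \<otimes>\<^bsub>A\<^esub> u \<otimes>\<^bsub>A\<^esub> f (S x))) (\<Delta> h)"
      unfolding Qact_cls[OF h u] hact_eq
      by (rule hom_tensor_lift[OF H_vs H_vs A_vs Q_vs cls_hom]) (assumption | rule rules' u h)+
  qed (assumption | rule rules')+
  also have "\<dots> = tensor_lift K Q (\<lambda>w y. tensor_lift K Q
      (\<lambda>u x. cls (f y \<otimes>\<^bsub>A\<^esub> u \<otimes>\<^bsub>A\<^esub> f (S x))) (\<rho> w)) (\<rho> a)"
    by (rule coassoc_lift[OF Q_vs _ a, symmetric]) (assumption | rule rules')+
  also have "\<dots> = tensor_lift K Q (\<lambda>w y. cls (coinvariant_projection w \<otimes>\<^bsub>A\<^esub> f y)) (\<rho> a)"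
  proof (rule tensor_lift_cong[OF A_vs H_vs Q_vs coaction_mem[OF a]])
    fix w y assume w: "w \<in> carrier A" and y: "y \<in> carrier H"
    have "tensor_lift K Q (\<lambda>u x. cls (f y \<otimes>\<^bsub>A\<^esub> u \<otimes>\<^bsub>A\<^esub> f (S x))) (\<rho> w)
      = tensor_lift K Q (\<lambda>u x. cls (f y \<otimes>\<^bsub>A\<^esub> (u \<otimes>\<^bsub>A\<^esub> f (S x)))) (\<rho> w)"
      by (rule tensor_lift_cong[OF A_vs H_vs Q_vs coaction_mem[OF w]])
        ((assumption | rule rules' y)+, simp add: A.m_assoc f_mem H.antipode_mem y)
    also have "\<dots> = cls (f y \<otimes>\<^bsub>A\<^esub> coinvariant_projection w)"
      unfolding coinvariant_projection_def
      by (rule sym, rule hom_tensor_lift[OF A_vs H_vs A_vs Q_vs _ _ coaction_mem[OF w],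
            where g = "\<lambda>r. cls (f y \<otimes>\<^bsub>A\<^esub> r)"])
        (assumption | rule rules' y)+
    also have "\<dots> = cls (coinvariant_projection w \<otimes>\<^bsub>A\<^esub> f y)"
      by (rule cls_commute[OF f_mem[OF y] coinvariant_projection_coinvariant[OF w]])
    finally show "tensor_lift K Q (\<lambda>u x. cls (f y \<otimes>\<^bsub>A\<^esub> u \<otimes>\<^bsub>A\<^esub> f (S x))) (\<rho> w)
      = cls (coinvariant_projection w \<otimes>\<^bsub>A\<^esub> f y)" .
  qed (assumption | rule rules')+
  also have "\<dots> = cls (tensor_lift K A (\<lambda>w y. coinvariant_projection w \<otimes>\<^bsub>A\<^esub> f y) (\<rho> a))"
    by (rule sym, rule hom_tensor_lift[OF A_vs H_vs A_vs Q_vs cls_hom]) (assumption | rule rules')+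
  also have "tensor_lift K A (\<lambda>w y. coinvariant_projection w \<otimes>\<^bsub>A\<^esub> f y) (\<rho> a)
    = tensor_lift K A (\<lambda>w y. tensor_lift K A (\<lambda>u x. u \<otimes>\<^bsub>A\<^esub> f (S x) \<otimes>\<^bsub>A\<^esub> f y) (\<rho> w)) (\<rho> a)"
  proof (rule tensor_lift_cong[OF A_vs H_vs A_vs coaction_mem[OF a]])
    fix w y assume w: "w \<in> carrier A" and y: "y \<in> carrier H"
    show "coinvariant_projection w \<otimes>\<^bsub>A\<^esub> f y
      = tensor_lift K A (\<lambda>u x. u \<otimes>\<^bsub>A\<^esub> f (S x) \<otimes>\<^bsub>A\<^esub> f y) (\<rho> w)"
      unfolding coinvariant_projection_def
      by (rule hom_tensor_lift[OF A_vs H_vs A_vs A_vs, where g = "\<lambda>r. r \<otimes>\<^bsub>A\<^esub> f y"])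
        (assumption | rule rules' w y)+
  qed (assumption | rule rules')+
  also have "\<dots> = tensor_lift K A (\<lambda>u h. tensor_lift K A (\<lambda>x y. u \<otimes>\<^bsub>A\<^esub> f (S x) \<otimes>\<^bsub>A\<^esub> f y) (\<Delta> h)) (\<rho> a)"
    by (rule coassoc_lift[OF A_vs _ a]) (assumption | rule rules')+
  also have "\<dots> = a" by (rule stab[OF a])
  finally show "tensor_lift K Q (\<lambda>m0 m1. Qact m1 m0) (Qco m) = m" by (simp only: m_eq)
qed

end

theorem proposition3p3:
  fixes K :: "('k, 'r) ring_scheme"
    and H :: "('k, 'h, 'm) module_scheme"
    and \<Delta> :: "'h \<Rightarrow> ('h \<times> 'h \<Rightarrow> 'k) set"
    and \<epsilon> :: "'h \<Rightarrow> 'k"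
    and S :: "'h \<Rightarrow> 'h"
    and A :: "('k, 'a, 'n) module_scheme"
    and \<rho> :: "'a \<Rightarrow> ('a \<times> 'h \<Rightarrow> 'k) set"
    and f :: "'h \<Rightarrow> 'a"
  assumes "hopf_algebra K H \<Delta> \<epsilon> S"
    and "bij_betw S (carrier H) (carrier H)"
    and "comodule_algebra K H \<Delta> \<epsilon> S A \<rho>"
    and "total_integral K H \<Delta> A \<rho> f"
    and "f \<in> ring_hom H A"
  shows "convolution_inverse K H \<Delta> \<epsilon> A f (f \<circ> S)
    \<and> (\<forall>a\<in>carrier A.
          AB_coaction K H A \<rho> (AB_class K H A \<rho> a)
            = tensor_map K (AB K H A \<rho>) H (AB_class K H A \<rho>) id (\<rho> a))
    \<and> (\<forall>h\<in>carrier H. \<forall>a\<in>carrier A.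
          AB_action K H \<Delta> A \<rho> f (f \<circ> S) h (AB_class K H A \<rho> a)
            = AB_class K H A \<rho>
                (tensor_lift K A (\<lambda>h1 h2. f h2 \<otimes>\<^bsub>A\<^esub> a \<otimes>\<^bsub>A\<^esub> (f \<circ> S) h1) (\<Delta> h)))
    \<and> anti_yetter_drinfeld K H \<Delta> \<epsilon> S (AB K H A \<rho>)
        (AB_action K H \<Delta> A \<rho> f (f \<circ> S)) (AB_coaction K H A \<rho>)
    \<and> ((\<forall>a\<in>carrier A.
          tensor_lift K A (\<lambda>a0 a1.
            tensor_lift K A (\<lambda>x y. a0 \<otimes>\<^bsub>A\<^esub> (f \<circ> S) x \<otimes>\<^bsub>A\<^esub> f y) (\<Delta> a1)) (\<rho> a) = a)
       \<longrightarrow> stable_module K (AB K H A \<rho>)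
             (AB_action K H \<Delta> A \<rho> f (f \<circ> S)) (AB_coaction K H A \<rho>))"
proof -
  interpret integral_comodule_algebra K H \<Delta> \<epsilon> S A \<rho> f
    by (intro integral_comodule_algebra.intro integral_comodule_algebra_axioms.intro assms)
  show ?thesis
    using convolution_inverse_integral Qco_cls Qact_cls anti_yetter_drinfeld_AB stable_AB
    by (simp add: hact_eq)
qed

end
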